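(* Let $\Omega\subset\mathbb{R}^d$ be a bounded domain, let $V_1,V_2\in L^\infty(\Omega)$ be real-valued with $V_1\ge0$, and let $X_h\subset H^1_0(\Omega)$, $h>0$, be a family of conforming finite element subspaces. With the notation defined in the context, let $$T=(-\Delta+V_1)^{-1}(-\Delta+V_1+V_2)=I+K,\qquad T_h=(-\Delta_h+V_{1,h})^{-1}(-\Delta_h+V_{1,h}+V_{2,h})=I_h+K_h,$$ where $I_h$ is the identity on $X_h$, be the continuous and discrete preconditioned operators, on $H^1_0(\Omega)$ and $X_h$ respectively, and let $\widetilde K_h=\Pi_hK\Pi_h:H^1_0(\Omega)\to H^1_0(\Omega)$. Then: (i) (Norm convergence.) $\|\widetilde K_h-K\|\to0$ as $h\to0$ in the operator norm on $(H^1_0(\Omega),\|\cdot\|_A)$. (ii) (Spectral convergence and clustering.) For every $\epsilon>0$, $T_h$ has at most $M(\epsilon)$ eigenvalues outside $(1-\epsilon,1+\epsilon)$, where $M(\epsilon)<\infty$ is independent of $h$. Each nonzero eigenvalue $\mu$ of $K$ with multiplicity $m$ is approximated by exactly $m$ eigenvalues of $K_h$ (counted with multiplicity) converging to $\mu$ as $h\to0$. (iii) (Uniform condition number.) If $-\Delta+V_1+V_2>0$, then $\kappa(T_h)\le\kappa(T)$ for every $h$, and $\kappa(T_h)\to\kappa(T)$ as $h\to0$.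
   Context: All function spaces are real. On $H^1_0(\Omega)$ define the inner product $$\langle u,v\rangle_A=\int_\Omega(\nabla u\cdot\nabla v+V_1uv)\,\mathrm{d}\boldsymbol{x},$$ with norm $\|\cdot\|_A$, which is equivalent to the standard $H^1$ norm. The spaces $X_h\subset H^1_0(\Omega)$ are finite-dimensional conforming finite element spaces with mesh parameter $h>0$ that are asymptotically dense: for every $u\in H^1_0(\Omega)$, $\inf_{v_h\in X_h}\|u-v_h\|_A\to0$ as $h\to0$. Define: - $K:H^1_0(\Omega)\to H^1_0(\Omega)$ by $\langle Ku,v\rangle_A=\int_\Omega V_2uv\,\mathrm{d}\boldsymbol{x}$ for all $v\in H^1_0(\Omega)$, i.e. $K=(-\Delta+V_1)^{-1}V_2$, where $(-\Delta+V_1)^{-1}$ is the weak Dirichlet solution operator ($\langle(-\Delta+V_1)^{-1}f,v\rangle_A=(f,v)_{L^2}$ for all $v\in H^1_0(\Omega)$). - $K_h:X_h\to X_h$ by $\langle K_hu_h,v_h\rangle_A=\int_\Omega V_2u_hv_h\,\mathrm{d}\boldsymbol{x}$ for all $v_h\in X_h$. - $\Pi_h:H^1_0(\Omega)\to X_h$, the $\langle\cdot,\cdot\rangle_A$-orthogonal projection: $\langle\Pi_hu,v_h\rangle_A=\langle u,v_h\rangle_A$ for all $v_h\in X_h$. - The Galerkin operators on $X_h$: $((-\Delta_h+V_{1,h})u_h,v_h)_{L^2}=\langle u_h,v_h\rangle_A$ and $((-\Delta_h+V_{1,h}+V_{2,h})u_h,v_h)_{L^2}=\langle u_h,v_h\rangle_A+\int_\Omega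 V_2u_hv_h\,\mathrm{d}\boldsymbol{x}$ for all $u_h,v_h\in X_h$. The operator $T$ is understood weakly: $\langle Tu,v\rangle_A=\langle u,v\rangle_A+\int_\Omega V_2uv\,\mathrm{d}\boldsymbol{x}$ for all $u,v\in H^1_0(\Omega)$. $T$ and $T_h$ are self-adjoint with respect to $\langle\cdot,\cdot\rangle_A$. Eigenvalues are counted with multiplicity. The condition $-\Delta+V_1+V_2>0$ means $\int_\Omega(|\nabla u|^2+(V_1+V_2)u^2)\,\mathrm{d}\boldsymbol{x}>0$ for all $0\ne u\in H^1_0(\Omega)$. For such positive self-adjoint $S\in\{T,T_h\}$, $\kappa(S)=\mu_{\max}(S)/\mu_{\min}(S)$, where $\mu_{\max}(S)$ and $\mu_{\min}(S)$ are the supremum and infimum of $\langle Su,u\rangle_A$ over $\|u\|_A=1$ in the space on which $S$ acts ($H^1_0(\Omega)$ for $T$, $X_h$ for $T_h$). *)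

theory Defs
  imports "HOL-Analysis.Analysis"
begin

section \<open>The Hilbert space of square-integrable functions\<close>

definition square_integrable :: "('a::euclidean_space \<Rightarrow> real) \<Rightarrow> bool" where
  "square_integrable f \<longleftrightarrow>
     f \<in> borel_measurable lebesgue \<and> integrable lebesgue (\<lambda>x. (f x)\<^sup>2)"

definition L2_eq :: "('a::euclidean_space \<Rightarrow> real) \<Rightarrow> ('a \<Rightarrow> real) \<Rightarrow> bool" where
  "L2_eq f g \<longleftrightarrow>
     square_integrable f \<and> square_integrable g \<and> (AE x in lebesgue. f x = g x)"

lemma square_integrable_zero: "square_integrable (\<lambda>x. 0)"
  by (simp add: square_integrable_def)

lemma square_integrable_mult:
  assumes "square_integrable f" "square_integrable g"
  shows "integrable lebesgue (\<lambda>x. f x * g x)"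
proof (rule Bochner_Integration.integrable_bound)
  show "integrable lebesgue (\<lambda>x. (f x)\<^sup>2 + (g x)\<^sup>2)"
    using assms by (simp add: square_integrable_def)
  show "(\<lambda>x. f x * g x) \<in> borel_measurable lebesgue"
    using assms by (auto simp: square_integrable_def intro: borel_measurable_times)
  have "\<bar>a * b\<bar> \<le> a\<^sup>2 + b\<^sup>2" for a b :: real
  proof -
    have "2 * (\<bar>a\<bar> * \<bar>b\<bar>) \<le> a\<^sup>2 + b\<^sup>2"
      using sum_squares_bound[of "\<bar>a\<bar>" "\<bar>b\<bar>"] by simp
    moreover have "0 \<le> \<bar>a\<bar> * \<bar>b\<bar>" by simp
    ultimately show ?thesis unfolding abs_mult by linarith
  qed
  then show "AE x in lebesgue. norm (f x * g x) \<le> norm ((f x)\<^sup>2 + (g x)\<^sup>2)"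
    by simp
qed

lemma square_integrable_add:
  assumes "square_integrable f" "square_integrable g"
  shows "square_integrable (\<lambda>x. f x + g x)"
  using assms square_integrable_mult[OF assms]
  by (auto simp: square_integrable_def power2_sum mult.assoc)

lemma square_integrable_cmult:
  assumes "square_integrable f"
  shows "square_integrable (\<lambda>x. c * f x)"
  using assms by (auto simp: square_integrable_def power_mult_distrib)

lemma square_integrable_uminus:
  assumes "square_integrable f"
  shows "square_integrable (\<lambda>x. - f x)"
  using square_integrable_cmult[OF assms, of "-1"] by simp

lemma square_integrable_diff:
  assumes "square_integrable f" "square_integrable g"
  shows "square_integrable (\<lambda>x. f x - g x)"
  using square_integrable_add[OF assms(1) square_integrable_uminus[OF assms(2)]] by simp

quotient_type (overloaded) 'a L2 = "'a::euclidean_space \<Rightarrow> real" / partial: L2_eq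
proof (rule part_equivpI)
  show "\<exists>f::'a \<Rightarrow> real. L2_eq f f"
    using square_integrable_zero by (auto simp: L2_eq_def)
  show "symp (L2_eq :: ('a \<Rightarrow> real) \<Rightarrow> _)"
    by (auto simp: symp_def L2_eq_def)
  show "transp (L2_eq :: ('a \<Rightarrow> real) \<Rightarrow> _)"
    unfolding transp_def L2_eq_def by (auto elim: AE_mp)
qed

instantiation L2 :: (euclidean_space) real_inner
begin

lift_definition zero_L2 :: "'a L2" is "\<lambda>x. 0"
  by (simp add: L2_eq_def square_integrable_zero)

lift_definition plus_L2 :: "'a L2 \<Rightarrow> 'a L2 \<Rightarrow> 'a L2" is "\<lambda>f g x. f x + g x"
  unfolding L2_eq_def by (auto intro: square_integrable_add)

lift_definition uminus_L2 :: "'a L2 \<Rightarrow> 'a L2" is "\<lambda>f x. - f x"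
  unfolding L2_eq_def by (auto intro: square_integrable_uminus)

lift_definition minus_L2 :: "'a L2 \<Rightarrow> 'a L2 \<Rightarrow> 'a L2" is "\<lambda>f g x. f x - g x"
  unfolding L2_eq_def by (auto intro: square_integrable_diff)

lift_definition scaleR_L2 :: "real \<Rightarrow> 'a L2 \<Rightarrow> 'a L2" is "\<lambda>c f x. c * f x"
  unfolding L2_eq_def by (auto intro: square_integrable_cmult)

lift_definition inner_L2 :: "'a L2 \<Rightarrow> 'a L2 \<Rightarrow> real" is
  "\<lambda>f g. LINT x|lebesgue. f x * g x"
  unfolding L2_eq_def square_integrable_def
  by (intro integral_cong_AE) auto

definition norm_L2 :: "'a L2 \<Rightarrow> real" where
  "norm_L2 u = sqrt (inner u u)"

definition dist_L2 :: "'a L2 \<Rightarrow> 'a L2 \<Rightarrow> real" where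
  "dist_L2 u v = norm (u - v)"

definition sgn_L2 :: "'a L2 \<Rightarrow> 'a L2" where
  "sgn_L2 u = scaleR (inverse (norm u)) u"

definition uniformity_L2 :: "('a L2 \<times> 'a L2) filter" where
  "uniformity_L2 = (INF e\<in>{0<..}. principal {(u, v). dist u v < e})"

definition open_L2 :: "'a L2 set \<Rightarrow> bool" where
  "open_L2 U \<longleftrightarrow> (\<forall>u\<in>U. eventually (\<lambda>(u', v). u' = u \<longrightarrow> v \<in> U) uniformity)"

instance
proof
  fix u v w :: "'a L2" and a b :: real
  show "u + v + w = u + (v + w)"
    by transfer (auto simp: L2_eq_def add.assoc intro!: square_integrable_add)
  show "u + v = v + u"
    by transfer (auto simp: L2_eq_def add.commute intro!: square_integrable_add)
  show "0 + u = u"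
    by transfer (auto simp: L2_eq_def)
  show "- u + u = 0"
    by transfer (auto simp: L2_eq_def square_integrable_zero)
  show "u - v = u + - v"
    by transfer (auto simp: L2_eq_def intro!: square_integrable_diff)
  show "a *\<^sub>R (u + v) = a *\<^sub>R u + a *\<^sub>R v"
    by transfer (auto simp: L2_eq_def distrib_left
        intro!: square_integrable_add square_integrable_cmult)
  show "(a + b) *\<^sub>R u = a *\<^sub>R u + b *\<^sub>R u"
    by transfer (auto simp: L2_eq_def distrib_right
        intro!: square_integrable_add square_integrable_cmult)
  show "a *\<^sub>R b *\<^sub>R u = (a * b) *\<^sub>R u"
    by transfer (auto simp: L2_eq_def mult.assoc[symmetric] intro!: square_integrable_cmult)
  show "1 *\<^sub>R u = u"
    by transfer (auto simp: L2_eq_def)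
  show "dist u v = norm (u - v)"
    by (rule dist_L2_def)
  show "sgn u = scaleR (inverse (norm u)) u"
    by (rule sgn_L2_def)
  show "uniformity = (INF e\<in>{0<..}. principal {(u::'a L2, v). dist u v < e})"
    by (rule uniformity_L2_def)
  show "open U \<longleftrightarrow> (\<forall>u\<in>U. \<forall>\<^sub>F (u', v) in uniformity. u' = u \<longrightarrow> v \<in> U)"
    for U :: "'a L2 set"
    by (rule open_L2_def)
  show "inner u v = inner v u"
    by transfer (simp add: mult.commute)
  show "inner (u + v) w = inner u w + inner v w"
    by transfer (auto simp: L2_eq_def distrib_right square_integrable_mult)
  show "inner (a *\<^sub>R u) v = a * inner u v"
    by transfer (simp add: mult.assoc)
  show "0 \<le> inner u u"
    by transfer simp
  show "inner u u = 0 \<longleftrightarrow> u = 0"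
  proof (transfer)
    fix f :: "'a \<Rightarrow> real"
    assume "L2_eq f f"
    then have f: "square_integrable f" by (simp add: L2_eq_def)
    have "(LINT x|lebesgue. f x * f x) = 0 \<longleftrightarrow> (AE x in lebesgue. f x * f x = 0)"
      using square_integrable_mult[OF f f] by (intro integral_nonneg_eq_0_iff_AE) auto
    then show "(LINT x|lebesgue. f x * f x) = 0 \<longleftrightarrow> L2_eq f (\<lambda>x. 0)"
      using f by (simp add: L2_eq_def square_integrable_zero)
  qed
  show "norm u = sqrt (inner u u)"
    by (rule norm_L2_def)
qed

end


section \<open>Sobolev spaces\<close>

text \<open>
  Functions on \<open>\<Omega>\<close> are identified with their extensions by zero, so that the Sobolev spaces
  over the various \<open>\<Omega>\<close> are linear subspaces of the one type \<^typ>\<open>'a L2\<close>.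
\<close>

definition L2_on :: "'a::euclidean_space set \<Rightarrow> 'a L2 set" where
  "L2_on \<Omega> = {u. AE x in lebesgue. x \<notin> \<Omega> \<longrightarrow> rep_L2 u x = 0}"

definition Linfty_on :: "'a::euclidean_space set \<Rightarrow> ('a \<Rightarrow> real) set" where
  "Linfty_on \<Omega> = {V. set_borel_measurable lebesgue \<Omega> V \<and>
     (\<exists>C. AE x\<in>\<Omega> in lebesgue. \<bar>V x\<bar> \<le> C)}"

definition partial_deriv :: "'a::euclidean_space \<Rightarrow> ('a \<Rightarrow> real) \<Rightarrow> 'a \<Rightarrow> real" where
  "partial_deriv i f x = frechet_derivative f (at x) i"

primrec Ck :: "nat \<Rightarrow> ('a::euclidean_space \<Rightarrow> real) \<Rightarrow> bool" where
  "Ck 0 f \<longleftrightarrow> continuous_on UNIV f"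
| "Ck (Suc k) f \<longleftrightarrow>
     (\<forall>x. f differentiable (at x)) \<and> (\<forall>i\<in>Basis. Ck k (partial_deriv i f))"

definition test_functions :: "'a::euclidean_space set \<Rightarrow> ('a \<Rightarrow> real) set" where
  "test_functions \<Omega> = {\<phi>. (\<forall>k. Ck k \<phi>) \<and>
     compact (closure {x. \<phi> x \<noteq> 0}) \<and> closure {x. \<phi> x \<noteq> 0} \<subseteq> \<Omega>}"

definition is_weak_deriv ::
    "'a::euclidean_space set \<Rightarrow> 'a \<Rightarrow> 'a L2 \<Rightarrow> 'a L2 \<Rightarrow> bool" where
  "is_weak_deriv \<Omega> i u g \<longleftrightarrow> g \<in> L2_on \<Omega> \<and>
     (\<forall>\<phi>\<in>test_functions \<Omega>.
        (LINT x:\<Omega>|lebesgue. rep_L2 u x * partial_deriv i \<phi> x) =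
        - (LINT x:\<Omega>|lebesgue. rep_L2 g x * \<phi> x))"

definition weak_deriv :: "'a::euclidean_space set \<Rightarrow> 'a \<Rightarrow> 'a L2 \<Rightarrow> 'a L2" where
  "weak_deriv \<Omega> i u = (THE g. is_weak_deriv \<Omega> i u g)"

definition weak_grad :: "'a::euclidean_space set \<Rightarrow> 'a L2 \<Rightarrow> 'a \<Rightarrow> 'a" where
  "weak_grad \<Omega> u x = (\<Sum>i\<in>Basis. rep_L2 (weak_deriv \<Omega> i u) x *\<^sub>R i)"

definition H1 :: "'a::euclidean_space set \<Rightarrow> 'a L2 set" where
  "H1 \<Omega> = {u \<in> L2_on \<Omega>. \<forall>i\<in>Basis. \<exists>g. is_weak_deriv \<Omega> i u g}"

definition H1_norm :: "'a::euclidean_space set \<Rightarrow> 'a L2 \<Rightarrow> real" where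
  "H1_norm \<Omega> u =
     sqrt (LINT x:\<Omega>|lebesgue. (rep_L2 u x)\<^sup>2 + (norm (weak_grad \<Omega> u x))\<^sup>2)"

definition H10 :: "'a::euclidean_space set \<Rightarrow> 'a L2 set" where
  "H10 \<Omega> = {u \<in> H1 \<Omega>. \<forall>e>0. \<exists>\<phi>\<in>test_functions \<Omega>. H1_norm \<Omega> (u - abs_L2 \<phi>) < e}"


section \<open>Forms and operators\<close>

definition potential_form ::
    "'a::euclidean_space set \<Rightarrow> ('a \<Rightarrow> real) \<Rightarrow> 'a L2 \<Rightarrow> 'a L2 \<Rightarrow> real" where
  "potential_form \<Omega> V u v = (LINT x:\<Omega>|lebesgue. V x * rep_L2 u x * rep_L2 v x)"

text \<open>
  The form of \<open>- \<Delta> + V\<close>; for \<open>V = V\<^sub>1\<close> it is the inner product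
  \<open>\<langle>u, v\<rangle>\<^sub>A\<close>.
\<close>

definition energy_form ::
    "'a::euclidean_space set \<Rightarrow> ('a \<Rightarrow> real) \<Rightarrow> 'a L2 \<Rightarrow> 'a L2 \<Rightarrow> real" where
  "energy_form \<Omega> V u v =
     (LINT x:\<Omega>|lebesgue.
        weak_grad \<Omega> u x \<bullet> weak_grad \<Omega> v x + V x * rep_L2 u x * rep_L2 v x)"

definition norm_A :: "'a::euclidean_space set \<Rightarrow> ('a \<Rightarrow> real) \<Rightarrow> 'a L2 \<Rightarrow> real" where
  "norm_A \<Omega> V1 u = sqrt (energy_form \<Omega> V1 u u)"

definition represent :: "'b set \<Rightarrow> ('b \<Rightarrow> 'b \<Rightarrow> real) \<Rightarrow> ('b \<Rightarrow> real) \<Rightarrow> 'b" where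
  "represent W b F = (THE w. w \<in> W \<and> (\<forall>v\<in>W. b w v = F v))"

text \<open>
  The weak solution operator \<open>(- \<Delta> + V\<^sub>1)\<^sup>-\<^sup>1\<close>, taking as its datum the functional
  \<open>v \<mapsto> (f, v)\<close>, so that it also applies to data \<open>f\<close> in the dual of
  \<^term>\<open>H10 \<Omega>\<close>.
\<close>

definition weak_solve ::
    "'a::euclidean_space set \<Rightarrow> ('a \<Rightarrow> real) \<Rightarrow> ('a L2 \<Rightarrow> real) \<Rightarrow> 'a L2" where
  "weak_solve \<Omega> V1 F = represent (H10 \<Omega>) (energy_form \<Omega> V1) F"

definition op_K ::
    "'a::euclidean_space set \<Rightarrow> ('a \<Rightarrow> real) \<Rightarrow> ('a \<Rightarrow> real) \<Rightarrow> 'a L2 \<Rightarrow> 'a L2" where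
  "op_K \<Omega> V1 V2 u = weak_solve \<Omega> V1 (\<lambda>v. potential_form \<Omega> V2 u v)"

definition op_T ::
    "'a::euclidean_space set \<Rightarrow> ('a \<Rightarrow> real) \<Rightarrow> ('a \<Rightarrow> real) \<Rightarrow> 'a L2 \<Rightarrow> 'a L2" where
  "op_T \<Omega> V1 V2 u =
     weak_solve \<Omega> V1 (\<lambda>v. energy_form \<Omega> V1 u v + potential_form \<Omega> V2 u v)"

text \<open>In the discrete operators, \<open>W\<close> is the finite element space \<open>X\<^sub>h\<close>.\<close>

definition op_Kh ::
    "'a::euclidean_space set \<Rightarrow> ('a \<Rightarrow> real) \<Rightarrow> ('a \<Rightarrow> real) \<Rightarrow> 'a L2 set \<Rightarrow> 'a L2 \<Rightarrow> 'a L2"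
  where
  "op_Kh \<Omega> V1 V2 W u = represent W (energy_form \<Omega> V1) (\<lambda>v. potential_form \<Omega> V2 u v)"

definition proj_A ::
    "'a::euclidean_space set \<Rightarrow> ('a \<Rightarrow> real) \<Rightarrow> 'a L2 set \<Rightarrow> 'a L2 \<Rightarrow> 'a L2" where
  "proj_A \<Omega> V1 W u = represent W (energy_form \<Omega> V1) (\<lambda>v. energy_form \<Omega> V1 u v)"

definition galerkin_V1 ::
    "'a::euclidean_space set \<Rightarrow> ('a \<Rightarrow> real) \<Rightarrow> 'a L2 set \<Rightarrow> 'a L2 \<Rightarrow> 'a L2" where
  "galerkin_V1 \<Omega> V1 W u = represent W inner (\<lambda>v. energy_form \<Omega> V1 u v)"

definition galerkin_V1_V2 ::
    "'a::euclidean_space set \<Rightarrow> ('a \<Rightarrow> real) \<Rightarrow> ('a \<Rightarrow> real) \<Rightarrow> 'a L2 set \<Rightarrow> 'a L2 \<Rightarrow> 'a L2"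
  where
  "galerkin_V1_V2 \<Omega> V1 V2 W u =
     represent W inner (\<lambda>v. energy_form \<Omega> V1 u v + potential_form \<Omega> V2 u v)"

definition op_Th ::
    "'a::euclidean_space set \<Rightarrow> ('a \<Rightarrow> real) \<Rightarrow> ('a \<Rightarrow> real) \<Rightarrow> 'a L2 set \<Rightarrow> 'a L2 \<Rightarrow> 'a L2"
  where
  "op_Th \<Omega> V1 V2 W u = inv_into W (galerkin_V1 \<Omega> V1 W) (galerkin_V1_V2 \<Omega> V1 V2 W u)"

definition op_Kt ::
    "'a::euclidean_space set \<Rightarrow> ('a \<Rightarrow> real) \<Rightarrow> ('a \<Rightarrow> real) \<Rightarrow> 'a L2 set \<Rightarrow> 'a L2 \<Rightarrow> 'a L2"
  where
  "op_Kt \<Omega> V1 V2 W u = proj_A \<Omega> V1 W (op_K \<Omega> V1 V2 (proj_A \<Omega> V1 W u))"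

definition opnorm_A ::
    "'a::euclidean_space set \<Rightarrow> ('a \<Rightarrow> real) \<Rightarrow> ('a L2 \<Rightarrow> 'a L2) \<Rightarrow> ennreal" where
  "opnorm_A \<Omega> V1 S =
     (SUP u\<in>{u \<in> H10 \<Omega>. norm_A \<Omega> V1 u \<le> 1}. ennreal (norm_A \<Omega> V1 (S u)))"


section \<open>Spectra and condition numbers\<close>

definition finite_dim :: "'b::real_vector set \<Rightarrow> bool" where
  "finite_dim S \<longleftrightarrow> (\<exists>B. finite B \<and> S \<subseteq> span B)"

definition eigenspace :: "'b::real_vector set \<Rightarrow> ('b \<Rightarrow> 'b) \<Rightarrow> real \<Rightarrow> 'b set" where
  "eigenspace W S \<mu> = {u \<in> W. S u = \<mu> *\<^sub>R u}"

definition eigenvalues :: "'b::real_vector set \<Rightarrow> ('b \<Rightarrow> 'b) \<Rightarrow> real set" where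
  "eigenvalues W S = {\<mu>. \<exists>u\<in>W. u \<noteq> 0 \<and> S u = \<mu> *\<^sub>R u}"

text \<open>
  All operators under consideration are self-adjoint, so that their eigenvalues are real and
  the multiplicity is the dimension of the eigenspace.
\<close>

definition multiplicity_of :: "'b::real_vector set \<Rightarrow> ('b \<Rightarrow> 'b) \<Rightarrow> real \<Rightarrow> nat" where
  "multiplicity_of W S \<mu> = dim (eigenspace W S \<mu>)"

definition mu_max ::
    "'a::euclidean_space set \<Rightarrow> ('a \<Rightarrow> real) \<Rightarrow> 'a L2 set \<Rightarrow> ('a L2 \<Rightarrow> 'a L2) \<Rightarrow> real" where
  "mu_max \<Omega> V1 W S = (SUP u\<in>{u \<in> W. norm_A \<Omega> V1 u = 1}. energy_form \<Omega> V1 (S u) u)"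

definition mu_min ::
    "'a::euclidean_space set \<Rightarrow> ('a \<Rightarrow> real) \<Rightarrow> 'a L2 set \<Rightarrow> ('a L2 \<Rightarrow> 'a L2) \<Rightarrow> real" where
  "mu_min \<Omega> V1 W S = (INF u\<in>{u \<in> W. norm_A \<Omega> V1 u = 1}. energy_form \<Omega> V1 (S u) u)"

text \<open>Meaningful only for \<^prop>\<open>W \<noteq> {0}\<close>, as otherwise the unit sphere is empty.\<close>

definition cond_number ::
    "'a::euclidean_space set \<Rightarrow> ('a \<Rightarrow> real) \<Rightarrow> 'a L2 set \<Rightarrow> ('a L2 \<Rightarrow> 'a L2) \<Rightarrow> real" where
  "cond_number \<Omega> V1 W S = mu_max \<Omega> V1 W S / mu_min \<Omega> V1 W S"

end

theory Submission
  imports Defs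
begin

text \<open>
  All operators are determined by two symmetric forms on \<open>H10 \<Omega>\<close>: the energy inner product \<open>a\<close> and
  \<open>b(u, v) = \<integral> V\<^sub>2 u v\<close>. The operator \<open>K\<close> represents \<open>b\<close> with respect to \<open>a\<close> on \<open>H10 \<Omega>\<close>, and \<open>K\<^sub>h\<close>
  represents it on \<open>X\<^sub>h\<close>; hence \<open>T = I + K\<close> and \<open>T\<^sub>h = I + K\<^sub>h\<close>, where the second identity comes from
  the injectivity of the discrete operator \<open>- \<Delta>\<^sub>h + V\<^sub>1\<^sub>,\<^sub>h\<close>. Everything else follows from one property of
  the pair of forms, established in \<open>compact_form_A\<close>: up to an error \<open>\<epsilon> \<parallel>w\<parallel> \<parallel>v\<parallel>\<close>, the form \<open>b(w, v)\<close> is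
  controlled by \<open>\<parallel>v\<parallel>\<close> and finitely many functionals \<open>a(f, w)\<close>.

  Norm convergence. The projection \<open>\<Pi>\<^sub>h\<close> is symmetric, so \<open>a(f, u - \<Pi>\<^sub>h u) = a(f - \<Pi>\<^sub>h f, u)\<close>, and density
  makes the finitely many \<open>f - \<Pi>\<^sub>h f\<close> small. Therefore \<open>b(u - \<Pi>\<^sub>h u, v)\<close> tends to zero uniformly on the unit
  balls (\<open>residual_small\<close>), which is the convergence of \<open>K (I - \<Pi>\<^sub>h)\<close> to zero in norm.

  Clustering. Where the functionals belonging to \<open>\<epsilon> / 2\<close> vanish, \<open>K\<^sub>h\<close> is bounded by \<open>\<epsilon> / 2\<close>, so eigenvectors
  with \<open>\<bar>\<mu>\<bar> \<ge> \<epsilon>\<close> span a space on which these functionals are jointly injective; their number bounds the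
  multiplicities for all \<open>h\<close> at once (\<open>clustering\<close>).

  Spectral convergence. Let \<open>\<mu> \<noteq> 0\<close> be an eigenvalue with eigenspace \<open>E\<close> of dimension \<open>m\<close>. On the orthogonal
  complement of \<open>E\<close> the operator \<open>K - \<mu>\<close> is bounded below (\<open>K_gap\<close>). Since \<open>K\<^sub>h\<close> is close to \<open>K\<close>, the
  eigenvectors of \<open>K\<^sub>h\<close> near \<open>\<mu>\<close> span a space that meets this complement trivially, so there are at most
  \<open>m\<close> of them; and \<open>\<Pi>\<^sub>h E\<close> consists of approximate eigenvectors, so there are at least \<open>m\<close>. As this holds in
  every small window around \<open>\<mu>\<close>, the eigenvalues converge (\<open>spectral_convergence\<close>).

  Condition numbers. \<open>T\<^sub>h\<close> is the compression of \<open>T\<close>, so its Rayleigh quotients are those of \<open>T\<close> on a smaller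
  sphere. Positivity and compactness make the infimum for \<open>T\<close> strictly positive (\<open>positive_imp_coercive\<close>),
  which gives the inequality (\<open>cond_le\<close>), and density gives the limit (\<open>cond_tendsto\<close>).

  The analytic input is that \<open>H10 \<Omega>\<close> is a Hilbert space that embeds compactly into \<open>L\<^sup>2\<close>. Completeness comes
  from Riesz--Fischer (\<open>L2_complete\<close>) together with the uniqueness of weak derivatives, for which smooth bumps
  approximating boxes have to separate the functions on \<open>\<Omega>\<close> (\<open>test_functions_separate\<close>). The inequalities of
  Poincare and Rellich both follow from \<open>\<parallel>\<phi>(z + \<cdot>) - \<phi>\<parallel> \<le> \<bar>z\<bar> \<parallel>\<nabla>\<phi>\<parallel>\<close> for test functions: a long translation
  separates the supports, and short ones control the distance of \<open>\<phi>\<close> to its averages over small cells.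
\<close>

section \<open>Inner products on a subspace\<close>

locale inner_form =
  fixes H :: "'b::real_vector set" and a :: "'b \<Rightarrow> 'b \<Rightarrow> real"
  assumes H_subspace: "subspace H"
    and a_add_left: "\<lbrakk>u \<in> H; v \<in> H; w \<in> H\<rbrakk> \<Longrightarrow> a (u + v) w = a u w + a v w"
    and a_scale_left: "\<lbrakk>u \<in> H; w \<in> H\<rbrakk> \<Longrightarrow> a (c *\<^sub>R u) w = c * a u w"
    and a_sym: "\<lbrakk>u \<in> H; v \<in> H\<rbrakk> \<Longrightarrow> a u v = a v u"
    and a_pos: "\<lbrakk>u \<in> H; u \<noteq> 0\<rbrakk> \<Longrightarrow> 0 < a u u"
begin

definition nrm :: "'b \<Rightarrow> real" where "nrm u = sqrt (a u u)"

lemma H_zero [simp, intro]: "0 \<in> H"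
  using H_subspace by (rule subspace_0)

lemma H_add [simp, intro]: "u \<in> H \<Longrightarrow> v \<in> H \<Longrightarrow> u + v \<in> H"
  using H_subspace by (rule subspace_add)

lemma H_diff [simp, intro]: "u \<in> H \<Longrightarrow> v \<in> H \<Longrightarrow> u - v \<in> H"
  using H_subspace by (rule subspace_diff)

lemma H_scale [simp, intro]: "u \<in> H \<Longrightarrow> c *\<^sub>R u \<in> H"
  using H_subspace by (rule subspace_scale)

lemma H_sum [intro]: "(\<And>i. i \<in> I \<Longrightarrow> f i \<in> H) \<Longrightarrow> sum f I \<in> H"
  using H_subspace by (rule subspace_sum)

lemma a_add_right: "\<lbrakk>u \<in> H; v \<in> H; w \<in> H\<rbrakk> \<Longrightarrow> a w (u + v) = a w u + a w v"
  using a_add_left[of u v w] a_sym[of w] by simp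

lemma a_scale_right: "\<lbrakk>u \<in> H; w \<in> H\<rbrakk> \<Longrightarrow> a w (c *\<^sub>R u) = c * a w u"
  using a_scale_left[of u w c] a_sym[of w] by simp

lemma a_zero_left [simp]: "w \<in> H \<Longrightarrow> a 0 w = 0"
  using a_scale_left[of 0 w 0] by simp

lemma a_zero_right [simp]: "w \<in> H \<Longrightarrow> a w 0 = 0"
  using a_scale_right[of 0 w 0] by simp

lemma a_diff_left: "\<lbrakk>u \<in> H; v \<in> H; w \<in> H\<rbrakk> \<Longrightarrow> a (u - v) w = a u w - a v w"
  using a_add_left[of u "(-1) *\<^sub>R v" w] a_scale_left[of v w "-1"] H_scale[of v "-1"] by simp

lemma a_diff_right: "\<lbrakk>u \<in> H; v \<in> H; w \<in> H\<rbrakk> \<Longrightarrow> a w (u - v) = a w u - a w v"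
  using a_diff_left[of u v w] a_sym[of w] by simp

lemma a_sum_left: "\<lbrakk>\<And>i. i \<in> I \<Longrightarrow> f i \<in> H; w \<in> H\<rbrakk> \<Longrightarrow> a (sum f I) w = (\<Sum>i\<in>I. a (f i) w)"
  by (induction I rule: infinite_finite_induct) (auto simp: a_add_left H_sum)

lemma a_sum_right: "\<lbrakk>\<And>i. i \<in> I \<Longrightarrow> f i \<in> H; w \<in> H\<rbrakk> \<Longrightarrow> a w (sum f I) = (\<Sum>i\<in>I. a w (f i))"
  by (induction I rule: infinite_finite_induct) (auto simp: a_add_right H_sum)

lemmas a_simps = a_add_left a_add_right a_scale_left a_scale_right a_diff_left a_diff_right

lemma a_nonneg: "u \<in> H \<Longrightarrow> 0 \<le> a u u"
  using a_pos[of u] by (cases "u = 0") auto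

lemma a_eq_0: "u \<in> H \<Longrightarrow> a u u = 0 \<longleftrightarrow> u = 0"
  using a_pos[of u] by (cases "u = 0") auto

lemma nrm_nonneg: "u \<in> H \<Longrightarrow> 0 \<le> nrm u"
  by (simp add: nrm_def a_nonneg)

lemma nrm_square: "u \<in> H \<Longrightarrow> (nrm u)\<^sup>2 = a u u"
  by (simp add: nrm_def a_nonneg)

lemma nrm_eq_0: "u \<in> H \<Longrightarrow> nrm u = 0 \<longleftrightarrow> u = 0"
  by (simp add: nrm_def a_eq_0 a_nonneg)

lemma nrm_pos: "u \<in> H \<Longrightarrow> u \<noteq> 0 \<Longrightarrow> 0 < nrm u"
  by (simp add: nrm_def a_pos)

lemma nrm_zero [simp]: "nrm 0 = 0"
  by (simp add: nrm_def)

lemma nrm_scale: "u \<in> H \<Longrightarrow> nrm (c *\<^sub>R u) = \<bar>c\<bar> * nrm u"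
  by (simp add: nrm_def a_simps real_sqrt_mult flip: mult.assoc)

text \<open>
  The Cauchy--Schwarz inequality holds for every positive semidefinite form, not just for \<open>a\<close>; it is
  applied to \<open>a (T u) v\<close> with a nonnegative operator \<open>T\<close> as well.
\<close>

lemma semidefinite_Cauchy_Schwarz:
  assumes t_add: "\<And>u v w. \<lbrakk>u \<in> H; v \<in> H; w \<in> H\<rbrakk> \<Longrightarrow> t (u + v) w = t u w + t v w"
    and t_scale: "\<And>u w c. \<lbrakk>u \<in> H; w \<in> H\<rbrakk> \<Longrightarrow> t (c *\<^sub>R u) w = c * t u w"
    and t_sym: "\<And>u v. \<lbrakk>u \<in> H; v \<in> H\<rbrakk> \<Longrightarrow> t u v = t v u"
    and t_nonneg: "\<And>u. u \<in> H \<Longrightarrow> 0 \<le> t u u"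
    and u: "u \<in> H" and v: "v \<in> H"
  shows "(t u v)\<^sup>2 \<le> t u u * t v v"
proof -
  have expand: "0 \<le> t u u + 2 * x * t u v + x\<^sup>2 * t v v" for x :: real
  proof -
    have "t (u + x *\<^sub>R v) (u + x *\<^sub>R v) = t u (u + x *\<^sub>R v) + x * t v (u + x *\<^sub>R v)"
      using u v by (simp add: t_add t_scale)
    also have "\<dots> = t (u + x *\<^sub>R v) u + x * t (u + x *\<^sub>R v) v"
      using t_sym[of u "u + x *\<^sub>R v"] t_sym[of v "u + x *\<^sub>R v"] u v by simp
    also have "\<dots> = t u u + 2 * x * t u v + x\<^sup>2 * t v v"
      using u v t_sym[of v u] by (simp add: t_add t_scale power2_eq_square algebra_simps)
    finally show ?thesis using t_nonneg[of "u + x *\<^sub>R v"] u v by simp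
  qed
  show ?thesis
  proof (cases "t v v = 0")
    case True
    have "t u v = 0"
    proof (rule ccontr)
      assume "t u v \<noteq> 0"
      then show False
        using expand[of "- (t u u + 1) / (2 * t u v)"] True by (simp add: field_simps)
    qed
    with True show ?thesis by simp
  next
    case False
    then have pos: "0 < t v v" using t_nonneg[OF v] by simp
    have "0 \<le> t v v * (t u u + 2 * (- t u v / t v v) * t u v + (- t u v / t v v)\<^sup>2 * t v v)"
      using expand[of "- t u v / t v v"] pos by (intro mult_nonneg_nonneg) auto
    also have "\<dots> = t u u * t v v - (t u v)\<^sup>2"
      using pos by (simp add: field_simps power2_eq_square)
    finally show ?thesis by simp
  qed
qed

lemma Cauchy_Schwarz: "u \<in> H \<Longrightarrow> v \<in> H \<Longrightarrow> \<bar>a u v\<bar> \<le> nrm u * nrm v"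
proof -
  assume "u \<in> H" "v \<in> H"
  then have "(a u v)\<^sup>2 \<le> a u u * a v v"
    by (intro semidefinite_Cauchy_Schwarz) (auto simp: a_simps a_nonneg a_sym)
  then show ?thesis
    unfolding nrm_def real_sqrt_mult[symmetric] by (rule real_le_rsqrt[of "\<bar>_\<bar>", simplified])
qed

lemma nrm_triangle: "u \<in> H \<Longrightarrow> v \<in> H \<Longrightarrow> nrm (u + v) \<le> nrm u + nrm v"
proof -
  assume u: "u \<in> H" and v: "v \<in> H"
  have "(nrm (u + v))\<^sup>2 = (nrm u)\<^sup>2 + 2 * a u v + (nrm v)\<^sup>2"
    using u v by (simp add: nrm_square a_simps a_sym[of v u])
  also have "\<dots> \<le> (nrm u + nrm v)\<^sup>2"
    using Cauchy_Schwarz[OF u v] by (simp add: power2_sum)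
  finally show ?thesis
    using nrm_nonneg u v by (meson add_nonneg_nonneg power2_le_imp_le)
qed

lemma nrm_minus_commute: "u \<in> H \<Longrightarrow> v \<in> H \<Longrightarrow> nrm (u - v) = nrm (v - u)"
  using nrm_scale[of "u - v" "-1"] by simp

lemma nrm_triangle_diff: "u \<in> H \<Longrightarrow> v \<in> H \<Longrightarrow> nrm (u - v) \<le> nrm u + nrm v"
  using nrm_triangle[of u "(-1) *\<^sub>R v"] nrm_scale[of v "-1"] H_scale[of v "-1"] by simp

lemma nrm_le_diff: "u \<in> H \<Longrightarrow> v \<in> H \<Longrightarrow> nrm u \<le> nrm (u - v) + nrm v"
  using nrm_triangle[of "u - v" v] by simp

lemma nrm_triangle_rev: "u \<in> H \<Longrightarrow> v \<in> H \<Longrightarrow> \<bar>nrm u - nrm v\<bar> \<le> nrm (u - v)"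
  using nrm_le_diff[of u v] nrm_le_diff[of v u] nrm_minus_commute[of u v] by simp

lemma nrm_sum: "(\<And>i. i \<in> I \<Longrightarrow> f i \<in> H) \<Longrightarrow> nrm (sum f I) \<le> (\<Sum>i\<in>I. nrm (f i))"
proof (induction I rule: infinite_finite_induct)
  case (insert x I)
  have "nrm (f x + sum f I) \<le> nrm (f x) + nrm (sum f I)"
    using insert.prems by (intro nrm_triangle H_sum) auto
  with insert show ?case by simp
qed auto

lemma subspace_inner_form:
  assumes "subspace W" "W \<subseteq> H"
  shows "inner_form W a"
  using assms by unfold_locales (auto simp: a_simps a_pos a_sym subset_eq)

lemma representer_unique:
  assumes "w \<in> H" "w' \<in> H" "\<And>v. v \<in> H \<Longrightarrow> a w v = a w' v"
  shows "w = w'"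
proof -
  have "a (w - w') (w - w') = 0"
    using assms by (simp add: a_diff_left)
  with assms show ?thesis using a_eq_0[of "w - w'"] by simp
qed

lemma represent_eqI:
  assumes "w \<in> H" "\<And>v. v \<in> H \<Longrightarrow> a w v = F v"
  shows "represent H a F = w"
  unfolding represent_def
proof (rule the_equality)
  show "w \<in> H \<and> (\<forall>v\<in>H. a w v = F v)" using assms by blast
  fix w' assume "w' \<in> H \<and> (\<forall>v\<in>H. a w' v = F v)"
  then show "w' = w" using assms by (intro representer_unique) auto
qed

subsection \<open>Orthonormal bases of finite-dimensional subspaces\<close>

definition orthonormal :: "'b set \<Rightarrow> bool" where
  "orthonormal B \<longleftrightarrow> finite B \<and> B \<subseteq> H \<and> (\<forall>e\<in>B. \<forall>f\<in>B. a e f = (if e = f then 1 else 0))"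

lemma orthonormalD:
  assumes "orthonormal B"
  shows "finite B" "B \<subseteq> H" "\<And>e f. e \<in> B \<Longrightarrow> f \<in> B \<Longrightarrow> a e f = (if e = f then 1 else 0)"
  using assms by (auto simp: orthonormal_def)

lemma orthonormal_subset: "orthonormal B \<Longrightarrow> C \<subseteq> B \<Longrightarrow> orthonormal C"
  unfolding orthonormal_def by (auto intro: finite_subset simp: subset_eq)

lemma span_subset_H: "B \<subseteq> H \<Longrightarrow> span B \<subseteq> H"
  by (rule span_minimal[OF _ H_subspace])

lemma orthonormal_coefficient:
  assumes B: "orthonormal B" and e: "e \<in> B"
  shows "a e (\<Sum>f\<in>B. c f *\<^sub>R f) = c e"
proof -
  note D = orthonormalD[OF B]
  have "a e (\<Sum>f\<in>B. c f *\<^sub>R f) = (\<Sum>f\<in>B. c f * a e f)"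
    using D(2) e by (subst a_sum_right) (auto simp: a_scale_right subset_eq)
  also have "\<dots> = (\<Sum>f\<in>B. if e = f then c f else 0)"
    using D(3) e by (intro sum.cong) auto
  finally show ?thesis using D(1) e by simp
qed

lemma orthonormal_expansion:
  assumes B: "orthonormal B" and u: "u \<in> span B"
  shows "u = (\<Sum>e\<in>B. a e u *\<^sub>R e)"
proof -
  obtain c where c: "u = (\<Sum>f\<in>B. c f *\<^sub>R f)"
    using u span_finite[OF orthonormalD(1)[OF B]] by auto
  then show ?thesis using orthonormal_coefficient[OF B, of _ c] by simp
qed

lemma orthonormal_nrm_square:
  assumes B: "orthonormal B"
  shows "(nrm (\<Sum>e\<in>B. c e *\<^sub>R e))\<^sup>2 = (\<Sum>e\<in>B. (c e)\<^sup>2)"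
proof -
  note D = orthonormalD[OF B]
  have sH: "(\<Sum>e\<in>B. c e *\<^sub>R e) \<in> H"
    using D(2) by (intro H_sum) auto
  have "a (\<Sum>e\<in>B. c e *\<^sub>R e) (\<Sum>e\<in>B. c e *\<^sub>R e) = (\<Sum>e\<in>B. c e * a e (\<Sum>e\<in>B. c e *\<^sub>R e))"
    using D(2) sH by (subst a_sum_left) (auto simp: a_scale_left subset_eq)
  also have "\<dots> = (\<Sum>e\<in>B. (c e)\<^sup>2)"
    using orthonormal_coefficient[OF B, of _ c] by (simp add: power2_eq_square)
  finally show ?thesis using sH by (simp add: nrm_square)
qed

lemma orthonormal_independent:
  assumes B: "orthonormal B"
  shows "independent B"
proof (rule independent_if_scalars_zero[OF orthonormalD(1)[OF B]])
  fix c e assume "(\<Sum>e\<in>B. c e *\<^sub>R e) = 0" "e \<in> B"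
  then show "c e = 0"
    using orthonormal_coefficient[OF B, of e c] orthonormalD(2)[OF B] by auto
qed

lemma dim_span_orthonormal: "orthonormal B \<Longrightarrow> dim (span B) = card B"
  by (simp add: orthonormal_independent dim_eq_card)

lemma orthonormal_residual:
  assumes B: "orthonormal B" and u: "u \<in> H" and e: "e \<in> B"
  shows "a e (u - (\<Sum>f\<in>B. a f u *\<^sub>R f)) = 0"
proof -
  note D = orthonormalD[OF B]
  have "(\<Sum>f\<in>B. a f u *\<^sub>R f) \<in> H" using D(2) by (intro H_sum) auto
  then show ?thesis
    using orthonormal_coefficient[OF B e, of "\<lambda>f. a f u"] D(2) e u by (auto simp: a_diff_right)
qed

lemma orthonormal_insert:
  assumes B: "orthonormal B" and v: "v \<in> H" "nrm v = 1" and perp: "\<And>e. e \<in> B \<Longrightarrow> a e v = 0"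
  shows "orthonormal (insert v B)" "v \<notin> B"
proof -
  note D = orthonormalD[OF B]
  have vv: "a v v = 1" using v nrm_square[of v] by simp
  show vB: "v \<notin> B" using perp vv by force
  have "a v e = 0" if "e \<in> B" for e
    using perp[OF that] a_sym[of v e] D(2) that v by auto
  then show "orthonormal (insert v B)"
    using D v vv perp vB unfolding orthonormal_def by auto
qed

text \<open>
  A largest orthonormal system of vectors with a property \<open>P\<close> is a basis, as soon as the orthogonal
  complement of a smaller one always provides another vector with this property. With \<open>P\<close> trivial
  this gives orthonormal bases, and with \<open>P\<close> ``is an eigenvector'' the spectral theorem.
\<close>

lemma orthonormal_basis_of_property:
  assumes W: "subspace W" "finite_dim W" "W \<subseteq> H"
    and ext: "\<And>B u. \<lbrakk>orthonormal B; B \<subseteq> W; \<forall>e\<in>B. P e; u \<in> W; u \<noteq> 0; \<forall>e\<in>B. a e u = 0\<rbrakk>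
        \<Longrightarrow> \<exists>v\<in>W. nrm v = 1 \<and> P v \<and> (\<forall>e\<in>B. a e v = 0)"
  shows "\<exists>B. orthonormal B \<and> (\<forall>e\<in>B. P e) \<and> span B = W"
proof -
  obtain C where C: "finite C" "W \<subseteq> span C" using W(2) by (auto simp: finite_dim_def)
  define Q where "Q n \<longleftrightarrow> (\<exists>B. orthonormal B \<and> B \<subseteq> W \<and> (\<forall>e\<in>B. P e) \<and> card B = n)" for n
  have "Q 0" unfolding Q_def by (intro exI[of _ "{}"]) (auto simp: orthonormal_def)
  moreover have bound: "n \<le> card C" if "Q n" for n
  proof -
    obtain B where "orthonormal B" "B \<subseteq> W" "card B = n" using \<open>Q n\<close> by (auto simp: Q_def)
    then show ?thesis
      using independent_span_bound[OF C(1) orthonormal_independent, of B] C(2) by auto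
  qed
  ultimately have "\<exists>n. Q n \<and> (\<forall>m. Q m \<longrightarrow> m \<le> n)"
    using ex_has_greatest_nat[of Q 0 "\<lambda>n. n" "Suc (card C)"] by (simp add: less_Suc_eq_le)
  then obtain n where n: "Q n" "\<And>m. Q m \<Longrightarrow> m \<le> n" by blast
  then obtain B where B: "orthonormal B" "B \<subseteq> W" "\<forall>e\<in>B. P e" "card B = n"
    by (auto simp: Q_def)
  have "w \<in> span B" if w: "w \<in> W" for w
  proof (rule ccontr)
    assume nw: "w \<notin> span B"
    define u where "u = w - (\<Sum>f\<in>B. a f w *\<^sub>R f)"
    have sB: "(\<Sum>f\<in>B. a f w *\<^sub>R f) \<in> span B"
      by (intro span_sum span_scale span_base)
    have "span B \<subseteq> W" by (rule span_minimal[OF B(2) W(1)])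
    then have "u \<in> W" using sB w W(1) by (auto simp: u_def subspace_diff)
    moreover have "u \<noteq> 0" using sB nw by (auto simp: u_def)
    moreover have "\<forall>e\<in>B. a e u = 0"
      using orthonormal_residual[OF B(1)] w W(3) by (auto simp: u_def)
    ultimately obtain v where v: "v \<in> W" "nrm v = 1" "P v" "\<forall>e\<in>B. a e v = 0"
      using ext[OF B(1-3)] by blast
    have "orthonormal (insert v B)" "v \<notin> B"
      using orthonormal_insert[OF B(1)] v W(3) by auto
    then have "Q (Suc n)"
      unfolding Q_def using v B orthonormalD(1)[OF B(1)] by (intro exI[of _ "insert v B"]) auto
    with n(2) show False by force
  qed
  moreover have "span B \<subseteq> W" by (rule span_minimal[OF B(2) W(1)])
  ultimately show ?thesis using B by blast
qed

lemma orthonormal_basis_exists: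
  assumes W: "subspace W" "finite_dim W" "W \<subseteq> H"
  obtains B where "orthonormal B" "span B = W"
proof -
  have "\<exists>B. orthonormal B \<and> (\<forall>e\<in>B. True) \<and> span B = W"
  proof (rule orthonormal_basis_of_property[OF W])
    fix B u assume u: "u \<in> W" "u \<noteq> 0" "\<forall>e\<in>B. a e u = 0" and B: "orthonormal B"
    then have "0 < nrm u" "u \<in> H" using W(3) nrm_pos by auto
    then show "\<exists>v\<in>W. nrm v = 1 \<and> True \<and> (\<forall>e\<in>B. a e v = 0)"
      using u W orthonormalD(2)[OF B]
      by (intro bexI[of _ "(1 / nrm u) *\<^sub>R u"]) (auto simp: nrm_scale a_scale_right subspace_scale subset_eq)
  qed
  then show ?thesis using that by blast
qed

lemma represent_finite_dim:
  assumes W: "subspace W" "finite_dim W" "W \<subseteq> H"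
    and F_add: "\<And>u v. \<lbrakk>u \<in> W; v \<in> W\<rbrakk> \<Longrightarrow> F (u + v) = F u + F v"
    and F_scale: "\<And>u c. u \<in> W \<Longrightarrow> F (c *\<^sub>R u) = c * F u"
  shows "represent W a F \<in> W" "\<And>v. v \<in> W \<Longrightarrow> a (represent W a F) v = F v"
proof -
  interpret W: inner_form W a by (rule subspace_inner_form[OF W(1,3)])
  obtain B where B: "orthonormal B" "span B = W" using orthonormal_basis_exists[OF W] .
  define w where "w = (\<Sum>e\<in>B. F e *\<^sub>R e)"
  have BW: "B \<subseteq> W" using B(2) span_superset by blast
  have wW: "w \<in> W" unfolding w_def using BW by (intro W.H_sum) auto
  have F_sum: "F (sum g I) = (\<Sum>i\<in>I. F (g i))" if "\<And>i. i \<in> I \<Longrightarrow> g i \<in> W" for g and I :: "'b set"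
    using that F_scale[of 0 0]
    by (induction I rule: infinite_finite_induct) (auto simp: F_add W.H_sum)
  have w: "a w v = F v" if v: "v \<in> W" for v
  proof -
    have "a w v = (\<Sum>e\<in>B. F e * a e v)"
      unfolding w_def using BW v by (subst W.a_sum_left) (auto simp: W.a_scale_left subset_eq)
    also have "\<dots> = F (\<Sum>e\<in>B. a e v *\<^sub>R e)"
      using BW by (subst F_sum) (auto simp: F_scale subset_eq mult.commute)
    also have "\<dots> = F v" using orthonormal_expansion[OF B(1), of v] B(2) v by simp
    finally show ?thesis .
  qed
  have "represent W a F = w" by (rule W.represent_eqI[OF wW w])
  then show "represent W a F \<in> W" "\<And>v. v \<in> W \<Longrightarrow> a (represent W a F) v = F v"
    using wW w by auto
qed

text \<open>
  Compactness is stated with a sum over a set of vectors, in which representers of different functionals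
  may coincide; scaling by the number of functionals makes up for the lost repetitions.
\<close>

lemma indexed_functionals_as_set:
  fixes f :: "'c \<Rightarrow> 'b"
  assumes I: "finite I" and f: "\<And>i. i \<in> I \<Longrightarrow> f i \<in> H"
  obtains F where "finite F" "F \<subseteq> H" "\<And>w. w \<in> H \<Longrightarrow> (\<Sum>i\<in>I. \<bar>a (f i) w\<bar>) \<le> (\<Sum>v\<in>F. \<bar>a v w\<bar>)"
proof (cases "I = {}")
  case True
  then show ?thesis using that[of "{}"] by simp
next
  case False
  define c where "c = real (card I)"
  have c: "0 < c" using False I by (simp add: c_def card_gt_0_iff)
  let ?F = "(\<lambda>v. c *\<^sub>R v) ` (f ` I)"
  have "(\<Sum>i\<in>I. \<bar>a (f i) w\<bar>) \<le> (\<Sum>v\<in>?F. \<bar>a v w\<bar>)" if w: "w \<in> H" for w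
  proof -
    have "(\<Sum>i\<in>I. \<bar>a (f i) w\<bar>) = (\<Sum>v\<in>f ` I. \<Sum>i\<in>{i \<in> I. f i = v}. \<bar>a (f i) w\<bar>)"
      by (rule sum.image_gen[OF I])
    also have "\<dots> = (\<Sum>v\<in>f ` I. real (card {i \<in> I. f i = v}) * \<bar>a v w\<bar>)"
      by (intro sum.cong) auto
    also have "\<dots> \<le> (\<Sum>v\<in>f ` I. c * \<bar>a v w\<bar>)"
      using I unfolding c_def by (intro sum_mono mult_right_mono of_nat_mono card_mono) auto
    also have "\<dots> = (\<Sum>v\<in>f ` I. \<bar>a (c *\<^sub>R v) w\<bar>)"
      using f w c by (intro sum.cong) (auto simp: a_scale_left abs_mult)
    also have "\<dots> = (\<Sum>v\<in>?F. \<bar>a v w\<bar>)"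
      using c by (subst sum.reindex) (auto simp: inj_on_def)
    finally show ?thesis .
  qed
  then show ?thesis using that[of ?F] I f by auto
qed

end

text \<open>
  Restricting to the kernel of one functional lowers the dimension by at most one. All bounds
  on multiplicities consist in exhibiting few functionals that separate a span of eigenvectors.
\<close>

lemma dim_le_card_separating:
  fixes W :: "'b::real_vector set" and L :: "('b \<Rightarrow> real) set"
  assumes "finite L" and "subspace W"
    and "\<And>l u v. \<lbrakk>l \<in> L; u \<in> W; v \<in> W\<rbrakk> \<Longrightarrow> l (u + v) = l u + l v"
    and "\<And>l u c. \<lbrakk>l \<in> L; u \<in> W\<rbrakk> \<Longrightarrow> l (c *\<^sub>R u) = c * l u"
    and "\<And>u. \<lbrakk>u \<in> W; \<forall>l\<in>L. l u = 0\<rbrakk> \<Longrightarrow> u = 0"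
  shows "finite_dim W" "dim W \<le> card L"
proof -
  have "\<exists>C. finite C \<and> card C \<le> card L \<and> W \<subseteq> span C"
    using assms
  proof (induction L arbitrary: W rule: finite_induct)
    case empty
    then show ?case by (intro exI[of _ "{}"]) auto
  next
    case (insert l L)
    define W' where "W' = {u \<in> W. l u = 0}"
    have l0: "l 0 = 0" using insert.prems(3)[of l 0 0] subspace_0[OF insert.prems(1)] by simp
    have "\<exists>C. finite C \<and> card C \<le> card L \<and> W' \<subseteq> span C"
    proof (rule insert.IH)
      show "subspace W'"
        using insert.prems(1) insert.prems(2,3)[of l] l0 unfolding W'_def subspace_def by simp
      show "u = 0" if "u \<in> W'" "\<forall>l\<in>L. l u = 0" for u
        using insert.prems(4)[of u] that by (auto simp: W'_def)
    qed (use insert.prems(2,3) in \<open>auto simp: W'_def\<close>)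
    then obtain C where C: "finite C" "card C \<le> card L" "W' \<subseteq> span C"
      by blast
    show ?case
    proof (cases "W' = W")
      case True
      then show ?thesis using C insert.hyps by (intro exI[of _ C]) auto
    next
      case False
      then obtain w where w: "w \<in> W" "l w \<noteq> 0" by (auto simp: W'_def)
      have "u \<in> span (insert w C)" if u: "u \<in> W" for u
      proof -
        have uw: "u + (- (l u / l w)) *\<^sub>R w \<in> W"
          using u w insert.prems(1) by (intro subspace_add subspace_scale)
        have "l (u + (- (l u / l w)) *\<^sub>R w) = l u + l ((- (l u / l w)) *\<^sub>R w)"
          by (rule insert.prems(2)) (use u w insert.prems(1) in \<open>auto intro: subspace_scale subspace_neg\<close>)
        also have "l ((- (l u / l w)) *\<^sub>R w) = - (l u / l w) * l w"
          by (rule insert.prems(3)) (use w in auto)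
        finally have "l (u + (- (l u / l w)) *\<^sub>R w) = 0"
          using w(2) by simp
        then have "u + (- (l u / l w)) *\<^sub>R w \<in> W'"
          using uw w by (simp add: W'_def)
        then have "u + (- (l u / l w)) *\<^sub>R w \<in> span (insert w C)"
          using C(3) span_mono[of C "insert w C"] by blast
        then have "(u + (- (l u / l w)) *\<^sub>R w) + (l u / l w) *\<^sub>R w \<in> span (insert w C)"
          by (rule span_add) (intro span_scale span_base insertI1)
        then show ?thesis by simp
      qed
      then show ?thesis
        using C insert.hyps card_insert_le_m1[of "card (insert l L)" C w]
        by (intro exI[of _ "insert w C"]) (auto simp: card_insert_if)
    qed
  qed
  then obtain C where C: "finite C" "card C \<le> card L" "W \<subseteq> span C" by blast
  then show "finite_dim W" by (auto simp: finite_dim_def)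
  show "dim W \<le> card L" using dim_le_card[OF C(3,1)] C(2) by simp
qed

section \<open>Hilbert spaces and finite-dimensional spectral theory\<close>

lemma linear_coefficient_zero:
  fixes p q :: real
  assumes "\<And>x. 0 \<le> 2 * x * p + x\<^sup>2 * q" "0 \<le> q"
  shows "p = 0"
proof (rule ccontr)
  assume p: "p \<noteq> 0"
  have nz: "q + 1 \<noteq> 0" using assms(2) by simp
  have "2 * (- p / d) * p + (- p / d)\<^sup>2 * (d - 1) = - (p\<^sup>2 * (d + 1) / d\<^sup>2)" if "d \<noteq> 0" for d
    using that by (simp add: field_simps power2_eq_square)
  from this[OF nz] have "2 * (- p / (q + 1)) * p + (- p / (q + 1))\<^sup>2 * q
      = - (p\<^sup>2 * (q + 1 + 1) / (q + 1)\<^sup>2)"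
    by simp
  also have "\<dots> < 0"
    using p assms(2) nz by (simp add: add_nonneg_pos)
  finally show False using assms(1)[of "- p / (q + 1)"] by simp
qed

lemma common_convergent_subsequence:
  fixes g :: "'f \<Rightarrow> nat \<Rightarrow> real"
  assumes "finite F" "\<And>f. f \<in> F \<Longrightarrow> bounded (range (g f))"
  shows "\<exists>r::nat \<Rightarrow> nat. strict_mono r \<and> (\<forall>f\<in>F. convergent (\<lambda>n. g f (r n)))"
  using assms
proof (induction F rule: finite_induct)
  case empty
  show ?case by (intro exI[of _ id]) (auto simp: strict_mono_def)
next
  case (insert f F)
  then obtain r :: "nat \<Rightarrow> nat"
    where r: "strict_mono r" "\<forall>f\<in>F. convergent (\<lambda>n. g f (r n))" by auto
  have "bounded (range (\<lambda>n. g f (r n)))"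
    by (rule bounded_subset[OF insert.prems[of f]]) auto
  then obtain l k where k: "strict_mono k" "((\<lambda>n. g f (r n)) \<circ> k) \<longlonglongrightarrow> l"
    using bounded_imp_convergent_subsequence[of "\<lambda>n. g f (r n)"] by blast
  have "convergent (\<lambda>n. g f' (r (k n)))" if "f' \<in> F" for f'
    using r(2) that convergent_subseq_convergent[OF _ k(1), of "\<lambda>n. g f' (r n)"] by (simp add: o_def)
  moreover have "convergent (\<lambda>n. g f (r (k n)))"
    using k(2) by (auto simp: o_def convergent_def)
  ultimately show ?case
    using strict_mono_o[OF r(1) k(1)] by (intro exI[of _ "\<lambda>n. r (k n)"]) (auto simp: o_def)
qed

context inner_form begin

text \<open>
  Linearity is a consequence: for symmetric \<open>S\<close>, \<open>a (S u) v = a u (S v)\<close> is linear in \<open>u\<close> for every \<open>v\<close>.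
\<close>

definition symmetric_operator :: "'b set \<Rightarrow> ('b \<Rightarrow> 'b) \<Rightarrow> bool" where
  "symmetric_operator W S \<longleftrightarrow> (\<forall>u\<in>W. S u \<in> W) \<and> (\<forall>u\<in>W. \<forall>v\<in>W. a (S u) v = a u (S v))"

lemma symmetric_operatorD:
  assumes "symmetric_operator W S"
  shows "u \<in> W \<Longrightarrow> S u \<in> W" "u \<in> W \<Longrightarrow> v \<in> W \<Longrightarrow> a (S u) v = a u (S v)"
  using assms by (auto simp: symmetric_operator_def)

lemma symmetric_operator_linear:
  assumes S: "symmetric_operator H S"
  shows "u \<in> H \<Longrightarrow> v \<in> H \<Longrightarrow> S (u + v) = S u + S v" "u \<in> H \<Longrightarrow> S (c *\<^sub>R u) = c *\<^sub>R S u"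
    "u \<in> H \<Longrightarrow> v \<in> H \<Longrightarrow> S (u - v) = S u - S v"
  using symmetric_operatorD[OF S] by (auto intro!: representer_unique simp: a_simps)

lemma operator_nrm_le:
  assumes u: "u \<in> H" and M: "0 \<le> M" "\<And>v. v \<in> H \<Longrightarrow> \<bar>a u v\<bar> \<le> M * nrm v"
  shows "nrm u \<le> M"
proof (cases "u = 0")
  case False
  then have pos: "0 < nrm u" using u by (rule nrm_pos[rotated])
  have "nrm u * nrm u \<le> M * nrm u"
    using M(2)[OF u] nrm_square[OF u] a_nonneg[OF u] by (simp add: power2_eq_square)
  then show ?thesis using pos by simp
qed (use M in simp)

lemma tendsto_a_left:
  assumes "\<And>n. s n \<in> H" "l \<in> H" "v \<in> H" "((\<lambda>n. nrm (s n - l)) \<longlongrightarrow> 0) G"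
  shows "((\<lambda>n. a (s n) v) \<longlongrightarrow> a l v) G"
proof (rule LIM_zero_cancel)
  have "((\<lambda>n. nrm (s n - l) * nrm v) \<longlongrightarrow> 0) G"
    using tendsto_mult_right[OF assms(4), of "nrm v"] by simp
  then show "((\<lambda>n. a (s n) v - a l v) \<longlongrightarrow> 0) G"
  proof (rule Lim_null_comparison[rotated])
    show "\<forall>\<^sub>F n in G. norm (a (s n) v - a l v) \<le> nrm (s n - l) * nrm v"
      using Cauchy_Schwarz[of "s _ - l" v] assms(1-3)
      by (intro always_eventually) (auto simp: a_diff_left)
  qed
qed

end

locale hilbert_form = inner_form H a for H :: "'b::real_vector set" and a +
  assumes complete: "\<lbrakk>\<And>n. s n \<in> H; \<And>e. 0 < e \<Longrightarrow> \<exists>N. \<forall>m\<ge>N. \<forall>n\<ge>N. nrm (s m - s n) < e\<rbrakk>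
    \<Longrightarrow> \<exists>l\<in>H. (\<lambda>n. nrm (s n - l)) \<longlonglongrightarrow> 0"
begin

text \<open>
  Riesz representation: the representer minimises \<open>a v v - 2 F v\<close>, and by the parallelogram identity
  every minimising sequence is a Cauchy sequence.
\<close>

lemma Riesz_representation:
  assumes F_add: "\<And>u v. \<lbrakk>u \<in> H; v \<in> H\<rbrakk> \<Longrightarrow> F (u + v) = F u + F v"
    and F_scale: "\<And>u c. u \<in> H \<Longrightarrow> F (c *\<^sub>R u) = c * F u"
    and F_bounded: "\<And>u. u \<in> H \<Longrightarrow> \<bar>F u\<bar> \<le> C * nrm u"
  shows "represent H a F \<in> H" "\<And>v. v \<in> H \<Longrightarrow> a (represent H a F) v = F v"
proof -
  define J where "J v = a v v - 2 * F v" for v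
  have J_lower: "- C\<^sup>2 \<le> J v" if v: "v \<in> H" for v
  proof -
    have "0 \<le> (nrm v - C)\<^sup>2" by simp
    then show ?thesis
      using abs_le_D1[OF F_bounded[OF v]] nrm_square[OF v] unfolding J_def
      by (simp add: power2_diff mult.commute mult.left_commute)
  qed
  define d where "d = Inf (J ` H)"
  have bdd: "bdd_below (J ` H)" using J_lower by (intro bdd_belowI[of _ "- C\<^sup>2"]) auto
  have d_le: "d \<le> J v" if "v \<in> H" for v
    unfolding d_def using that by (intro cInf_lower bdd) auto
  have "\<exists>v\<in>H. J v < d + 1 / real (Suc n)" for n
    using cInf_lessD[of "J ` H" "d + 1 / real (Suc n)"] H_zero unfolding d_def by force
  then obtain s where s: "\<And>n. s n \<in> H" "\<And>n. J (s n) < d + 1 / real (Suc n)" by metis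
  have parallelogram: "(nrm (u - v))\<^sup>2 = 2 * J u + 2 * J v - 4 * J ((1/2) *\<^sub>R (u + v))"
    if "u \<in> H" "v \<in> H" for u v
    using that by (simp add: nrm_square J_def a_simps F_add F_scale a_sym[of v u] algebra_simps)
  have cauchy: "(nrm (s m - s n))\<^sup>2 \<le> 2 / real (Suc m) + 2 / real (Suc n)" for m n
    using parallelogram[OF s(1)[of m] s(1)[of n]] s(2)[of m] s(2)[of n]
      d_le[of "(1/2) *\<^sub>R (s m + s n)"] s(1) by auto
  have "\<exists>l\<in>H. (\<lambda>n. nrm (s n - l)) \<longlonglongrightarrow> 0"
  proof (rule complete[OF s(1)])
    fix e :: real assume e: "0 < e"
    obtain N where N: "4 / e\<^sup>2 < real N" using reals_Archimedean2 by blast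
    have "nrm (s m - s n) < e" if "N \<le> m" "N \<le> n" for m n
    proof (rule power2_less_imp_less)
      have half: "2 / real (Suc k) < e\<^sup>2 / 2" if "N \<le> k" for k
      proof -
        have "4 / e\<^sup>2 < real (Suc k)" using N that by simp
        then show ?thesis using e by (simp add: field_simps)
      qed
      then show "(nrm (s m - s n))\<^sup>2 < e\<^sup>2"
        using cauchy[of m n] half[of m] half[of n] that by linarith
    qed (use e in simp)
    then show "\<exists>N. \<forall>m\<ge>N. \<forall>n\<ge>N. nrm (s m - s n) < e" by blast
  qed
  then obtain w where w: "w \<in> H" "(\<lambda>n. nrm (s n - w)) \<longlonglongrightarrow> 0" by blast
  have rep: "a w v = F v" if v: "v \<in> H" for v
  proof -
    have "0 \<le> 2 * x * (a w v - F v) + x\<^sup>2 * a v v" for x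
    proof (rule LIMSEQ_le_const)
      have "(\<lambda>n. a (s n) v) \<longlonglongrightarrow> a w v"
        by (rule tendsto_a_left[OF s(1) w(1) v w(2)])
      then have "(\<lambda>n. 1 / real (Suc n) + 2 * x * (a (s n) v - F v) + x\<^sup>2 * a v v)
          \<longlonglongrightarrow> 0 + 2 * x * (a w v - F v) + x\<^sup>2 * a v v"
        by (intro tendsto_intros LIMSEQ_Suc lim_1_over_n)
      then show "(\<lambda>n. 1 / real (Suc n) + 2 * x * (a (s n) v - F v) + x\<^sup>2 * a v v)
          \<longlonglongrightarrow> 2 * x * (a w v - F v) + x\<^sup>2 * a v v" by simp
      have "0 \<le> 1 / real (Suc n) + 2 * x * (a (s n) v - F v) + x\<^sup>2 * a v v" for n
      proof -
        have "J (s n + x *\<^sub>R v) = J (s n) + 2 * x * (a (s n) v - F v) + x\<^sup>2 * a v v"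
          using s(1) v
          by (simp add: J_def a_simps F_add F_scale a_sym[of v "s n"] algebra_simps power2_eq_square)
        then show ?thesis
          using d_le[of "s n + x *\<^sub>R v"] s(1)[of n] s(2)[of n] v by auto
      qed
      then show "\<exists>N. \<forall>n\<ge>N. 0 \<le> 1 / real (Suc n) + 2 * x * (a (s n) v - F v) + x\<^sup>2 * a v v"
        by blast
    qed
    then show ?thesis
      using linear_coefficient_zero[of "a w v - F v" "a v v"] a_nonneg[OF v] by simp
  qed
  have "represent H a F = w" by (rule represent_eqI[OF w(1) rep])
  then show "represent H a F \<in> H" "\<And>v. v \<in> H \<Longrightarrow> a (represent H a F) v = F v"
    using w(1) rep by auto
qed

text \<open>
  An injective operator is bounded below if it controls the norm up to finitely many functionals:
  along a normalised sequence with \<open>T (s n)\<close> tending to zero, a subsequence makes these functionals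
  converge, so that the estimate turns it into a Cauchy sequence, whose limit would lie in the kernel.
\<close>

lemma bounded_below_of_injective:
  fixes g :: "'f \<Rightarrow> 'b \<Rightarrow> real"
  assumes T: "symmetric_operator H T" and D: "\<And>u. u \<in> H \<Longrightarrow> nrm (T u) \<le> D * nrm u"
    and F: "finite F"
    and g_diff: "\<And>f u v. \<lbrakk>f \<in> F; u \<in> H; v \<in> H\<rbrakk> \<Longrightarrow> g f (u - v) = g f u - g f v"
    and g_bounded: "\<And>f u. \<lbrakk>f \<in> F; u \<in> H\<rbrakk> \<Longrightarrow> \<bar>g f u\<bar> \<le> M f * nrm u"
    and estimate: "\<And>w. w \<in> H \<Longrightarrow> nrm w \<le> C * (nrm (T w) + (\<Sum>f\<in>F. \<bar>g f w\<bar>))"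
    and injective: "\<And>u. \<lbrakk>u \<in> H; T u = 0\<rbrakk> \<Longrightarrow> u = 0"
    and C: "0 \<le> C"
  shows "\<exists>\<gamma>>0. \<forall>u\<in>H. \<gamma> * nrm u \<le> nrm (T u)"
proof (rule ccontr)
  note T_mem = symmetric_operatorD(1)[OF T] and T_lin = symmetric_operator_linear[OF T]
  assume neg: "\<not> ?thesis"
  have "\<exists>u\<in>H. nrm u = 1 \<and> nrm (T u) < 1 / real (Suc n)" for n
  proof -
    obtain u where u: "u \<in> H" "nrm (T u) < 1 / real (Suc n) * nrm u"
      using neg by (metis not_le zero_less_divide_1_iff of_nat_0_less_iff zero_less_Suc)
    then have "u \<noteq> 0" using nrm_nonneg[OF T_mem[OF u(1)]] by auto
    then have pos: "0 < nrm u" using u(1) nrm_pos by blast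
    then show ?thesis
      using u T_mem[OF u(1)]
      by (intro bexI[of _ "(1 / nrm u) *\<^sub>R u"]) (auto simp: nrm_scale T_lin field_simps)
  qed
  then obtain s where s: "\<And>n. s n \<in> H" "\<And>n. nrm (s n) = 1"
    "\<And>n. nrm (T (s n)) < 1 / real (Suc n)" by metis
  have "bounded (range (\<lambda>n. g f (s n)))" if "f \<in> F" for f
    using g_bounded[OF that s(1)] s(2) by (intro boundedI[of _ "M f"]) auto
  then obtain r :: "nat \<Rightarrow> nat" where r: "strict_mono r"
    and conv: "\<forall>f\<in>F. convergent (\<lambda>n. g f (s (r n)))"
    using common_convergent_subsequence[OF F, of "\<lambda>f n. g f (s n)"] by blast
  define L where "L f = lim (\<lambda>n. g f (s (r n)))" for f
  have L: "(\<lambda>n. g f (s (r n))) \<longlonglongrightarrow> L f" if "f \<in> F" for f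
    using conv that by (simp add: L_def convergent_LIMSEQ_iff)
  have Ts: "(\<lambda>n. nrm (T (s (r n)))) \<longlonglongrightarrow> 0"
  proof (rule tendsto_sandwich[of "\<lambda>_. 0" _ _ "\<lambda>n. 1 / real (Suc (r n))"])
    show "(\<lambda>n. 1 / real (Suc (r n))) \<longlonglongrightarrow> 0"
      using LIMSEQ_subseq_LIMSEQ[OF LIMSEQ_Suc[OF lim_1_over_n] r] by (simp add: o_def)
  qed (use s(1,3) T_mem nrm_nonneg in \<open>auto intro!: always_eventually less_imp_le\<close>)
  define \<rho> where "\<rho> n = C * (nrm (T (s (r n))) + (\<Sum>f\<in>F. \<bar>g f (s (r n)) - L f\<bar>))" for n
  have "\<rho> \<longlonglongrightarrow> C * (0 + (\<Sum>f\<in>F. \<bar>L f - L f\<bar>))"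
    unfolding \<rho>_def by (intro tendsto_intros Ts L)
  then have \<rho>: "\<rho> \<longlonglongrightarrow> 0" by simp
  have step: "nrm (s (r m) - s (r n)) \<le> \<rho> m + \<rho> n" for m n
  proof -
    let ?w = "s (r m) - s (r n)"
    have "nrm (T ?w) \<le> nrm (T (s (r m))) + nrm (T (s (r n)))"
      using s(1) T_mem by (simp add: T_lin nrm_triangle_diff)
    moreover have "(\<Sum>f\<in>F. \<bar>g f ?w\<bar>) \<le> (\<Sum>f\<in>F. \<bar>g f (s (r m)) - L f\<bar> + \<bar>g f (s (r n)) - L f\<bar>)"
      using s(1) by (intro sum_mono) (auto simp: g_diff)
    ultimately have "nrm (T ?w) + (\<Sum>f\<in>F. \<bar>g f ?w\<bar>) \<le>
        nrm (T (s (r m))) + nrm (T (s (r n))) +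
        ((\<Sum>f\<in>F. \<bar>g f (s (r m)) - L f\<bar>) + (\<Sum>f\<in>F. \<bar>g f (s (r n)) - L f\<bar>))"
      by (simp add: sum.distrib)
    from mult_left_mono[OF this C] show ?thesis
      using estimate[of ?w] s(1) by (simp add: \<rho>_def algebra_simps)
  qed
  have "\<exists>l\<in>H. (\<lambda>n. nrm (s (r n) - l)) \<longlonglongrightarrow> 0"
  proof (rule complete[OF s(1)])
    fix e :: real assume "0 < e"
    then obtain N where N: "\<And>n. n \<ge> N \<Longrightarrow> \<rho> n < e / 2"
      using order_tendstoD(2)[OF \<rho>, of "e / 2"] by (auto simp: eventually_sequentially)
    then have "nrm (s (r m) - s (r n)) < e" if "m \<ge> N" "n \<ge> N" for m n
      using step[of m n] N[of m] N[of n] that by linarith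
    then show "\<exists>N. \<forall>m\<ge>N. \<forall>n\<ge>N. nrm (s (r m) - s (r n)) < e" by blast
  qed
  then obtain l where l: "l \<in> H" "(\<lambda>n. nrm (s (r n) - l)) \<longlonglongrightarrow> 0" by blast
  have "nrm (T l) \<le> 0"
  proof (rule LIMSEQ_le_const)
    have "(\<lambda>n. D * nrm (s (r n) - l) + nrm (T (s (r n)))) \<longlonglongrightarrow> D * 0 + 0"
      by (intro tendsto_intros l(2) Ts)
    then show "(\<lambda>n. D * nrm (s (r n) - l) + nrm (T (s (r n)))) \<longlonglongrightarrow> 0" by simp
    have "nrm (T l) \<le> D * nrm (s (r n) - l) + nrm (T (s (r n)))" for n
      using nrm_le_diff[of "T l" "T (s (r n))"] D[of "l - s (r n)"] s(1) l(1) T_mem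
        nrm_minus_commute[of l "s (r n)"] by (simp add: T_lin)
    then show "\<exists>N. \<forall>n\<ge>N. nrm (T l) \<le> D * nrm (s (r n) - l) + nrm (T (s (r n)))" by blast
  qed
  then have "l = 0"
    using injective l(1) T_mem nrm_eq_0 nrm_nonneg by (metis order_antisym)
  then show False
    using l(2) s(2) LIMSEQ_const_iff[of "1::real" 0] by simp
qed

text \<open>
  The Cauchy--Schwarz inequality for the semidefinite form \<open>a (T u) v\<close>, at \<open>v = T u\<close>, bounds the square of
  the norm of \<open>T u\<close> by a multiple of \<open>a (T u) u\<close>; so an operator bounded below is coercive.
\<close>

lemma coercive_of_injective:
  fixes g :: "'f \<Rightarrow> 'b \<Rightarrow> real"
  assumes T: "symmetric_operator H T" and D: "\<And>u. u \<in> H \<Longrightarrow> nrm (T u) \<le> D * nrm u"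
    and F: "finite F"
    and g: "\<And>f u v. \<lbrakk>f \<in> F; u \<in> H; v \<in> H\<rbrakk> \<Longrightarrow> g f (u - v) = g f u - g f v"
      "\<And>f u. \<lbrakk>f \<in> F; u \<in> H\<rbrakk> \<Longrightarrow> \<bar>g f u\<bar> \<le> M f * nrm u"
    and estimate: "\<And>w. w \<in> H \<Longrightarrow> nrm w \<le> C * (nrm (T w) + (\<Sum>f\<in>F. \<bar>g f w\<bar>))"
    and injective: "\<And>u. \<lbrakk>u \<in> H; T u = 0\<rbrakk> \<Longrightarrow> u = 0"
    and C: "0 \<le> C"
    and nonneg: "\<And>u. u \<in> H \<Longrightarrow> 0 \<le> a (T u) u"
  shows "\<exists>\<gamma>>0. \<forall>u\<in>H. \<gamma> * (nrm u)\<^sup>2 \<le> a (T u) u"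
proof -
  note T_mem = symmetric_operatorD(1)[OF T] and T_lin = symmetric_operator_linear[OF T]
  obtain \<gamma> where \<gamma>: "0 < \<gamma>" "\<And>u. u \<in> H \<Longrightarrow> \<gamma> * nrm u \<le> nrm (T u)"
    using bounded_below_of_injective[OF T D F g estimate injective C] by blast
  define D' where "D' = max D 1"
  have D': "0 < D'" "\<And>u. u \<in> H \<Longrightarrow> nrm (T u) \<le> D' * nrm u"
    using D nrm_nonneg mult_right_mono[of D D'] unfolding D'_def
    by (auto intro: order_trans[OF D])
  have "\<gamma>\<^sup>2 / D' * (nrm u)\<^sup>2 \<le> a (T u) u" if u: "u \<in> H" for u
  proof (cases "T u = 0")
    case True
    then show ?thesis using injective[OF u] by simp
  next
    case False
    let ?v = "T u"
    have v: "?v \<in> H" using T_mem u .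
    have "(a (T u) ?v)\<^sup>2 \<le> a (T u) u * a (T ?v) ?v"
      using u v T_mem nonneg symmetric_operatorD(2)[OF T]
      by (intro semidefinite_Cauchy_Schwarz[of "\<lambda>u v. a (T u) v"]) (auto simp: T_lin a_simps a_sym)
    moreover have "a (T ?v) ?v \<le> D' * (nrm ?v)\<^sup>2"
    proof -
      have "a (T ?v) ?v \<le> nrm (T ?v) * nrm ?v"
        using Cauchy_Schwarz[of "T ?v" ?v] v T_mem by auto
      also have "\<dots> \<le> D' * nrm ?v * nrm ?v"
        using D'(2)[OF v] nrm_nonneg[OF v] by (intro mult_right_mono) auto
      finally show ?thesis by (simp add: power2_eq_square mult.assoc)
    qed
    ultimately have "((nrm ?v)\<^sup>2)\<^sup>2 \<le> a (T u) u * (D' * (nrm ?v)\<^sup>2)"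
      using nonneg[OF u] nrm_square[OF v] mult_left_mono[of "a (T ?v) ?v" _ "a (T u) u"] by fastforce
    then have "(nrm ?v)\<^sup>2 * (nrm ?v)\<^sup>2 \<le> (a (T u) u * D') * (nrm ?v)\<^sup>2"
      by (simp add: power2_eq_square mult.assoc)
    then have "(nrm ?v)\<^sup>2 \<le> a (T u) u * D'"
      by (rule mult_right_le_imp_le) (use nrm_pos[OF v False] in simp)
    moreover have "(\<gamma> * nrm u)\<^sup>2 \<le> (nrm ?v)\<^sup>2"
      using \<gamma> nrm_nonneg[OF u] u by (intro power_mono) auto
    ultimately show ?thesis using D'(1) by (simp add: field_simps power_mult_distrib)
  qed
  moreover have "0 < \<gamma>\<^sup>2 / D'" using \<gamma>(1) D'(1) by simp
  ultimately show ?thesis by blast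
qed

lemma orthogonal_complement_hilbert_form:
  assumes E: "E \<subseteq> H"
  shows "hilbert_form {u \<in> H. \<forall>e\<in>E. a e u = 0} a"
proof -
  let ?Y = "{u \<in> H. \<forall>e\<in>E. a e u = 0}"
  have "subspace ?Y"
    using E by (auto simp: subspace_def a_simps subset_eq)
  then interpret Y: inner_form ?Y a by (rule subspace_inner_form) auto
  show ?thesis
  proof unfold_locales
    fix s :: "nat \<Rightarrow> 'b"
    assume s: "\<And>n. s n \<in> ?Y" "\<And>e. 0 < e \<Longrightarrow> \<exists>N. \<forall>m\<ge>N. \<forall>n\<ge>N. nrm (s m - s n) < e"
    then obtain l where l: "l \<in> H" "(\<lambda>n. nrm (s n - l)) \<longlonglongrightarrow> 0"
      using complete[of s] by auto
    have "a e l = 0" if e: "e \<in> E" for e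
    proof -
      have "(\<lambda>n. a (s n) e) \<longlonglongrightarrow> a l e"
        using s(1) l e E by (intro tendsto_a_left) auto
      moreover have "a (s n) e = 0" for n
        using s(1)[of n] e E a_sym[of "s n" e] by auto
      ultimately show ?thesis
        using LIMSEQ_const_iff[of "0::real"] a_sym[of l e] l(1) e E by auto
    qed
    then show "\<exists>l\<in>?Y. (\<lambda>n. nrm (s n - l)) \<longlonglongrightarrow> 0" using l by blast
  qed
qed

end

context inner_form begin

lemma finite_dim_hilbert_form:
  assumes "finite_dim H"
  shows "hilbert_form H a"
proof unfold_locales
  fix s :: "nat \<Rightarrow> 'b"
  assume s: "\<And>n. s n \<in> H" and cauchy: "\<And>e. 0 < e \<Longrightarrow> \<exists>N. \<forall>m\<ge>N. \<forall>n\<ge>N. nrm (s m - s n) < e"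
  obtain B where B: "orthonormal B" "span B = H"
    using orthonormal_basis_exists[OF H_subspace assms order_refl] .
  note D = orthonormalD[OF B(1)]
  have nrm_basis: "nrm e = 1" if "e \<in> B" for e using D(3)[OF that that] by (simp add: nrm_def)
  have "Cauchy (\<lambda>n. a e (s n))" if e: "e \<in> B" for e
  proof (rule metric_CauchyI)
    fix \<epsilon> :: real assume "0 < \<epsilon>"
    then obtain N where N: "\<forall>m\<ge>N. \<forall>n\<ge>N. nrm (s m - s n) < \<epsilon>" using cauchy by blast
    have "dist (a e (s m)) (a e (s n)) \<le> nrm (s m - s n)" for m n
      using Cauchy_Schwarz[of e "s m - s n"] nrm_basis[OF e] e D(2) s
      by (auto simp: dist_real_def a_diff_right subset_eq)
    with N show "\<exists>N. \<forall>m\<ge>N. \<forall>n\<ge>N. dist (a e (s m)) (a e (s n)) < \<epsilon>"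
      by (meson order_le_less_trans)
  qed
  then have "\<forall>e\<in>B. \<exists>c. (\<lambda>n. a e (s n)) \<longlonglongrightarrow> c"
    using real_Cauchy_convergent by (auto simp: convergent_def)
  then obtain c where c: "\<And>e. e \<in> B \<Longrightarrow> (\<lambda>n. a e (s n)) \<longlonglongrightarrow> c e" by metis
  define l where "l = (\<Sum>e\<in>B. c e *\<^sub>R e)"
  have l: "l \<in> H" unfolding l_def using D(2) by (intro H_sum) auto
  have "(nrm (s n - l))\<^sup>2 = (\<Sum>e\<in>B. (a e (s n) - c e)\<^sup>2)" for n
  proof -
    have "s n = (\<Sum>e\<in>B. a e (s n) *\<^sub>R e)"
      using orthonormal_expansion[OF B(1), of "s n"] B(2) s by simp
    then have "s n - l = (\<Sum>e\<in>B. (a e (s n) - c e) *\<^sub>R e)"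
      unfolding l_def by (simp add: sum_subtractf scaleR_diff_left)
    then show ?thesis using orthonormal_nrm_square[OF B(1)] by simp
  qed
  then have eq: "nrm (s n - l) = sqrt (\<Sum>e\<in>B. (a e (s n) - c e)\<^sup>2)" for n
    using nrm_nonneg[of "s n - l"] s l by (metis H_diff real_sqrt_unique)
  have "(\<lambda>n. sqrt (\<Sum>e\<in>B. (a e (s n) - c e)\<^sup>2)) \<longlonglongrightarrow> sqrt (\<Sum>e\<in>B. (c e - c e)\<^sup>2)"
    by (intro tendsto_intros c)
  then show "\<exists>l\<in>H. (\<lambda>n. nrm (s n - l)) \<longlonglongrightarrow> 0"
    using l eq by (intro bexI[of _ l]) auto
qed

lemma nrm_le_sum_coefficients:
  assumes B: "orthonormal B" and u: "u \<in> span B"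
  shows "nrm u \<le> (\<Sum>e\<in>B. \<bar>a e u\<bar>)"
proof -
  note D = orthonormalD[OF B]
  have "nrm (\<Sum>e\<in>B. a e u *\<^sub>R e) \<le> (\<Sum>e\<in>B. nrm (a e u *\<^sub>R e))"
    using D(2) by (intro nrm_sum) auto
  also have "\<dots> = (\<Sum>e\<in>B. \<bar>a e u\<bar>)"
  proof (rule sum.cong)
    fix e assume e: "e \<in> B"
    then have "nrm e = 1" using D(3)[OF e e] by (simp add: nrm_def)
    then show "nrm (a e u *\<^sub>R e) = \<bar>a e u\<bar>" using nrm_scale[of e] D(2) e by auto
  qed simp
  finally show ?thesis using orthonormal_expansion[OF B u] by simp
qed

text \<open>
  Subtracting the infimum \<open>c\<close> of the Rayleigh quotient leaves a nonnegative operator that is not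
  coercive, hence not injective.
\<close>

lemma eigenvector_exists:
  assumes fin: "finite_dim H" and u0: "u0 \<in> H" "u0 \<noteq> 0" and S: "symmetric_operator H S"
  shows "\<exists>v\<in>H. nrm v = 1 \<and> (\<exists>\<nu>. S v = \<nu> *\<^sub>R v)"
proof -
  interpret hilbert_form H a by (rule finite_dim_hilbert_form[OF fin])
  note S_mem = symmetric_operatorD(1)[OF S] and S_lin = symmetric_operator_linear[OF S]
  obtain B where B: "orthonormal B" "span B = H"
    using orthonormal_basis_exists[OF H_subspace fin order_refl] .
  note BD = orthonormalD[OF B(1)]
  have nrm_basis: "nrm e = 1" if "e \<in> B" for e using BD(3)[OF that that] by (simp add: nrm_def)
  define D where "D = (\<Sum>e\<in>B. nrm (S e))"
  have D: "nrm (S u) \<le> D * nrm u" if u: "u \<in> H" for u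
  proof -
    have coef: "\<bar>a e u\<bar> \<le> nrm u" if "e \<in> B" for e
      using Cauchy_Schwarz[of e u] nrm_basis[OF that] that u BD(2) by auto
    have "nrm (S u) \<le> D * nrm u"
    proof (rule operator_nrm_le)
      show "S u \<in> H" using S_mem u .
      show "0 \<le> D * nrm u"
        unfolding D_def using S_mem BD(2) u by (intro mult_nonneg_nonneg sum_nonneg nrm_nonneg) auto
      fix v assume v: "v \<in> H"
      have "a (S u) v = a u (S v)" using symmetric_operatorD(2)[OF S u v] .
      also have "\<dots> = (\<Sum>e\<in>B. a e u * a e (S v))"
      proof -
        have "a u (S v) = a (\<Sum>e\<in>B. a e u *\<^sub>R e) (S v)"
          using orthonormal_expansion[OF B(1), of u] B(2) u by simp
        also have "\<dots> = (\<Sum>e\<in>B. a e u * a e (S v))"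
          using BD(2) S_mem[OF v] by (subst a_sum_left) (auto simp: a_scale_left subset_eq)
        finally show ?thesis .
      qed
      also have "\<dots> = (\<Sum>e\<in>B. a e u * a (S e) v)"
        using symmetric_operatorD(2)[OF S _ v] BD(2) by (intro sum.cong) auto
      finally have "\<bar>a (S u) v\<bar> \<le> (\<Sum>e\<in>B. \<bar>a e u * a (S e) v\<bar>)" by simp
      also have "\<dots> \<le> (\<Sum>e\<in>B. nrm u * (nrm (S e) * nrm v))"
        unfolding abs_mult using coef Cauchy_Schwarz[OF S_mem v] BD(2) nrm_nonneg[OF u]
        by (intro sum_mono mult_mono) auto
      also have "\<dots> = D * nrm u * nrm v"
        by (simp add: D_def sum_distrib_left sum_distrib_right algebra_simps)
      finally show "\<bar>a (S u) v\<bar> \<le> D * nrm u * nrm v" .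
    qed
    then show ?thesis .
  qed
  define R where "R = (\<lambda>u. a (S u) u) ` {u \<in> H. nrm u = 1}"
  define c where "c = Inf R"
  have "(1 / nrm u0) *\<^sub>R u0 \<in> {u \<in> H. nrm u = 1}"
    using u0 nrm_pos[OF u0] by (auto simp: nrm_scale)
  then have R_ne: "R \<noteq> {}" unfolding R_def by blast
  have R_bdd: "bdd_below R"
  proof (rule bdd_belowI)
    fix x assume "x \<in> R"
    then obtain u where u: "u \<in> H" "nrm u = 1" "x = a (S u) u" by (auto simp: R_def)
    then show "- D \<le> x" using Cauchy_Schwarz[OF S_mem u(1)] D[of u] u by fastforce
  qed
  define T where "T u = S u - c *\<^sub>R u" for u
  have T: "symmetric_operator H T"
    using symmetric_operatorD[OF S] unfolding symmetric_operator_def T_def by (auto simp: a_simps)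
  have c_le: "c \<le> a (S u) u" if "u \<in> H" "nrm u = 1" for u
    unfolding c_def using that R_bdd by (intro cInf_lower) (auto simp: R_def)
  have T_nonneg: "0 \<le> a (T u) u" if u: "u \<in> H" for u
  proof (cases "u = 0")
    case False
    then have pos: "0 < nrm u" using nrm_pos u by blast
    have "c \<le> a (S ((1 / nrm u) *\<^sub>R u)) ((1 / nrm u) *\<^sub>R u)"
      using u pos by (intro c_le) (auto simp: nrm_scale)
    then have "c * (nrm u)\<^sup>2 \<le> a (S u) u"
      using u pos S_mem[OF u] by (simp add: S_lin a_simps field_simps power2_eq_square)
    then show ?thesis using u S_mem[OF u] by (simp add: T_def a_simps nrm_square)
  qed (use u S_mem in \<open>simp add: T_def\<close>)
  have "\<exists>u\<in>H. T u = 0 \<and> u \<noteq> 0"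
  proof (rule ccontr)
    assume inj: "\<not> ?thesis"
    have "\<exists>\<gamma>>0. \<forall>u\<in>H. \<gamma> * (nrm u)\<^sup>2 \<le> a (T u) u"
    proof (rule coercive_of_injective[where g = a and F = B and C = 1 and M = nrm, OF T])
      show "nrm (T u) \<le> (D + \<bar>c\<bar>) * nrm u" if "u \<in> H" for u
        using nrm_triangle_diff[of "S u" "c *\<^sub>R u"] D[OF that] S_mem that
        by (simp add: T_def nrm_scale algebra_simps)
      show "nrm w \<le> 1 * (nrm (T w) + (\<Sum>f\<in>B. \<bar>a f w\<bar>))" if "w \<in> H" for w
        using nrm_le_sum_coefficients[OF B(1), of w] B(2) that
          nrm_nonneg[OF symmetric_operatorD(1)[OF T that]] by simp
    qed (use inj BD T_nonneg Cauchy_Schwarz in \<open>auto simp: a_diff_right\<close>)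
    then obtain \<gamma> where \<gamma>: "0 < \<gamma>" "\<And>u. u \<in> H \<Longrightarrow> \<gamma> * (nrm u)\<^sup>2 \<le> a (T u) u" by blast
    have "c + \<gamma> \<le> Inf R"
    proof (rule cInf_greatest[OF R_ne])
      fix x assume "x \<in> R"
      then obtain u where u: "u \<in> H" "nrm u = 1" "x = a (S u) u" by (auto simp: R_def)
      then show "c + \<gamma> \<le> x"
        using \<gamma>(2)[of u] S_mem[of u] nrm_square[of u] by (simp add: T_def a_simps)
    qed
    with \<gamma>(1) show False by (simp add: c_def)
  qed
  then obtain u where u: "u \<in> H" "S u = c *\<^sub>R u" "u \<noteq> 0" by (auto simp: T_def)
  then have "0 < nrm u" using nrm_pos by blast
  then show ?thesis
    using u by (intro bexI[of _ "(1 / nrm u) *\<^sub>R u"]) (auto simp: nrm_scale S_lin intro!: exI[of _ c])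
qed

definition eigenbasis :: "'b set \<Rightarrow> ('b \<Rightarrow> 'b) \<Rightarrow> 'b set \<Rightarrow> ('b \<Rightarrow> real) \<Rightarrow> bool" where
  "eigenbasis W S B \<theta> \<longleftrightarrow> orthonormal B \<and> span B = W \<and> (\<forall>e\<in>B. S e = \<theta> e *\<^sub>R e)"

text \<open>
  The orthogonal complement of a system of eigenvectors is invariant under \<open>S\<close>, so unless it is trivial
  it contains a further eigenvector.
\<close>

lemma spectral_theorem:
  assumes W: "subspace W" "finite_dim W" "W \<subseteq> H" and S: "symmetric_operator W S"
  shows "\<exists>B \<theta>. eigenbasis W S B \<theta>"
proof -
  interpret W: inner_form W a by (rule subspace_inner_form[OF W(1,3)])
  note S_mem = symmetric_operatorD(1)[OF S] and S_sym = symmetric_operatorD(2)[OF S]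
  have "\<exists>B. orthonormal B \<and> (\<forall>e\<in>B. \<exists>\<nu>. S e = \<nu> *\<^sub>R e) \<and> span B = W"
  proof (rule orthonormal_basis_of_property[OF W])
    fix B u
    assume B: "orthonormal B" "B \<subseteq> W" "\<forall>e\<in>B. \<exists>\<nu>. S e = \<nu> *\<^sub>R e"
      and u: "u \<in> W" "u \<noteq> 0" "\<forall>e\<in>B. a e u = 0"
    define Y where "Y = {w \<in> W. \<forall>e\<in>B. a e w = 0}"
    have "subspace Y"
      unfolding Y_def subspace_def using B(2) by (auto simp: W.a_simps subset_eq)
    moreover have "Y \<subseteq> W" by (auto simp: Y_def)
    ultimately interpret Y: inner_form Y a by (rule W.subspace_inner_form)
    have "S w \<in> Y" if w: "w \<in> Y" for w
    proof -
      have "a e (S w) = 0" if e: "e \<in> B" for e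
      proof -
        obtain \<nu> where "S e = \<nu> *\<^sub>R e" using B(3) e by blast
        then show ?thesis
          using S_sym[of e w] W.a_scale_left[of e w \<nu>] e w B(2) by (auto simp: Y_def)
      qed
      then show ?thesis using w S_mem by (auto simp: Y_def)
    qed
    then have "Y.symmetric_operator Y S"
      using S_sym \<open>Y \<subseteq> W\<close> by (auto simp: Y.symmetric_operator_def)
    moreover have "finite_dim Y" using W(2) \<open>Y \<subseteq> W\<close> by (auto simp: finite_dim_def)
    moreover have "u \<in> Y" using u by (auto simp: Y_def)
    ultimately show "\<exists>v\<in>W. nrm v = 1 \<and> (\<exists>\<nu>. S v = \<nu> *\<^sub>R v) \<and> (\<forall>e\<in>B. a e v = 0)"
      using Y.eigenvector_exists[of u S] u(2) by (auto simp: Y_def)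
  qed
  then obtain B where "orthonormal B" "\<forall>e\<in>B. \<exists>\<nu>. S e = \<nu> *\<^sub>R e" "span B = W" by blast
  then show ?thesis by (auto simp: eigenbasis_def intro: bchoice)
qed

lemma eigenbasis_finite: "eigenbasis W S B \<theta> \<Longrightarrow> finite B"
  by (simp add: eigenbasis_def orthonormal_def)

lemma eigenspace_eigenbasis:
  assumes B: "eigenbasis W S B \<theta>" and W: "W \<subseteq> H" "subspace W" and S: "symmetric_operator W S"
  shows "eigenspace W S \<nu> = span {e \<in> B. \<theta> e = \<nu>}"
proof -
  interpret W: inner_form W a by (rule subspace_inner_form[OF W(2,1)])
  note S_mem = symmetric_operatorD(1)[OF S] and S_sym = symmetric_operatorD(2)[OF S]
  have orth: "orthonormal B" and spanB: "span B = W" and eig: "\<And>e. e \<in> B \<Longrightarrow> S e = \<theta> e *\<^sub>R e"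
    using B by (auto simp: eigenbasis_def)
  have BW: "B \<subseteq> W" using spanB span_superset by blast
  have SW: "W.symmetric_operator W S" using S by (simp add: symmetric_operator_def W.symmetric_operator_def)
  note S_lin = W.symmetric_operator_linear[OF SW]
  show ?thesis
  proof
    have "subspace (eigenspace W S \<nu>)"
      unfolding subspace_def eigenspace_def using S_lin(2)[of 0 0]
      by (auto simp: S_lin scaleR_add_right)
    then show "span {e \<in> B. \<theta> e = \<nu>} \<subseteq> eigenspace W S \<nu>"
      using eig BW by (intro span_minimal) (auto simp: eigenspace_def)
    show "eigenspace W S \<nu> \<subseteq> span {e \<in> B. \<theta> e = \<nu>}"
    proof
      fix u assume "u \<in> eigenspace W S \<nu>"
      then have u: "u \<in> W" "S u = \<nu> *\<^sub>R u" by (auto simp: eigenspace_def)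
      have "a e u = 0" if e: "e \<in> B" "\<theta> e \<noteq> \<nu>" for e
      proof -
        have "\<theta> e * a e u = \<nu> * a e u"
          using S_sym[of e u] eig[OF e(1)] u BW e(1) by (auto simp: W.a_simps)
        then show ?thesis using e(2) by simp
      qed
      then have "(\<Sum>e\<in>B. a e u *\<^sub>R e) = (\<Sum>e\<in>{e \<in> B. \<theta> e = \<nu>}. a e u *\<^sub>R e)"
        using orthonormalD(1)[OF orth] by (intro sum.mono_neutral_right) auto
      then have "u = (\<Sum>e\<in>{e \<in> B. \<theta> e = \<nu>}. a e u *\<^sub>R e)"
        using orthonormal_expansion[OF orth] u(1) spanB by auto
      then show "u \<in> span {e \<in> B. \<theta> e = \<nu>}"
        by (metis (mono_tags, lifting) span_base span_scale span_sum)
    qed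
  qed
qed

lemma multiplicity_eigenbasis:
  assumes "eigenbasis W S B \<theta>" "W \<subseteq> H" "subspace W" "symmetric_operator W S"
  shows "multiplicity_of W S \<nu> = card {e \<in> B. \<theta> e = \<nu>}"
proof -
  have "orthonormal {e \<in> B. \<theta> e = \<nu>}"
    using assms(1) orthonormal_subset[of B] by (auto simp: eigenbasis_def)
  then show ?thesis
    using eigenspace_eigenbasis[OF assms] by (simp add: multiplicity_of_def dim_span_orthonormal del: dim_span)
qed

lemma eigenvalues_eigenbasis:
  assumes B: "eigenbasis W S B \<theta>" and "W \<subseteq> H" "subspace W" "symmetric_operator W S"
  shows "eigenvalues W S = \<theta> ` B"
proof -
  have "\<nu> \<in> eigenvalues W S \<longleftrightarrow> \<nu> \<in> \<theta> ` B" for \<nu>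
  proof -
    have "\<nu> \<in> eigenvalues W S \<longleftrightarrow> (\<exists>u\<in>eigenspace W S \<nu>. u \<noteq> 0)"
      by (auto simp: eigenvalues_def eigenspace_def)
    also have "\<dots> \<longleftrightarrow> \<not> {e \<in> B. \<theta> e = \<nu>} \<subseteq> {0}"
    proof -
      have "span {e \<in> B. \<theta> e = \<nu>} \<subseteq> {0} \<longleftrightarrow> {e \<in> B. \<theta> e = \<nu>} \<subseteq> {0}"
      proof
        show "{e \<in> B. \<theta> e = \<nu>} \<subseteq> {0}" if "span {e \<in> B. \<theta> e = \<nu>} \<subseteq> {0}"
          using span_superset that by (rule order_trans)
      qed (rule span_minimal[OF _ subspace_single_0])
      then show ?thesis unfolding eigenspace_eigenbasis[OF assms] by blast
    qed
    also have "\<dots> \<longleftrightarrow> \<nu> \<in> \<theta> ` B"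
    proof -
      have "0 \<notin> B" using B orthonormalD(3)[of B 0 0] by (force simp: eigenbasis_def)
      then show ?thesis by auto
    qed
    finally show ?thesis .
  qed
  then show ?thesis by blast
qed

end

section \<open>Galerkin approximation of a compact form\<close>

text \<open>
  The last assumption is compactness of \<open>b\<close> relative to \<open>a\<close>. It is expressed through approximation by
  finite rank, with an explicit set \<open>F\<close>, because bounds that are uniform in the trial space come from
  using the same \<open>F\<close> for all of them.
\<close>

locale compact_form = hilbert_form H a for H :: "'b::real_vector set" and a +
  fixes b :: "'b \<Rightarrow> 'b \<Rightarrow> real"
  assumes b_add_left: "\<lbrakk>u \<in> H; v \<in> H; w \<in> H\<rbrakk> \<Longrightarrow> b (u + v) w = b u w + b v w"
    and b_scale_left: "\<lbrakk>u \<in> H; w \<in> H\<rbrakk> \<Longrightarrow> b (c *\<^sub>R u) w = c * b u w"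
    and b_sym: "\<lbrakk>u \<in> H; v \<in> H\<rbrakk> \<Longrightarrow> b u v = b v u"
    and b_compact: "0 < \<epsilon> \<Longrightarrow> \<exists>F. finite F \<and> F \<subseteq> H \<and>
      (\<forall>w\<in>H. \<forall>v\<in>H. \<bar>b w v\<bar> \<le> (\<epsilon> * nrm w + (\<Sum>f\<in>F. \<bar>a f w\<bar>)) * nrm v)"
begin

lemma b_add_right: "\<lbrakk>u \<in> H; v \<in> H; w \<in> H\<rbrakk> \<Longrightarrow> b w (u + v) = b w u + b w v"
  using b_add_left[of u v w] b_sym[of w] by simp

lemma b_scale_right: "\<lbrakk>u \<in> H; w \<in> H\<rbrakk> \<Longrightarrow> b w (c *\<^sub>R u) = c * b w u"
  using b_scale_left[of u w c] b_sym[of w] by simp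

lemma b_diff_left: "\<lbrakk>u \<in> H; v \<in> H; w \<in> H\<rbrakk> \<Longrightarrow> b (u - v) w = b u w - b v w"
  using b_add_left[of u "(-1) *\<^sub>R v" w] b_scale_left[of v w "-1"] H_scale[of v "-1"] by simp

lemma b_diff_right: "\<lbrakk>u \<in> H; v \<in> H; w \<in> H\<rbrakk> \<Longrightarrow> b w (u - v) = b w u - b w v"
  using b_diff_left[of u v w] b_sym[of w] by simp

lemmas b_simps = b_add_left b_add_right b_scale_left b_scale_right b_diff_left b_diff_right

lemma b_bounded:
  obtains C where "0 < C" "\<And>u v. \<lbrakk>u \<in> H; v \<in> H\<rbrakk> \<Longrightarrow> \<bar>b u v\<bar> \<le> C * nrm u * nrm v"
proof -
  obtain F where F: "finite F" "F \<subseteq> H"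
    "\<And>w v. \<lbrakk>w \<in> H; v \<in> H\<rbrakk> \<Longrightarrow> \<bar>b w v\<bar> \<le> (1 * nrm w + (\<Sum>f\<in>F. \<bar>a f w\<bar>)) * nrm v"
    using b_compact[of 1] by auto
  have "\<bar>b u v\<bar> \<le> (1 + (\<Sum>f\<in>F. nrm f)) * nrm u * nrm v" if u: "u \<in> H" and v: "v \<in> H" for u v
  proof -
    have "(\<Sum>f\<in>F. \<bar>a f u\<bar>) \<le> (\<Sum>f\<in>F. nrm f * nrm u)"
      using F(2) u by (intro sum_mono Cauchy_Schwarz) auto
    then have "1 * nrm u + (\<Sum>f\<in>F. \<bar>a f u\<bar>) \<le> (1 + (\<Sum>f\<in>F. nrm f)) * nrm u"
      by (simp add: sum_distrib_right distrib_right)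
    from mult_right_mono[OF this nrm_nonneg[OF v]] show ?thesis
      using F(3)[OF u v] by linarith
  qed
  moreover have "0 < 1 + (\<Sum>f\<in>F. nrm f)"
    using F(2) nrm_nonneg by (intro add_pos_nonneg sum_nonneg) auto
  ultimately show ?thesis using that by blast
qed

definition K :: "'b \<Rightarrow> 'b" where "K u = represent H a (b u)"

lemma K:
  assumes u: "u \<in> H"
  shows K_mem: "K u \<in> H" and a_K: "v \<in> H \<Longrightarrow> a (K u) v = b u v"
proof -
  obtain C where C: "0 < C" "\<And>u v. \<lbrakk>u \<in> H; v \<in> H\<rbrakk> \<Longrightarrow> \<bar>b u v\<bar> \<le> C * nrm u * nrm v"
    by (rule b_bounded) (rule that)
  have *: "represent H a (b u) \<in> H" "\<And>v. v \<in> H \<Longrightarrow> a (represent H a (b u)) v = b u v"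
    by (rule Riesz_representation[of "b u" "C * nrm u"]; use u C(2)[OF u] in \<open>auto simp: b_simps\<close>)+
  then show "K u \<in> H" "v \<in> H \<Longrightarrow> a (K u) v = b u v" by (auto simp: K_def)
qed

lemma K_symmetric: "symmetric_operator H K"
  using K_mem a_K a_sym b_sym by (auto simp: symmetric_operator_def)

lemmas K_linear = symmetric_operator_linear[OF K_symmetric]

lemma K_bounded:
  obtains C where "0 < C" "\<And>u. u \<in> H \<Longrightarrow> nrm (K u) \<le> C * nrm u"
proof -
  obtain C where C: "0 < C" "\<And>u v. \<lbrakk>u \<in> H; v \<in> H\<rbrakk> \<Longrightarrow> \<bar>b u v\<bar> \<le> C * nrm u * nrm v"
    by (rule b_bounded) (rule that)
  have "nrm (K u) \<le> C * nrm u" if "u \<in> H" for u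
    using C that by (intro operator_nrm_le) (auto simp: a_K K_mem nrm_nonneg)
  then show ?thesis using that C(1) by blast
qed

lemma K_compact:
  assumes "0 < \<epsilon>"
  obtains F where "finite F" "F \<subseteq> H"
    "\<And>w v. \<lbrakk>w \<in> H; v \<in> H\<rbrakk> \<Longrightarrow> \<bar>b w v\<bar> \<le> (\<epsilon> * nrm w + (\<Sum>f\<in>F. \<bar>a f w\<bar>)) * nrm v"
    "\<And>w. w \<in> H \<Longrightarrow> nrm (K w) \<le> \<epsilon> * nrm w + (\<Sum>f\<in>F. \<bar>a f w\<bar>)"
proof -
  obtain F where F: "finite F" "F \<subseteq> H"
    "\<And>w v. \<lbrakk>w \<in> H; v \<in> H\<rbrakk> \<Longrightarrow> \<bar>b w v\<bar> \<le> (\<epsilon> * nrm w + (\<Sum>f\<in>F. \<bar>a f w\<bar>)) * nrm v"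
    using b_compact[OF assms] by blast
  have "nrm (K w) \<le> \<epsilon> * nrm w + (\<Sum>f\<in>F. \<bar>a f w\<bar>)" if w: "w \<in> H" for w
  proof (rule operator_nrm_le[OF K_mem[OF w]])
    show "0 \<le> \<epsilon> * nrm w + (\<Sum>f\<in>F. \<bar>a f w\<bar>)"
      using assms nrm_nonneg[OF w] by (intro add_nonneg_nonneg sum_nonneg) auto
    show "\<bar>a (K w) v\<bar> \<le> (\<epsilon> * nrm w + (\<Sum>f\<in>F. \<bar>a f w\<bar>)) * nrm v" if "v \<in> H" for v
      using F(3)[OF w that] a_K[OF w that] by simp
  qed
  then show ?thesis using that F by blast
qed

lemma K_shift_estimate:
  assumes "\<mu> \<noteq> 0"
  obtains F where "finite F" "F \<subseteq> H"
    "\<And>w. w \<in> H \<Longrightarrow> nrm w \<le> 2 / \<bar>\<mu>\<bar> * (nrm (K w - \<mu> *\<^sub>R w) + (\<Sum>f\<in>F. \<bar>a f w\<bar>))"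
proof -
  obtain F where F: "finite F" "F \<subseteq> H"
    "\<And>w. w \<in> H \<Longrightarrow> nrm (K w) \<le> \<bar>\<mu>\<bar> / 2 * nrm w + (\<Sum>f\<in>F. \<bar>a f w\<bar>)"
    by (rule K_compact[of "\<bar>\<mu>\<bar> / 2"]) (use assms in simp, rule that)
  have "nrm w \<le> 2 / \<bar>\<mu>\<bar> * (nrm (K w - \<mu> *\<^sub>R w) + (\<Sum>f\<in>F. \<bar>a f w\<bar>))" if w: "w \<in> H" for w
  proof -
    have "\<bar>\<mu>\<bar> * nrm w \<le> nrm (\<mu> *\<^sub>R w - K w) + nrm (K w)"
      using nrm_le_diff[of "\<mu> *\<^sub>R w" "K w"] w K_mem by (simp add: nrm_scale)
    then have "\<bar>\<mu>\<bar> * nrm w \<le> 2 * (nrm (K w - \<mu> *\<^sub>R w) + (\<Sum>f\<in>F. \<bar>a f w\<bar>))"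
      using F(3)[OF w] nrm_minus_commute[of "\<mu> *\<^sub>R w" "K w"] w K_mem[OF w] by simp
    then show ?thesis using assms by (simp add: field_simps)
  qed
  then show ?thesis using that F by blast
qed

lemma K_shift_symmetric: "symmetric_operator H (\<lambda>u. K u - \<mu> *\<^sub>R u)"
  using symmetric_operatorD[OF K_symmetric] by (auto simp: symmetric_operator_def a_simps)

lemma eigenspace_K_subspace: "subspace (eigenspace H K \<mu>)"
  unfolding eigenspace_def subspace_def using K_linear(2)[of 0 0]
  by (auto simp: K_linear scaleR_add_right)

lemma eigenspace_K_finite_dim:
  assumes "\<mu> \<noteq> 0"
  shows "finite_dim (eigenspace H K \<mu>)"
proof -
  obtain F where F: "finite F" "F \<subseteq> H"
    "\<And>w. w \<in> H \<Longrightarrow> nrm w \<le> 2 / \<bar>\<mu>\<bar> * (nrm (K w - \<mu> *\<^sub>R w) + (\<Sum>f\<in>F. \<bar>a f w\<bar>))"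
    by (rule K_shift_estimate[OF assms]) (rule that)
  show ?thesis
  proof (rule dim_le_card_separating(1)[of "a ` F"])
    fix u assume u: "u \<in> eigenspace H K \<mu>" "\<forall>l\<in>a ` F. l u = 0"
    then have "nrm u \<le> 0" using F(3)[of u] by (simp add: eigenspace_def)
    then show "u = 0"
      using u nrm_nonneg[of u] nrm_eq_0[of u] by (auto simp: eigenspace_def)
  qed (use F eigenspace_K_subspace in \<open>auto simp: eigenspace_def a_simps subset_eq\<close>)
qed

text \<open>
  The orthogonal complement of the eigenspace is a Hilbert space that is invariant under \<open>K\<close>, and \<open>K - \<mu>\<close>
  is injective there; this is the Fredholm alternative in quantitative form.
\<close>

lemma K_gap:
  assumes \<mu>: "\<mu> \<noteq> 0"
  obtains \<gamma> where "0 < \<gamma>"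
    "\<And>u. \<lbrakk>u \<in> H; \<forall>e\<in>eigenspace H K \<mu>. a e u = 0\<rbrakk> \<Longrightarrow> \<gamma> * nrm u \<le> nrm (K u - \<mu> *\<^sub>R u)"
proof -
  let ?E = "eigenspace H K \<mu>"
  let ?Y = "{u \<in> H. \<forall>e\<in>?E. a e u = 0}"
  have E: "?E \<subseteq> H" by (auto simp: eigenspace_def)
  interpret Y: hilbert_form ?Y a by (rule orthogonal_complement_hilbert_form[OF E])
  obtain F where F: "finite F" "F \<subseteq> H"
    "\<And>w. w \<in> H \<Longrightarrow> nrm w \<le> 2 / \<bar>\<mu>\<bar> * (nrm (K w - \<mu> *\<^sub>R w) + (\<Sum>f\<in>F. \<bar>a f w\<bar>))"
    by (rule K_shift_estimate[OF \<mu>]) (rule that)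
  obtain C where C: "0 < C" "\<And>u. u \<in> H \<Longrightarrow> nrm (K u) \<le> C * nrm u"
    by (rule K_bounded) (rule that)
  have "\<exists>\<gamma>>0. \<forall>u\<in>?Y. \<gamma> * nrm u \<le> nrm (K u - \<mu> *\<^sub>R u)"
  proof (rule Y.bounded_below_of_injective[where g = a and F = F and M = nrm])
    have "a e (K u) = 0" if "e \<in> ?E" "u \<in> ?Y" for e u
      using that E symmetric_operatorD(2)[OF K_symmetric, of e u]
      by (auto simp: eigenspace_def a_scale_left)
    then show "Y.symmetric_operator ?Y (\<lambda>u. K u - \<mu> *\<^sub>R u)"
      using symmetric_operatorD[OF K_shift_symmetric] K_mem E
      unfolding Y.symmetric_operator_def by (auto simp: a_simps subset_eq)
    show "nrm (K u - \<mu> *\<^sub>R u) \<le> (C + \<bar>\<mu>\<bar>) * nrm u" if "u \<in> ?Y" for u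
      using nrm_triangle_diff[of "K u" "\<mu> *\<^sub>R u"] C(2)[of u] K_mem that
      by (auto simp: nrm_scale algebra_simps)
    show "nrm w \<le> 2 / \<bar>\<mu>\<bar> * (nrm (K w - \<mu> *\<^sub>R w) + (\<Sum>f\<in>F. \<bar>a f w\<bar>))" if "w \<in> ?Y" for w
      using F(3) that by auto
    show "u = 0" if "u \<in> ?Y" "K u - \<mu> *\<^sub>R u = 0" for u
    proof -
      have "u \<in> ?E" using that by (auto simp: eigenspace_def)
      then show ?thesis using that a_eq_0[of u] by auto
    qed
  qed (use F Cauchy_Schwarz in \<open>auto simp: a_diff_right subset_eq\<close>)
  then show ?thesis using that by auto
qed

text \<open>
  Positivity makes \<open>I + K\<close> injective. As \<open>K\<close> is compact, its spectrum does not accumulate at \<open>-1\<close>, so the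
  infimum of the Rayleigh quotient cannot be zero.
\<close>

lemma positive_imp_coercive:
  assumes pos: "\<And>u. \<lbrakk>u \<in> H; u \<noteq> 0\<rbrakk> \<Longrightarrow> 0 < a u u + b u u"
  obtains \<gamma> where "0 < \<gamma>" "\<And>u. u \<in> H \<Longrightarrow> \<gamma> * (nrm u)\<^sup>2 \<le> a u u + b u u"
proof -
  define T where "T u = K u - (- 1) *\<^sub>R u" for u
  have aT: "a (T u) u = a u u + b u u" if "u \<in> H" for u
    using that K_mem[OF that] a_K[OF that that] by (simp add: T_def a_add_left)
  obtain F where F: "finite F" "F \<subseteq> H"
    "\<And>w. w \<in> H \<Longrightarrow> nrm w \<le> 2 / \<bar>- 1\<bar> * (nrm (K w - (- 1) *\<^sub>R w) + (\<Sum>f\<in>F. \<bar>a f w\<bar>))"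
    by (rule K_shift_estimate[of "- 1"]) (simp, rule that)
  obtain C where C: "0 < C" "\<And>u. u \<in> H \<Longrightarrow> nrm (K u) \<le> C * nrm u"
    by (rule K_bounded) (rule that)
  have "\<exists>\<gamma>>0. \<forall>u\<in>H. \<gamma> * (nrm u)\<^sup>2 \<le> a (T u) u"
  proof (rule coercive_of_injective[where g = a and F = F and M = nrm])
    show "symmetric_operator H T" unfolding T_def by (rule K_shift_symmetric)
    show "nrm (T u) \<le> (C + 1) * nrm u" if "u \<in> H" for u
      using nrm_triangle[of "K u" u] C(2)[of u] K_mem that by (auto simp: T_def algebra_simps)
    show "nrm w \<le> 2 / \<bar>- 1\<bar> * (nrm (T w) + (\<Sum>f\<in>F. \<bar>a f w\<bar>))" if "w \<in> H" for w
      using F(3)[OF that] by (simp only: T_def)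
    show "0 \<le> a (T u) u" if "u \<in> H" for u
      using pos[OF that] aT[OF that] b_scale_left[of 0 0 0] that by (cases "u = 0") (auto simp: less_imp_le)
    show "u = 0" if "u \<in> H" "T u = 0" for u
      using pos[of u] aT[of u] that by (cases "u = 0") auto
  qed (use F Cauchy_Schwarz in \<open>auto simp: a_diff_right subset_eq\<close>)
  then show ?thesis using that aT by auto
qed

subsection \<open>A single trial space\<close>

definition trial_space :: "'b set \<Rightarrow> bool" where
  "trial_space W \<longleftrightarrow> subspace W \<and> finite_dim W \<and> W \<subseteq> H"

definition proj :: "'b set \<Rightarrow> 'b \<Rightarrow> 'b" where "proj W u = represent W a (a u)"

definition Kh :: "'b set \<Rightarrow> 'b \<Rightarrow> 'b" where "Kh W u = represent W a (b u)"

text \<open>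
  The operator norm of \<open>K (I - \<Pi>)\<close>, written as a bound for the form \<open>b\<close>; every comparison between
  \<open>K\<close> and its Galerkin discretisation goes through this one quantity.
\<close>

definition residual_le :: "'b set \<Rightarrow> real \<Rightarrow> bool" where
  "residual_le W \<eta> \<longleftrightarrow> (\<forall>u\<in>H. \<forall>v\<in>H. \<bar>b (u - proj W u) v\<bar> \<le> \<eta> * nrm u * nrm v)"

context
  fixes W assumes trial: "trial_space W"
begin

lemma W_sub: "subspace W" "finite_dim W" "W \<subseteq> H"
  using trial by (auto simp: trial_space_def)

lemma proj_mem: "u \<in> H \<Longrightarrow> proj W u \<in> W"
  unfolding proj_def using W_sub by (intro represent_finite_dim(1)) (auto simp: a_simps subset_eq)

lemma proj_mem_H: "u \<in> H \<Longrightarrow> proj W u \<in> H"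
  using proj_mem W_sub(3) by blast

lemma a_proj_left: "u \<in> H \<Longrightarrow> v \<in> W \<Longrightarrow> a (proj W u) v = a u v"
  unfolding proj_def using W_sub by (intro represent_finite_dim(2)) (auto simp: a_simps subset_eq)

lemma a_proj_right: "u \<in> H \<Longrightarrow> v \<in> W \<Longrightarrow> a v (proj W u) = a v u"
  using a_proj_left[of u v] a_sym[of v] proj_mem_H W_sub(3) by auto

lemma a_proj_commute: "u \<in> H \<Longrightarrow> v \<in> H \<Longrightarrow> a (proj W u) v = a u (proj W v)"
  using a_proj_left[of u "proj W v"] a_proj_right[of v "proj W u"] proj_mem by simp

lemma proj_symmetric: "symmetric_operator H (proj W)"
  using a_proj_commute proj_mem_H by (auto simp: symmetric_operator_def)

lemmas proj_linear = symmetric_operator_linear[OF proj_symmetric]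

lemma proj_Pythagoras:
  assumes u: "u \<in> H" and v: "v \<in> W"
  shows "(nrm (u - v))\<^sup>2 = (nrm (u - proj W u))\<^sup>2 + (nrm (proj W u - v))\<^sup>2"
proof -
  have vH: "v \<in> H" and pH: "proj W u \<in> H" using v proj_mem_H u W_sub(3) by auto
  have "a (proj W u) (proj W u) = a u (proj W u)"
    using a_proj_left[OF u proj_mem[OF u]] .
  then show ?thesis
    using u vH pH a_proj_left[OF u v] a_sym[of "proj W u" u] a_sym[of v u] a_sym[of v "proj W u"]
    by (simp add: nrm_square a_simps)
qed

lemma nrm_proj_le: "u \<in> H \<Longrightarrow> nrm (proj W u) \<le> nrm u"
  using proj_Pythagoras[of u 0] subspace_0[OF W_sub(1)] nrm_nonneg[of u]
  by (intro power2_le_imp_le[of "nrm (proj W u)" "nrm u"]) auto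

lemma nrm_proj_best: "u \<in> H \<Longrightarrow> v \<in> W \<Longrightarrow> nrm (u - proj W u) \<le> nrm (u - v)"
  using proj_Pythagoras[of u v] nrm_nonneg[of "u - v"] W_sub(3)
  by (intro power2_le_imp_le[of "nrm (u - proj W u)" "nrm (u - v)"]) auto

lemma nrm_residual_le: "u \<in> H \<Longrightarrow> nrm (u - proj W u) \<le> nrm u"
  using nrm_proj_best[of u 0] subspace_0[OF W_sub(1)] by simp

lemma Kh_mem: "u \<in> H \<Longrightarrow> Kh W u \<in> W"
  unfolding Kh_def using W_sub by (intro represent_finite_dim(1)) (auto simp: b_simps subset_eq)

lemma a_Kh: "u \<in> H \<Longrightarrow> v \<in> W \<Longrightarrow> a (Kh W u) v = b u v"
  unfolding Kh_def using W_sub by (intro represent_finite_dim(2)) (auto simp: b_simps subset_eq)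

lemma a_Kh_proj: "u \<in> H \<Longrightarrow> v \<in> H \<Longrightarrow> a (Kh W u) v = b u (proj W v)"
  using a_Kh[of u "proj W v"] a_proj_right[of v "Kh W u"] Kh_mem proj_mem by simp

lemma Kh_symmetric: "symmetric_operator W (Kh W)"
proof -
  have "a (Kh W u) v = a u (Kh W v)" if "u \<in> W" "v \<in> W" for u v
  proof -
    have "u \<in> H" "v \<in> H" "Kh W v \<in> H" using that W_sub(3) Kh_mem by auto
    then show ?thesis using that a_Kh[of u v] a_Kh[of v u] a_sym[of u "Kh W v"] b_sym[of u v] by simp
  qed
  then show ?thesis using Kh_mem W_sub(3) by (auto simp: symmetric_operator_def)
qed

lemma Kh_eigenbasis_exists: "\<exists>B \<theta>. eigenbasis W (Kh W) B \<theta>"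
  using spectral_theorem[OF W_sub Kh_symmetric] .

text \<open>
  Since the projection is symmetric, a functional \<open>a f\<close> applied to the residual of \<open>u\<close> equals \<open>a\<close> applied to
  the residual of \<open>f\<close> and to \<open>u\<close>: what matters is how well the finitely many \<open>f\<close> are approximated.
\<close>

lemma residual_bound:
  assumes F: "finite F" "F \<subseteq> H" and \<epsilon>: "0 \<le> \<epsilon>"
    and bF: "\<And>w v. \<lbrakk>w \<in> H; v \<in> H\<rbrakk> \<Longrightarrow> \<bar>b w v\<bar> \<le> (\<epsilon> * nrm w + (\<Sum>f\<in>F. \<bar>a f w\<bar>)) * nrm v"
  shows "residual_le W (\<epsilon> + (\<Sum>f\<in>F. nrm (f - proj W f)))"
  unfolding residual_le_def
proof (intro ballI)
  fix u v assume u: "u \<in> H" and v: "v \<in> H"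
  let ?w = "u - proj W u"
  have w: "?w \<in> H" using u proj_mem_H by auto
  have "\<bar>a f ?w\<bar> \<le> nrm (f - proj W f) * nrm u" if "f \<in> F" for f
  proof -
    have f: "f \<in> H" using that F(2) by blast
    have "a f ?w = a (f - proj W f) u"
      using f u proj_mem_H a_proj_commute[OF f u] by (simp add: a_simps)
    then show ?thesis using Cauchy_Schwarz[of "f - proj W f" u] f u proj_mem_H by simp
  qed
  then have "(\<Sum>f\<in>F. \<bar>a f ?w\<bar>) \<le> (\<Sum>f\<in>F. nrm (f - proj W f)) * nrm u"
    unfolding sum_distrib_right by (rule sum_mono)
  moreover have "\<epsilon> * nrm ?w \<le> \<epsilon> * nrm u"
    using nrm_residual_le[OF u] \<epsilon> by (rule mult_left_mono)
  ultimately have "\<epsilon> * nrm ?w + (\<Sum>f\<in>F. \<bar>a f ?w\<bar>) \<le> (\<epsilon> + (\<Sum>f\<in>F. nrm (f - proj W f))) * nrm u"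
    by (simp add: distrib_right)
  from mult_right_mono[OF this nrm_nonneg[OF v]]
  show "\<bar>b ?w v\<bar> \<le> (\<epsilon> + (\<Sum>f\<in>F. nrm (f - proj W f))) * nrm u * nrm v"
    using bF[OF w v] by linarith
qed

context
  fixes \<eta> assumes residual: "residual_le W \<eta>" and \<eta>: "0 \<le> \<eta>"
begin

lemma residualD:
  "u \<in> H \<Longrightarrow> v \<in> H \<Longrightarrow> \<bar>b (u - proj W u) v\<bar> \<le> \<eta> * nrm u * nrm v"
  using residual by (auto simp: residual_le_def)

lemma residualD_right:
  "u \<in> H \<Longrightarrow> v \<in> H \<Longrightarrow> \<bar>b u (v - proj W v)\<bar> \<le> \<eta> * nrm u * nrm v"
  using residualD[of v u] b_sym[of u "v - proj W v"] proj_mem_H by (simp add: mult_ac)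

lemma nrm_proj_K_proj_le:
  assumes u: "u \<in> H"
  shows "nrm (proj W (K (proj W u)) - K u) \<le> 2 * \<eta> * nrm u"
proof (rule operator_nrm_le)
  have pu: "proj W u \<in> H" "K (proj W u) \<in> H" using u proj_mem_H K_mem by auto
  show "proj W (K (proj W u)) - K u \<in> H" using u K_mem proj_mem_H by auto
  show "0 \<le> 2 * \<eta> * nrm u" using \<eta> nrm_nonneg[OF u] by simp
  fix v assume v: "v \<in> H"
  have pv: "proj W v \<in> H" using v proj_mem_H by auto
  have "a (proj W (K (proj W u)) - K u) v = b (proj W u) (proj W v) - b u v"
    using u v pu pv proj_mem_H[of "K (proj W u)"] a_proj_commute[of "K (proj W u)" v]
    by (simp add: a_diff_left a_K K_mem)
  also have "\<dots> = - b (u - proj W u) (proj W v) - b u (v - proj W v)"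
    using u v pu pv by (simp add: b_simps)
  finally have "\<bar>a (proj W (K (proj W u)) - K u) v\<bar>
      \<le> \<bar>b (u - proj W u) (proj W v)\<bar> + \<bar>b u (v - proj W v)\<bar>"
    by linarith
  moreover have "\<eta> * nrm u * nrm (proj W v) \<le> \<eta> * nrm u * nrm v"
    using nrm_proj_le[OF v] \<eta> nrm_nonneg[OF u] by (intro mult_left_mono) auto
  ultimately show "\<bar>a (proj W (K (proj W u)) - K u) v\<bar> \<le> 2 * \<eta> * nrm u * nrm v"
    using residualD[OF u pv] residualD_right[OF u v] by linarith
qed

lemma nrm_Kh_diff_le:
  assumes u: "u \<in> W"
  shows "nrm (Kh W u - K u) \<le> \<eta> * nrm u"
proof (rule operator_nrm_le)
  have uH: "u \<in> H" using u W_sub(3) by blast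
  then have KH: "Kh W u \<in> H" using Kh_mem W_sub(3) by blast
  then show "Kh W u - K u \<in> H" using uH K_mem by auto
  show "0 \<le> \<eta> * nrm u" using \<eta> nrm_nonneg[OF uH] by simp
  fix v assume v: "v \<in> H"
  have "a (Kh W u - K u) v = - b u (v - proj W v)"
    using uH KH v a_Kh_proj[OF uH v] proj_mem_H[OF v] by (simp add: a_diff_left a_K K_mem b_diff_right)
  then show "\<bar>a (Kh W u - K u) v\<bar> \<le> \<eta> * nrm u * nrm v"
    using residualD_right[OF uH v] by simp
qed

text \<open>
  For \<open>u = K u / \<mu>\<close> the residual tested with \<open>v\<close> is \<open>b u (v - \<Pi> v) / \<mu>\<close>, so eigenvectors are approximated at a
  rate that is uniform on the eigenspace.
\<close>

lemma nrm_eigenvector_residual_le: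
  assumes \<mu>: "\<mu> \<noteq> 0" and u: "u \<in> eigenspace H K \<mu>"
  shows "nrm (u - proj W u) \<le> \<eta> / \<bar>\<mu>\<bar> * nrm u"
proof (rule operator_nrm_le)
  have uH: "u \<in> H" and Ku: "K u = \<mu> *\<^sub>R u" using u by (auto simp: eigenspace_def)
  show "u - proj W u \<in> H" using uH proj_mem_H by auto
  show "0 \<le> \<eta> / \<bar>\<mu>\<bar> * nrm u" using \<eta> nrm_nonneg[OF uH] by simp
  fix v assume v: "v \<in> H"
  have r: "v - proj W v \<in> H" using v proj_mem_H by auto
  have "b u (v - proj W v) = a (\<mu> *\<^sub>R u) (v - proj W v)"
    using a_K[OF uH r] Ku by simp
  also have "\<dots> = \<mu> * a u (v - proj W v)"
    using uH r by (rule a_scale_left)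
  also have "a u (v - proj W v) = a (u - proj W u) v"
    using uH v proj_mem_H a_proj_commute[OF uH v] by (simp add: a_simps)
  finally have "\<bar>\<mu>\<bar> * \<bar>a (u - proj W u) v\<bar> \<le> \<eta> * nrm u * nrm v"
    using residualD_right[OF uH v] by (simp add: abs_mult)
  then show "\<bar>a (u - proj W u) v\<bar> \<le> \<eta> / \<bar>\<mu>\<bar> * nrm u * nrm v"
    using \<mu> by (simp add: field_simps)
qed

end

lemma eigenbasis_Kh_span:
  assumes B: "eigenbasis W (Kh W) B \<theta>" and B': "B' \<subseteq> B"
    and w: "w \<in> span B'"
  shows "w \<in> W" "(nrm w)\<^sup>2 = (\<Sum>e\<in>B'. (a e w)\<^sup>2)"
    "(nrm (Kh W w - c *\<^sub>R w))\<^sup>2 = (\<Sum>e\<in>B'. (\<theta> e - c)\<^sup>2 * (a e w)\<^sup>2)"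
proof -
  interpret W: inner_form W a by (rule subspace_inner_form[OF W_sub(1,3)])
  have orth: "orthonormal B" "span B = W" "\<And>e. e \<in> B \<Longrightarrow> Kh W e = \<theta> e *\<^sub>R e"
    using B by (auto simp: eigenbasis_def)
  have orth': "orthonormal B'" using orthonormal_subset[OF orth(1) B'] .
  have B'W: "B' \<subseteq> W" using B' orth(2) span_superset by blast
  have exp: "w = (\<Sum>e\<in>B'. a e w *\<^sub>R e)" by (rule orthonormal_expansion[OF orth' w])
  show wW: "w \<in> W" using w span_mono[OF B'] orth(2) by blast
  show "(nrm w)\<^sup>2 = (\<Sum>e\<in>B'. (a e w)\<^sup>2)"
    using orthonormal_nrm_square[OF orth', of "\<lambda>e. a e w"] exp by simp
  have sym: "W.symmetric_operator W (Kh W)"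
    using Kh_symmetric by (simp add: symmetric_operator_def W.symmetric_operator_def)
  note lin = W.symmetric_operator_linear[OF sym]
  have lin_sum: "Kh W (sum g I) = (\<Sum>i\<in>I. Kh W (g i))" if "\<And>i. i \<in> I \<Longrightarrow> g i \<in> W" for g and I :: "'b set"
    using that lin(2)[of 0 0] by (induction I rule: infinite_finite_induct) (auto simp: lin W.H_sum)
  have "Kh W w = (\<Sum>e\<in>B'. Kh W (a e w *\<^sub>R e))"
    using B'W by (subst exp, subst lin_sum) auto
  also have "\<dots> = (\<Sum>e\<in>B'. (\<theta> e * a e w) *\<^sub>R e)"
    using B' B'W orth(3) by (intro sum.cong) (auto simp: lin subset_eq mult.commute)
  finally have "Kh W w - c *\<^sub>R w = (\<Sum>e\<in>B'. (\<theta> e * a e w) *\<^sub>R e) - c *\<^sub>R (\<Sum>e\<in>B'. a e w *\<^sub>R e)"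
    using exp by simp
  also have "\<dots> = (\<Sum>e\<in>B'. ((\<theta> e - c) * a e w) *\<^sub>R e)"
    by (simp add: scaleR_sum_right sum_subtractf[symmetric] scaleR_diff_left[symmetric] left_diff_distrib)
  finally show "(nrm (Kh W w - c *\<^sub>R w))\<^sup>2 = (\<Sum>e\<in>B'. (\<theta> e - c)\<^sup>2 * (a e w)\<^sup>2)"
    using orthonormal_nrm_square[OF orth'] by (simp add: power_mult_distrib)
qed

lemma nrm_Kh_shift_ge:
  assumes B: "eigenbasis W (Kh W) B \<theta>" "B' \<subseteq> B" "w \<in> span B'"
    and far: "\<And>e. e \<in> B' \<Longrightarrow> \<delta> \<le> \<bar>\<theta> e - c\<bar>" and \<delta>: "0 \<le> \<delta>"
  shows "\<delta> * nrm w \<le> nrm (Kh W w - c *\<^sub>R w)"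
proof (rule power2_le_imp_le)
  note * = eigenbasis_Kh_span[OF B]
  have wH: "w \<in> H" "Kh W w \<in> H" using *(1) W_sub(3) Kh_mem by auto
  have "\<delta>\<^sup>2 \<le> (\<theta> e - c)\<^sup>2" if "e \<in> B'" for e
    using power_mono[OF far[OF that] \<delta>, of 2] by simp
  then have "(\<Sum>e\<in>B'. \<delta>\<^sup>2 * (a e w)\<^sup>2) \<le> (\<Sum>e\<in>B'. (\<theta> e - c)\<^sup>2 * (a e w)\<^sup>2)"
    by (intro sum_mono mult_right_mono) auto
  then show "(\<delta> * nrm w)\<^sup>2 \<le> (nrm (Kh W w - c *\<^sub>R w))\<^sup>2"
    using *(2) *(3)[of c] by (simp add: power_mult_distrib sum_distrib_left)
  show "0 \<le> nrm (Kh W w - c *\<^sub>R w)" using wH by (intro nrm_nonneg) auto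
qed

lemma nrm_Kh_shift_le:
  assumes B: "eigenbasis W (Kh W) B \<theta>" "B' \<subseteq> B" "w \<in> span B'"
    and near: "\<And>e. e \<in> B' \<Longrightarrow> \<bar>\<theta> e - c\<bar> \<le> \<delta>" and \<delta>: "0 \<le> \<delta>"
  shows "nrm (Kh W w - c *\<^sub>R w) \<le> \<delta> * nrm w"
proof (rule power2_le_imp_le)
  note * = eigenbasis_Kh_span[OF B]
  have wH: "w \<in> H" using *(1) W_sub(3) by auto
  have "(\<theta> e - c)\<^sup>2 \<le> \<delta>\<^sup>2" if "e \<in> B'" for e
    using power_mono[OF near[OF that], of 2] by simp
  then have "(\<Sum>e\<in>B'. (\<theta> e - c)\<^sup>2 * (a e w)\<^sup>2) \<le> (\<Sum>e\<in>B'. \<delta>\<^sup>2 * (a e w)\<^sup>2)"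
    by (intro sum_mono mult_right_mono) auto
  then show "(nrm (Kh W w - c *\<^sub>R w))\<^sup>2 \<le> (\<delta> * nrm w)\<^sup>2"
    using *(2) *(3)[of c] by (simp add: power_mult_distrib sum_distrib_left)
  show "0 \<le> \<delta> * nrm w" using wH \<delta> nrm_nonneg by auto
qed

lemma card_eigenbasis_le:
  assumes B: "eigenbasis W (Kh W) B \<theta>" "B' \<subseteq> B" and F: "finite F" "F \<subseteq> H"
    and sep: "\<And>w. \<lbrakk>w \<in> span B'; \<forall>f\<in>F. a f w = 0\<rbrakk> \<Longrightarrow> w = 0"
  shows "card B' \<le> card F"
proof -
  have orth': "orthonormal B'" using B orthonormal_subset by (auto simp: eigenbasis_def)
  have sub: "span B' \<subseteq> H" using span_subset_H orthonormalD(2)[OF orth'] .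
  have "card B' = dim (span B')" using dim_span_orthonormal[OF orth'] by simp
  also have "\<dots> \<le> card (a ` F)"
    using F sub sep by (intro dim_le_card_separating(2)) (auto simp: a_simps subset_eq)
  also have "\<dots> \<le> card F" by (rule card_image_le[OF F(1)])
  finally show ?thesis .
qed

text \<open>
  A combination of eigenvectors of \<open>Kh W\<close> with eigenvalues within \<open>\<delta>\<close> of \<open>\<mu>\<close> is moved by \<open>K - \<mu>\<close> by at most
  \<open>\<delta> + \<eta>\<close> times its norm. If it is orthogonal to the eigenspace of \<open>K\<close>, this contradicts the gap \<open>\<gamma>\<close>.
\<close>

lemma card_eigenvalues_near_le:
  assumes \<mu>: "\<mu> \<noteq> 0"
    and gap: "\<And>u. \<lbrakk>u \<in> H; \<forall>e\<in>eigenspace H K \<mu>. a e u = 0\<rbrakk> \<Longrightarrow> \<gamma> * nrm u \<le> nrm (K u - \<mu> *\<^sub>R u)"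
    and res: "residual_le W \<eta>" "0 \<le> \<eta>" and \<delta>: "0 \<le> \<delta>" "\<delta> + \<eta> < \<gamma>"
    and B: "eigenbasis W (Kh W) B \<theta>"
  shows "card {e \<in> B. \<bar>\<theta> e - \<mu>\<bar> < \<delta>} \<le> dim (eigenspace H K \<mu>)"
proof -
  have E: "eigenspace H K \<mu> \<subseteq> H" by (auto simp: eigenspace_def)
  obtain F where F: "orthonormal F" "span F = eigenspace H K \<mu>"
    using orthonormal_basis_exists[OF eigenspace_K_subspace eigenspace_K_finite_dim[OF \<mu>] E] .
  note FD = orthonormalD[OF F(1)]
  have "card {e \<in> B. \<bar>\<theta> e - \<mu>\<bar> < \<delta>} \<le> card F"
  proof (rule card_eigenbasis_le[OF B _ FD(1,2)])
    fix w assume w: "w \<in> span {e \<in> B. \<bar>\<theta> e - \<mu>\<bar> < \<delta>}" and perp: "\<forall>f\<in>F. a f w = 0"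
    have wW: "w \<in> W" using eigenbasis_Kh_span(1)[OF B _ w] by auto
    then have wH: "w \<in> H" "Kh W w \<in> H" "K w \<in> H" using W_sub(3) Kh_mem K_mem by auto
    have "a e w = 0" if "e \<in> eigenspace H K \<mu>" for e
    proof -
      have "e = (\<Sum>f\<in>F. a f e *\<^sub>R f)" using orthonormal_expansion[OF F(1)] F(2) that by auto
      then have "a e w = a (\<Sum>f\<in>F. a f e *\<^sub>R f) w" by simp
      also have "\<dots> = (\<Sum>f\<in>F. a f e * a f w)"
        using FD(2) wH(1) by (subst a_sum_left) (auto simp: a_scale_left subset_eq)
      finally show ?thesis using perp by simp
    qed
    then have "\<gamma> * nrm w \<le> nrm (K w - \<mu> *\<^sub>R w)" using gap wH by auto
    also have "\<dots> \<le> nrm (Kh W w - K w) + nrm (Kh W w - \<mu> *\<^sub>R w)"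
      using nrm_triangle_diff[of "Kh W w - \<mu> *\<^sub>R w" "Kh W w - K w"] wH by simp
    also have "nrm (Kh W w - \<mu> *\<^sub>R w) \<le> \<delta> * nrm w"
      using w by (intro nrm_Kh_shift_le[OF B _ _ _ \<delta>(1)]) auto
    finally have "\<gamma> * nrm w \<le> (\<delta> + \<eta>) * nrm w"
      using nrm_Kh_diff_le[OF res wW] by (simp add: distrib_right)
    then have "nrm w \<le> 0" using \<delta>(2) by (simp add: mult_le_cancel_right)
    then show "w = 0" using wH(1) nrm_nonneg[of w] nrm_eq_0[of w] by simp
  qed auto
  then show ?thesis using dim_span_orthonormal[OF F(1)] F(2) by simp
qed

text \<open>
  If fewer eigenvectors of \<open>Kh W\<close> than the multiplicity of \<open>\<mu>\<close> had eigenvalues near \<open>\<mu>\<close>, then the projection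
  of some eigenvector of \<open>K\<close> would be orthogonal to all of them, and \<open>Kh W - \<mu>\<close> would move it by at least
  \<open>\<delta>\<close> times its norm; but it is an approximate eigenvector. The condition relating \<open>\<eta>\<close> and \<open>\<delta>\<close>
  collects the errors: \<open>\<eta>\<close> for replacing \<open>Kh W\<close> by \<open>K\<close>, the rest for replacing \<open>u\<close> by its projection.
\<close>

lemma card_eigenvalues_near_ge:
  assumes \<mu>: "\<mu> \<noteq> 0"
    and C: "\<And>u. u \<in> H \<Longrightarrow> nrm (K u) \<le> C * nrm u" "0 < C"
    and res: "residual_le W \<eta>" "0 \<le> \<eta>"
    and \<delta>: "0 < \<delta>" "\<eta> * (1 + (C + \<bar>\<mu>\<bar>) / \<bar>\<mu>\<bar>) < \<delta> * (1 - \<eta> / \<bar>\<mu>\<bar>)"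
    and B: "eigenbasis W (Kh W) B \<theta>"
  shows "dim (eigenspace H K \<mu>) \<le> card {e \<in> B. \<bar>\<theta> e - \<mu>\<bar> < \<delta>}"
proof -
  let ?E = "eigenspace H K \<mu>" and ?B' = "{e \<in> B. \<bar>\<theta> e - \<mu>\<bar> < \<delta>}"
  have E: "?E \<subseteq> H" by (auto simp: eigenspace_def)
  have orth: "orthonormal B" "span B = W" using B by (auto simp: eigenbasis_def)
  note BD = orthonormalD[OF orth(1)]
  have "dim ?E \<le> card ((\<lambda>e u. a e (proj W u)) ` ?B')"
  proof (rule dim_le_card_separating(2))
    fix u assume u: "u \<in> ?E" and perp: "\<forall>l\<in>(\<lambda>e u. a e (proj W u)) ` ?B'. l u = 0"
    have uH: "u \<in> H" and Ku: "K u = \<mu> *\<^sub>R u" using u by (auto simp: eigenspace_def)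
    let ?w = "proj W u"
    have w: "?w \<in> W" "?w \<in> H" using proj_mem proj_mem_H uH by auto
    then have KH: "Kh W ?w \<in> H" "K ?w \<in> H" using Kh_mem K_mem W_sub(3) by auto
    have "?w = (\<Sum>e\<in>B. a e ?w *\<^sub>R e)"
      using orthonormal_expansion[OF orth(1)] w orth(2) by auto
    also have "\<dots> = (\<Sum>e\<in>B - ?B'. a e ?w *\<^sub>R e)"
      using perp BD(1) by (intro sum.mono_neutral_right) auto
    finally have "?w \<in> span (B - ?B')"
      by (metis (no_types, lifting) span_base span_scale span_sum)
    then have "\<delta> * nrm ?w \<le> nrm (Kh W ?w - \<mu> *\<^sub>R ?w)"
      using \<delta>(1) by (intro nrm_Kh_shift_ge[OF B]) auto
    also have "\<dots> \<le> nrm (Kh W ?w - K ?w) + nrm ((K ?w - K u) + \<mu> *\<^sub>R (u - ?w))"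
      using nrm_triangle[of "Kh W ?w - K ?w" "(K ?w - K u) + \<mu> *\<^sub>R (u - ?w)"] w KH uH Ku
      by (simp add: algebra_simps)
    also have "nrm ((K ?w - K u) + \<mu> *\<^sub>R (u - ?w)) \<le> nrm (K (?w - u)) + \<bar>\<mu>\<bar> * nrm (u - ?w)"
      using nrm_triangle[of "K ?w - K u" "\<mu> *\<^sub>R (u - ?w)"] w KH uH K_mem
      by (simp add: K_linear nrm_scale)
    also have "nrm (K (?w - u)) \<le> C * nrm (u - ?w)"
      using C(1)[of "?w - u"] w uH nrm_minus_commute[of u ?w] by simp
    finally have "\<delta> * nrm ?w \<le> nrm (Kh W ?w - K ?w) + (C + \<bar>\<mu>\<bar>) * nrm (u - ?w)"
      by (simp add: distrib_right)
    also have "(C + \<bar>\<mu>\<bar>) * nrm (u - ?w) \<le> (C + \<bar>\<mu>\<bar>) * (\<eta> / \<bar>\<mu>\<bar> * nrm u)"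
      using nrm_eigenvector_residual_le[OF res \<mu> u] C(2) by (intro mult_left_mono) auto
    also have "nrm (Kh W ?w - K ?w) \<le> \<eta> * nrm u"
      using nrm_Kh_diff_le[OF res w(1)] mult_left_mono[OF nrm_proj_le[OF uH] res(2)] by linarith
    finally have 1: "\<delta> * nrm ?w \<le> \<eta> * (1 + (C + \<bar>\<mu>\<bar>) / \<bar>\<mu>\<bar>) * nrm u"
      by (simp add: algebra_simps)
    have "nrm u \<le> \<eta> / \<bar>\<mu>\<bar> * nrm u + nrm ?w"
      using nrm_le_diff[OF uH w(2)] nrm_eigenvector_residual_le[OF res \<mu> u] by linarith
    from mult_left_mono[OF this, of \<delta>] have "\<delta> * (1 - \<eta> / \<bar>\<mu>\<bar>) * nrm u \<le> \<delta> * nrm ?w"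
      using \<delta>(1) by (simp add: algebra_simps)
    with 1 have "\<delta> * (1 - \<eta> / \<bar>\<mu>\<bar>) * nrm u \<le> \<eta> * (1 + (C + \<bar>\<mu>\<bar>) / \<bar>\<mu>\<bar>) * nrm u"
      by linarith
    then have "nrm u \<le> 0" using \<delta>(2) by (meson mult_right_less_imp_less not_le nrm_nonneg uH mult_strict_right_mono)
    then show "u = 0" using uH nrm_nonneg[of u] nrm_eq_0[of u] by simp
  next
    show "finite ((\<lambda>e u. a e (proj W u)) ` ?B')" using BD(1) by simp
    show "subspace ?E" by (rule eigenspace_K_subspace)
  next
    fix l u v c assume l: "l \<in> (\<lambda>e u. a e (proj W u)) ` ?B'" and u: "u \<in> ?E"
    then obtain e where e: "e \<in> H" "l = (\<lambda>u. a e (proj W u))" using BD(2) by auto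
    then show "l (c *\<^sub>R u) = c * l u"
      using u E proj_mem_H by (auto simp: proj_linear a_scale_right)
    assume "v \<in> ?E"
    with u E have "u \<in> H" "v \<in> H" by auto
    then show "l (u + v) = l u + l v"
      using e proj_mem_H by (simp add: proj_linear a_add_right)
  qed
  also have "\<dots> \<le> card ?B'" using BD(1) by (intro card_image_le) auto
  finally show ?thesis .
qed

end

text \<open>
  Off finitely many functionals, whose number depends on \<open>\<epsilon>\<close> only, \<open>Kh W\<close> has norm at most
  \<open>\<epsilon> / 2\<close>. These functionals are the same for all trial spaces, which makes the bound uniform.
\<close>

lemma clustering:
  assumes \<epsilon>: "0 < \<epsilon>"
  shows "\<exists>M::nat. \<forall>W S. trial_space W \<longrightarrow> (\<forall>u\<in>W. S u = u + Kh W u) \<longrightarrow>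
    (let E = eigenvalues W S - {1 - \<epsilon><..<1 + \<epsilon>}
     in finite E \<and> (\<Sum>\<nu>\<in>E. multiplicity_of W S \<nu>) \<le> M)"
proof -
  obtain F where F: "finite F" "F \<subseteq> H"
    "\<And>w v. \<lbrakk>w \<in> H; v \<in> H\<rbrakk> \<Longrightarrow> \<bar>b w v\<bar> \<le> (\<epsilon> / 2 * nrm w + (\<Sum>f\<in>F. \<bar>a f w\<bar>)) * nrm v"
    by (rule K_compact[of "\<epsilon> / 2"]) (use \<epsilon> in simp, rule that)
  have "finite (eigenvalues W S - {1 - \<epsilon><..<1 + \<epsilon>}) \<and>
      (\<Sum>\<nu>\<in>eigenvalues W S - {1 - \<epsilon><..<1 + \<epsilon>}. multiplicity_of W S \<nu>) \<le> card F"
    if W: "trial_space W" and S: "\<forall>u\<in>W. S u = u + Kh W u" for W S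
  proof -
    note Ws = W_sub[OF W]
    obtain B \<theta> where B: "eigenbasis W (Kh W) B \<theta>" using Kh_eigenbasis_exists[OF W] by blast
    have BW: "B \<subseteq> W" using B span_superset by (auto simp: eigenbasis_def)
    have BS: "eigenbasis W S B (\<lambda>e. 1 + \<theta> e)"
      using B BW S by (auto simp: eigenbasis_def scaleR_add_left subset_eq)
    have sym: "symmetric_operator W S"
      using symmetric_operatorD[OF Kh_symmetric[OF W]] S Ws
      by (auto simp: symmetric_operator_def a_simps subset_eq subspace_add)
    let ?E = "eigenvalues W S - {1 - \<epsilon><..<1 + \<epsilon>}" and ?B' = "{e \<in> B. \<epsilon> \<le> \<bar>\<theta> e - 0\<bar>}"
    have fB: "finite B" by (rule eigenbasis_finite[OF B])
    have E: "?E = (\<lambda>e. 1 + \<theta> e) ` ?B'"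
      unfolding eigenvalues_eigenbasis[OF BS Ws(3,1) sym] by auto
    have "(\<Sum>\<nu>\<in>?E. multiplicity_of W S \<nu>) = (\<Sum>\<nu>\<in>?E. card {e \<in> ?B'. 1 + \<theta> e = \<nu>})"
    proof (rule sum.cong)
      fix \<nu> assume "\<nu> \<in> ?E"
      then have "{e \<in> B. 1 + \<theta> e = \<nu>} = {e \<in> ?B'. 1 + \<theta> e = \<nu>}" by auto
      then show "multiplicity_of W S \<nu> = card {e \<in> ?B'. 1 + \<theta> e = \<nu>}"
        using multiplicity_eigenbasis[OF BS Ws(3,1) sym] by simp
    qed simp
    also have "\<dots> = card ?B'"
      using fB unfolding E card_eq_sum by (intro sum.image_gen[symmetric]) auto
    also have "\<dots> \<le> card F"
    proof (rule card_eigenbasis_le[OF W B _ F(1,2)])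
      fix w assume w: "w \<in> span ?B'" and perp: "\<forall>f\<in>F. a f w = 0"
      have wW: "w \<in> W" using eigenbasis_Kh_span(1)[OF W B _ w] by auto
      then have wH: "w \<in> H" "Kh W w \<in> H" using Ws(3) Kh_mem[OF W] by auto
      have "\<epsilon> * nrm w \<le> nrm (Kh W w - 0 *\<^sub>R w)"
        using w \<epsilon> by (intro nrm_Kh_shift_ge[OF W B]) auto
      also have "\<dots> \<le> \<epsilon> / 2 * nrm w"
      proof (rule operator_nrm_le)
        show "0 \<le> \<epsilon> / 2 * nrm w" using \<epsilon> nrm_nonneg[OF wH(1)] by simp
        fix v assume v: "v \<in> H"
        have "\<bar>a (Kh W w) v\<bar> = \<bar>b w (proj W v)\<bar>" using a_Kh_proj[OF W wH(1) v] by simp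
        also have "\<dots> \<le> \<epsilon> / 2 * nrm w * nrm (proj W v)"
          using F(3)[OF wH(1) proj_mem_H[OF W v]] perp by simp
        also have "\<dots> \<le> \<epsilon> / 2 * nrm w * nrm v"
          using nrm_proj_le[OF W v] \<epsilon> nrm_nonneg[OF wH(1)] by (intro mult_left_mono) auto
        finally show "\<bar>a (Kh W w - 0 *\<^sub>R w) v\<bar> \<le> \<epsilon> / 2 * nrm w * nrm v" by simp
      qed (use wH in auto)
      finally have "nrm w \<le> 0" using \<epsilon> by simp
      then show "w = 0" using wH(1) nrm_nonneg[of w] nrm_eq_0[of w] by simp
    qed auto
    finally show ?thesis using E fB by simp
  qed
  then show ?thesis unfolding Let_def by blast
qed

end

subsection \<open>Convergence along a family of trial spaces\<close>

locale galerkin = compact_form H a b for H :: "'b::real_vector set" and a b +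
  fixes X :: "'i \<Rightarrow> 'b set" and G :: "'i filter"
  assumes trial_spaces: "\<forall>\<^sub>F h in G. trial_space (X h)"
    and trial_dense: "u \<in> H \<Longrightarrow> ((\<lambda>h. INF v\<in>X h. nrm (u - v)) \<longlongrightarrow> 0) G"
begin

lemma proj_tendsto:
  assumes u: "u \<in> H"
  shows "((\<lambda>h. nrm (u - proj (X h) u)) \<longlongrightarrow> 0) G"
proof (rule tendsto_sandwich[OF _ _ tendsto_const trial_dense[OF u]])
  show "\<forall>\<^sub>F h in G. 0 \<le> nrm (u - proj (X h) u)"
    using trial_spaces by eventually_elim (use u in \<open>auto intro: nrm_nonneg proj_mem_H\<close>)
  show "\<forall>\<^sub>F h in G. nrm (u - proj (X h) u) \<le> (INF v\<in>X h. nrm (u - v))"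
    using trial_spaces
  proof eventually_elim
    case (elim h)
    show ?case
      using nrm_proj_best[OF elim u] subspace_0[OF W_sub(1)[OF elim]] by (intro cINF_greatest) auto
  qed
qed

lemma residual_small:
  assumes \<eta>: "0 < \<eta>"
  shows "\<forall>\<^sub>F h in G. residual_le (X h) \<eta>"
proof -
  obtain F where F: "finite F" "F \<subseteq> H"
    "\<And>w v. \<lbrakk>w \<in> H; v \<in> H\<rbrakk> \<Longrightarrow> \<bar>b w v\<bar> \<le> (\<eta> / 2 * nrm w + (\<Sum>f\<in>F. \<bar>a f w\<bar>)) * nrm v"
    by (rule K_compact[of "\<eta> / 2"]) (use \<eta> in simp, rule that)
  have "((\<lambda>h. \<Sum>f\<in>F. nrm (f - proj (X h) f)) \<longlongrightarrow> (\<Sum>f\<in>F. 0)) G"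
    using F(2) by (intro tendsto_sum proj_tendsto) auto
  then have "\<forall>\<^sub>F h in G. (\<Sum>f\<in>F. nrm (f - proj (X h) f)) < \<eta> / 2"
    using \<eta> by (intro order_tendstoD(2)[where y = 0]) auto
  then show ?thesis
    using trial_spaces
  proof eventually_elim
    case (elim h)
    have res: "residual_le (X h) (\<eta> / 2 + (\<Sum>f\<in>F. nrm (f - proj (X h) f)))"
      using \<eta> by (intro residual_bound[OF elim(2) F(1,2) _ F(3)]) auto
    show ?case
      unfolding residual_le_def
    proof (intro ballI)
      fix u v assume uv: "u \<in> H" "v \<in> H"
      then have "(\<eta> / 2 + (\<Sum>f\<in>F. nrm (f - proj (X h) f))) * (nrm u * nrm v) \<le> \<eta> * (nrm u * nrm v)"
        using elim(1) nrm_nonneg by (intro mult_right_mono mult_nonneg_nonneg) auto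
      then show "\<bar>b (u - proj (X h) u) v\<bar> \<le> \<eta> * nrm u * nrm v"
        using res uv unfolding residual_le_def by (force simp: mult.assoc)
    qed
  qed
qed

lemma proj_K_proj_tendsto:
  assumes "0 < \<eta>"
  shows "\<forall>\<^sub>F h in G. \<forall>u\<in>H. nrm (proj (X h) (K (proj (X h) u)) - K u) \<le> \<eta> * nrm u"
proof -
  have "\<forall>\<^sub>F h in G. residual_le (X h) (\<eta> / 2)" using assms by (intro residual_small) simp
  then show ?thesis
    using trial_spaces
  proof eventually_elim
    case (elim h)
    then show ?case using nrm_proj_K_proj_le[OF elim(2,1)] assms by simp
  qed
qed

lemma card_eigenvalues_near:
  assumes \<mu>: "\<mu> \<noteq> 0"
    and gap: "\<And>u. \<lbrakk>u \<in> H; \<forall>e\<in>eigenspace H K \<mu>. a e u = 0\<rbrakk> \<Longrightarrow> \<gamma> * nrm u \<le> nrm (K u - \<mu> *\<^sub>R u)"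
    and \<delta>: "0 < \<delta>" "\<delta> < \<gamma>"
  shows "\<forall>\<^sub>F h in G. \<forall>B \<theta>. eigenbasis (X h) (Kh (X h)) B \<theta> \<longrightarrow>
    card {e \<in> B. \<bar>\<theta> e - \<mu>\<bar> < \<delta>} = dim (eigenspace H K \<mu>)"
proof -
  obtain C where C: "0 < C" "\<And>u. u \<in> H \<Longrightarrow> nrm (K u) \<le> C * nrm u"
    by (rule K_bounded) (rule that)
  have "((\<lambda>\<eta>. \<eta> * (1 + (C + \<bar>\<mu>\<bar>) / \<bar>\<mu>\<bar>)) \<longlongrightarrow> 0 * (1 + (C + \<bar>\<mu>\<bar>) / \<bar>\<mu>\<bar>)) (at_right 0)"
    by (intro tendsto_intros)
  then have "\<forall>\<^sub>F \<eta> in at_right 0. \<eta> * (1 + (C + \<bar>\<mu>\<bar>) / \<bar>\<mu>\<bar>) < \<delta> / 2"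
    using \<delta>(1) by (intro order_tendstoD(2)) auto
  moreover have "((\<lambda>\<eta>. \<delta> * (1 - \<eta> / \<bar>\<mu>\<bar>)) \<longlongrightarrow> \<delta> * (1 - 0 / \<bar>\<mu>\<bar>)) (at_right 0)"
    using \<mu> by (intro tendsto_intros) auto
  then have "\<forall>\<^sub>F \<eta> in at_right 0. \<delta> / 2 < \<delta> * (1 - \<eta> / \<bar>\<mu>\<bar>)"
    using \<delta>(1) by (intro order_tendstoD(1)) auto
  moreover have "((\<lambda>\<eta>. \<delta> + \<eta>) \<longlongrightarrow> \<delta> + 0) (at_right 0)"
    by (intro tendsto_intros)
  then have "\<forall>\<^sub>F \<eta> in at_right 0. \<delta> + \<eta> < \<gamma>"
    using \<delta>(2) by (intro order_tendstoD(2)) auto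
  moreover have "\<forall>\<^sub>F \<eta> in at_right 0. 0 < (\<eta>::real)"
    by (simp add: eventually_at_filter)
  \<comment> \<open>Sufficiently small errors \<open>\<eta>\<close> meet the requirements of the upper and of the lower count.\<close>
  ultimately have "\<forall>\<^sub>F \<eta> in at_right 0. 0 < \<eta> \<and> \<delta> + \<eta> < \<gamma> \<and>
      \<eta> * (1 + (C + \<bar>\<mu>\<bar>) / \<bar>\<mu>\<bar>) < \<delta> * (1 - \<eta> / \<bar>\<mu>\<bar>)"
    by eventually_elim linarith
  then obtain \<eta> where \<eta>: "0 < \<eta>" "\<delta> + \<eta> < \<gamma>"
    "\<eta> * (1 + (C + \<bar>\<mu>\<bar>) / \<bar>\<mu>\<bar>) < \<delta> * (1 - \<eta> / \<bar>\<mu>\<bar>)"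
    using eventually_happens[of _ "at_right (0::real)"] by (auto simp: trivial_limit_at_right_real)
  show ?thesis
    using residual_small[OF \<eta>(1)] trial_spaces
  proof eventually_elim
    case (elim h)
    show ?case
    proof (intro allI impI antisym)
      fix B \<theta> assume B: "eigenbasis (X h) (Kh (X h)) B \<theta>"
      show "card {e \<in> B. \<bar>\<theta> e - \<mu>\<bar> < \<delta>} \<le> dim (eigenspace H K \<mu>)"
        using card_eigenvalues_near_le[OF elim(2) \<mu> gap elim(1) _ _ \<eta>(2) B] \<eta>(1) \<delta>(1) by simp
      show "dim (eigenspace H K \<mu>) \<le> card {e \<in> B. \<bar>\<theta> e - \<mu>\<bar> < \<delta>}"
        using card_eigenvalues_near_ge[OF elim(2) \<mu> C(2,1) elim(1) _ \<delta>(1) \<eta>(3) B] \<eta>(1) by simp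
    qed
  qed
qed

text \<open>
  The functions \<open>ev\<close> enumerate the eigenvalues inside one fixed window. Eventually every smaller window
  around \<open>\<mu>\<close> contains equally many, hence all of them, which is their convergence to \<open>\<mu>\<close>.
\<close>

lemma spectral_convergence:
  assumes \<mu>: "\<mu> \<noteq> 0"
  defines "m \<equiv> multiplicity_of H K \<mu>"
  shows "\<exists>\<delta>>0. \<exists>ev :: nat \<Rightarrow> 'i \<Rightarrow> real. (\<forall>j<m. (ev j \<longlongrightarrow> \<mu>) G) \<and>
    (\<forall>\<^sub>F h in G. \<forall>\<nu>. \<bar>\<nu> - \<mu>\<bar> < \<delta> \<longrightarrow>
      multiplicity_of (X h) (Kh (X h)) \<nu> = card {j. j < m \<and> ev j h = \<nu>})"
proof -
  obtain \<gamma> where \<gamma>: "0 < \<gamma>"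
    "\<And>u. \<lbrakk>u \<in> H; \<forall>e\<in>eigenspace H K \<mu>. a e u = 0\<rbrakk> \<Longrightarrow> \<gamma> * nrm u \<le> nrm (K u - \<mu> *\<^sub>R u)"
    by (rule K_gap[OF \<mu>]) (rule that)
  have m: "m = dim (eigenspace H K \<mu>)" by (simp add: m_def multiplicity_of_def)
  have "\<forall>h. \<exists>B \<theta>. trial_space (X h) \<longrightarrow> eigenbasis (X h) (Kh (X h)) B \<theta>"
    using Kh_eigenbasis_exists by blast
  then obtain B \<theta> where B: "\<And>h. trial_space (X h) \<Longrightarrow> eigenbasis (X h) (Kh (X h)) (B h) (\<theta> h)"
    by metis
  define J where "J \<delta> h = {e \<in> B h. \<bar>\<theta> h e - \<mu>\<bar> < \<delta>}" for \<delta> h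
  have count: "\<forall>\<^sub>F h in G. card (J \<delta> h) = m" if "0 < \<delta>" "\<delta> < \<gamma>" for \<delta>
  proof -
    have "\<forall>\<^sub>F h in G. \<forall>B \<theta>. eigenbasis (X h) (Kh (X h)) B \<theta> \<longrightarrow>
        card {e \<in> B. \<bar>\<theta> e - \<mu>\<bar> < \<delta>} = dim (eigenspace H K \<mu>)"
      by (rule card_eigenvalues_near[OF \<mu> _ that]) (rule \<gamma>(2))
    then show ?thesis
      using trial_spaces by eventually_elim (use B in \<open>auto simp: J_def m\<close>)
  qed
  define \<delta> where "\<delta> = \<gamma> / 2"
  have \<delta>: "0 < \<delta>" "\<delta> < \<gamma>" using \<gamma>(1) by (auto simp: \<delta>_def)
  have "\<forall>h. \<exists>p. trial_space (X h) \<and> card (J \<delta> h) = m \<longrightarrow> bij_betw p {..<m} (J \<delta> h)"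
  proof (intro allI)
    fix h
    have "finite (J \<delta> h)" if "trial_space (X h)"
      using eigenbasis_finite[OF B[OF that]] by (simp add: J_def)
    then show "\<exists>p. trial_space (X h) \<and> card (J \<delta> h) = m \<longrightarrow> bij_betw p {..<m} (J \<delta> h)"
      using ex_bij_betw_nat_finite[of "J \<delta> h"] by (auto simp: lessThan_atLeast0)
  qed
  then obtain p where p:
    "\<And>h. trial_space (X h) \<Longrightarrow> card (J \<delta> h) = m \<Longrightarrow> bij_betw (p h) {..<m} (J \<delta> h)" by metis
  define ev where "ev j h = \<theta> h (p h j)" for j h
  have "(ev j \<longlongrightarrow> \<mu>) G" if j: "j < m" for j
  proof (rule tendstoI)
    fix e :: real assume e: "0 < e"
    define \<delta>' where "\<delta>' = min e \<delta>"
    have "0 < \<delta>'" "\<delta>' < \<gamma>" using e \<delta> by (auto simp: \<delta>'_def)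
    from count[OF this] count[OF \<delta>] trial_spaces show "\<forall>\<^sub>F h in G. dist (ev j h) \<mu> < e"
    proof eventually_elim
      case (elim h)
      have "finite (J \<delta> h)" using eigenbasis_finite[OF B[OF elim(3)]] by (simp add: J_def)
      moreover have "J \<delta>' h \<subseteq> J \<delta> h" by (auto simp: J_def \<delta>'_def)
      ultimately have "J \<delta>' h = J \<delta> h" using elim by (intro card_subset_eq) auto
      moreover have "p h j \<in> J \<delta> h"
        using bij_betwE[OF p[OF elim(3,2)]] j by auto
      ultimately show ?case by (auto simp: J_def ev_def \<delta>'_def dist_real_def)
    qed
  qed
  moreover have "\<forall>\<^sub>F h in G. \<forall>\<nu>. \<bar>\<nu> - \<mu>\<bar> < \<delta> \<longrightarrow>
      multiplicity_of (X h) (Kh (X h)) \<nu> = card {j. j < m \<and> ev j h = \<nu>}"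
    using count[OF \<delta>] trial_spaces
  proof eventually_elim
    case (elim h)
    show ?case
    proof (intro allI impI)
      fix \<nu> assume \<nu>: "\<bar>\<nu> - \<mu>\<bar> < \<delta>"
      note W = W_sub[OF elim(2)]
      have bij: "bij_betw (p h) {..<m} (J \<delta> h)" by (rule p[OF elim(2,1)])
      have "multiplicity_of (X h) (Kh (X h)) \<nu> = card {e \<in> B h. \<theta> h e = \<nu>}"
        by (rule multiplicity_eigenbasis[OF B[OF elim(2)] W(3,1) Kh_symmetric[OF elim(2)]])
      also have "{e \<in> B h. \<theta> h e = \<nu>} = {e \<in> J \<delta> h. \<theta> h e = \<nu>}"
        using \<nu> by (auto simp: J_def)
      also have "\<dots> = p h ` {j. j < m \<and> ev j h = \<nu>}"
        using bij unfolding bij_betw_def ev_def by auto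
      also have "card \<dots> = card {j. j < m \<and> ev j h = \<nu>}"
        using bij by (intro card_image) (auto simp: bij_betw_def intro: inj_on_subset)
      finally show "multiplicity_of (X h) (Kh (X h)) \<nu> = card {j. j < m \<and> ev j h = \<nu>}" .
    qed
  qed
  ultimately show ?thesis using \<delta>(1) by blast
qed

subsection \<open>Extremal Rayleigh quotients\<close>

definition sphere_in :: "'b set \<Rightarrow> 'b set" where "sphere_in W = {u \<in> W. nrm u = 1}"

lemma sphere_in_H_nonempty: "H \<noteq> {0} \<Longrightarrow> sphere_in H \<noteq> {}"
proof -
  assume "H \<noteq> {0}"
  then obtain u where u: "u \<in> H" "u \<noteq> 0" using H_zero by blast
  then have "(1 / nrm u) *\<^sub>R u \<in> sphere_in H"
    using nrm_pos[OF u] by (auto simp: sphere_in_def nrm_scale)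
  then show ?thesis by blast
qed

lemma sphere_in_nonempty: "trial_space W \<Longrightarrow> W \<noteq> {0} \<Longrightarrow> sphere_in W \<noteq> {}"
proof -
  assume W: "trial_space W" "W \<noteq> {0}"
  then obtain u where u: "u \<in> W" "u \<noteq> 0" "u \<in> H" using subspace_0 W_sub[OF W(1)] by blast
  then have "(1 / nrm u) *\<^sub>R u \<in> sphere_in W"
    using nrm_pos[OF u(3,2)] W_sub[OF W(1)] by (auto simp: sphere_in_def nrm_scale subspace_scale)
  then show ?thesis by blast
qed

lemma sphere_in_approximation:
  assumes u: "u \<in> sphere_in H" and e: "0 < e"
  shows "\<forall>\<^sub>F h in G. \<exists>v\<in>sphere_in (X h). nrm (v - u) < e"
proof -
  have uH: "u \<in> H" and u1: "nrm u = 1" using u by (auto simp: sphere_in_def)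
  have "\<forall>\<^sub>F h in G. nrm (u - proj (X h) u) < min (e / 2) 1"
    using e by (intro order_tendstoD(2)[OF proj_tendsto[OF uH]]) auto
  then show ?thesis
    using trial_spaces
  proof eventually_elim
    case (elim h)
    let ?w = "proj (X h) u"
    have w: "?w \<in> X h" "?w \<in> H" using proj_mem[OF elim(2) uH] proj_mem_H[OF elim(2) uH] by auto
    have close: "\<bar>1 - nrm ?w\<bar> \<le> nrm (u - ?w)" using nrm_triangle_rev[OF uH w(2)] u1 by simp
    then have pos: "0 < nrm ?w" using elim(1) by linarith
    let ?v = "(1 / nrm ?w) *\<^sub>R ?w"
    have "?v \<in> sphere_in (X h)"
      using w pos W_sub[OF elim(2)] by (auto simp: sphere_in_def nrm_scale subspace_scale)
    moreover have "nrm (?v - u) \<le> nrm (?v - ?w) + nrm (?w - u)"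
      using nrm_triangle[of "?v - ?w" "?w - u"] w uH by simp
    moreover have "nrm (?v - ?w) = \<bar>1 - nrm ?w\<bar>"
    proof -
      have "?v - ?w = (1 / nrm ?w - 1) *\<^sub>R ?w" by (simp add: scaleR_diff_left)
      then have "nrm (?v - ?w) = \<bar>1 / nrm ?w - 1\<bar> * \<bar>nrm ?w\<bar>"
        using w(2) pos by (simp add: nrm_scale)
      also have "\<dots> = \<bar>1 - nrm ?w\<bar>"
        using pos by (simp add: abs_mult[symmetric] field_simps)
      finally show ?thesis .
    qed
    ultimately show ?case
      using close elim(1) nrm_minus_commute[OF uH w(2)] by (intro bexI[of _ ?v]) auto
  qed
qed

lemma sphere_in_mono: "trial_space W \<Longrightarrow> sphere_in W \<subseteq> sphere_in H"
  using W_sub(3) by (auto simp: sphere_in_def)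

text \<open>
  The supremum over the sphere of a trial space never exceeds the one over the whole sphere, and the
  normalised projections of a near-maximiser come close to it.
\<close>

lemma SUP_sphere_tendsto:
  assumes ne: "H \<noteq> {0}" and bdd: "bdd_above (f ` sphere_in H)"
    and Lip: "\<And>u v. \<lbrakk>u \<in> sphere_in H; v \<in> sphere_in H\<rbrakk> \<Longrightarrow> \<bar>f u - f v\<bar> \<le> C * nrm (u - v)"
  shows "((\<lambda>h. SUP u\<in>sphere_in (X h). f u) \<longlongrightarrow> (SUP u\<in>sphere_in H. f u)) G"
proof (rule order_tendstoI)
  fix y assume "y < (SUP u\<in>sphere_in H. f u)"
  then obtain u where u: "u \<in> sphere_in H" "y < f u"
    using less_cSUP_iff[OF sphere_in_H_nonempty[OF ne] bdd] by blast
  define e where "e = (f u - y) / (\<bar>C\<bar> + 1)"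
  have e: "0 < e" using u(2) by (auto simp: e_def intro!: divide_pos_pos)
  show "\<forall>\<^sub>F h in G. y < (SUP u\<in>sphere_in (X h). f u)"
    using sphere_in_approximation[OF u(1) e] trial_spaces
  proof eventually_elim
    case (elim h)
    then obtain v where v: "v \<in> sphere_in (X h)" "nrm (v - u) < e" by blast
    have vH: "v \<in> sphere_in H" using v(1) sphere_in_mono[OF elim(2)] by blast
    have "\<bar>f u - f v\<bar> \<le> C * nrm (v - u)"
      using Lip[OF vH u(1)] by (simp add: abs_minus_commute)
    also have "\<dots> \<le> (\<bar>C\<bar> + 1) * nrm (v - u)"
      using vH u(1) by (intro mult_right_mono nrm_nonneg) (auto simp: sphere_in_def)
    also have "\<dots> < (\<bar>C\<bar> + 1) * e" using v(2) by (intro mult_strict_left_mono) auto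
    also have "\<dots> = f u - y" unfolding e_def by simp
    finally have "y < f v" by linarith
    also have "f v \<le> (SUP u\<in>sphere_in (X h). f u)"
      using v(1) by (intro cSUP_upper bdd_above_mono[OF bdd] image_mono sphere_in_mono[OF elim(2)])
    finally show ?case .
  qed
next
  fix y assume y: "(SUP u\<in>sphere_in H. f u) < y"
  obtain u where u: "u \<in> sphere_in H" using sphere_in_H_nonempty[OF ne] by blast
  show "\<forall>\<^sub>F h in G. (SUP u\<in>sphere_in (X h). f u) < y"
    using sphere_in_approximation[OF u zero_less_one] trial_spaces
  proof eventually_elim
    case (elim h)
    have "(SUP u\<in>sphere_in (X h). f u) \<le> (SUP u\<in>sphere_in H. f u)"
      using elim(1) by (intro cSUP_subset_mono bdd sphere_in_mono[OF elim(2)]) auto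
    then show ?case using y by simp
  qed
qed

definition rayleigh :: "'b \<Rightarrow> real" where "rayleigh u = a u u + b u u"

lemma rayleigh_bounded:
  obtains C where "\<And>u. u \<in> sphere_in H \<Longrightarrow> \<bar>rayleigh u\<bar> \<le> C"
    "\<And>u v. \<lbrakk>u \<in> sphere_in H; v \<in> sphere_in H\<rbrakk> \<Longrightarrow> \<bar>rayleigh u - rayleigh v\<bar> \<le> C * nrm (u - v)"
proof -
  obtain D where D: "0 < D" "\<And>u v. \<lbrakk>u \<in> H; v \<in> H\<rbrakk> \<Longrightarrow> \<bar>b u v\<bar> \<le> D * nrm u * nrm v"
    by (rule b_bounded) (rule that)
  have "\<bar>rayleigh u\<bar> \<le> 1 + 2 * D" if "u \<in> sphere_in H" for u
    using that D(2)[of u u] D(1) nrm_square[of u] by (auto simp: rayleigh_def sphere_in_def)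
  moreover have "\<bar>rayleigh u - rayleigh v\<bar> \<le> (1 + 2 * D) * nrm (u - v)"
    if "u \<in> sphere_in H" "v \<in> sphere_in H" for u v
  proof -
    have uv: "u \<in> H" "v \<in> H" "nrm u = 1" "nrm v = 1" using that by (auto simp: sphere_in_def)
    have "rayleigh u - rayleigh v = b (u - v) u + b v (u - v)"
      using uv nrm_square[of u] nrm_square[of v] by (simp add: rayleigh_def b_simps)
    moreover have "\<bar>b (u - v) u\<bar> \<le> D * nrm (u - v)" "\<bar>b v (u - v)\<bar> \<le> D * nrm (u - v)"
      using D(2)[of "u - v" u] D(2)[of v "u - v"] uv by auto
    ultimately show ?thesis
      using nrm_nonneg[of "u - v"] uv by (simp add: distrib_right)
  qed
  ultimately show ?thesis using that by blast
qed

text \<open>The condition number of \<open>I + K\<close> compressed to \<open>W\<close>.\<close>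

definition cond :: "'b set \<Rightarrow> real" where
  "cond W = (SUP u\<in>sphere_in W. rayleigh u) / (INF u\<in>sphere_in W. rayleigh u)"

lemma rayleigh_bdd:
  "bdd_above (rayleigh ` sphere_in H)" "bdd_below (rayleigh ` sphere_in H)"
proof -
  obtain C where "\<And>u. u \<in> sphere_in H \<Longrightarrow> \<bar>rayleigh u\<bar> \<le> C"
    using rayleigh_bounded by metis
  then show "bdd_above (rayleigh ` sphere_in H)" "bdd_below (rayleigh ` sphere_in H)"
    by (auto intro!: bdd_aboveI[of _ C] bdd_belowI[of _ "- C"] simp: abs_le_iff) 
       (metis minus_le_iff)
qed

context
  assumes positive: "\<And>u. \<lbrakk>u \<in> H; u \<noteq> 0\<rbrakk> \<Longrightarrow> 0 < a u u + b u u"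
begin

lemma INF_rayleigh_pos: "H \<noteq> {0} \<Longrightarrow> 0 < (INF u\<in>sphere_in H. rayleigh u)"
proof -
  assume ne: "H \<noteq> {0}"
  obtain \<gamma> where \<gamma>: "0 < \<gamma>" "\<And>u. u \<in> H \<Longrightarrow> \<gamma> * (nrm u)\<^sup>2 \<le> a u u + b u u"
    by (rule positive_imp_coercive[OF positive]) (assumption, assumption, rule that)
  have "\<gamma> \<le> (INF u\<in>sphere_in H. rayleigh u)"
    using \<gamma>(2) by (intro cINF_greatest sphere_in_H_nonempty[OF ne]) (force simp: sphere_in_def rayleigh_def)
  with \<gamma>(1) show ?thesis by simp
qed

lemma cond_le:
  assumes W: "trial_space W" "W \<noteq> {0}"
  shows "cond W \<le> cond H"
proof -
  have neW: "sphere_in W \<noteq> {}" by (rule sphere_in_nonempty[OF W])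
  have ne: "H \<noteq> {0}" using W(2) W_sub[OF W(1)] subspace_0 by blast
  note sub = sphere_in_mono[OF W(1)]
  note pos = INF_rayleigh_pos[OF ne]
  have inf: "(INF u\<in>sphere_in H. rayleigh u) \<le> (INF u\<in>sphere_in W. rayleigh u)"
    by (intro cINF_superset_mono neW rayleigh_bdd sub) auto
  have sup: "(SUP u\<in>sphere_in W. rayleigh u) \<le> (SUP u\<in>sphere_in H. rayleigh u)"
    by (intro cSUP_subset_mono neW rayleigh_bdd sub) auto
  obtain u where u: "u \<in> sphere_in H" using neW sub by blast
  have "0 \<le> (SUP u\<in>sphere_in H. rayleigh u)"
    using cSUP_upper[OF u rayleigh_bdd(1)] cINF_lower[OF rayleigh_bdd(2) u] pos by linarith
  then show ?thesis
    unfolding cond_def using pos inf sup by (intro frac_le) auto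
qed

lemma cond_tendsto: "((\<lambda>h. cond (X h)) \<longlongrightarrow> cond H) G"
proof (cases "H = {0}")
  case True
  \<comment> \<open>All spheres are empty, and both quotients are the same default value.\<close>
  have "\<forall>\<^sub>F h in G. cond (X h) = cond H"
    using trial_spaces
  proof eventually_elim
    case (elim h)
    have "X h = H" using W_sub[OF elim] subspace_0 True by blast
    then show ?case by simp
  qed
  then show ?thesis by (rule tendsto_eventually)
next
  case False
  obtain C where C: "\<And>u v. \<lbrakk>u \<in> sphere_in H; v \<in> sphere_in H\<rbrakk> \<Longrightarrow> \<bar>rayleigh u - rayleigh v\<bar> \<le> C * nrm (u - v)"
    using rayleigh_bounded by metis
  have inf_eq: "(INF u\<in>S. rayleigh u) = - (SUP u\<in>S. - rayleigh u)" for S :: "'b set"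
    by (simp add: Inf_real_def image_image)
  have "bdd_above ((\<lambda>u. - rayleigh u) ` sphere_in H)"
    using rayleigh_bdd(2) bdd_above_uminus[of "rayleigh ` sphere_in H"] by (simp add: image_image)
  then have inf: "((\<lambda>h. INF u\<in>sphere_in (X h). rayleigh u) \<longlongrightarrow> (INF u\<in>sphere_in H. rayleigh u)) G"
    unfolding inf_eq using C
    by (intro tendsto_minus SUP_sphere_tendsto[OF False, of _ C]) (auto simp: abs_minus_commute)
  have "((\<lambda>h. SUP u\<in>sphere_in (X h). rayleigh u) \<longlongrightarrow> (SUP u\<in>sphere_in H. rayleigh u)) G"
    by (rule SUP_sphere_tendsto[OF False rayleigh_bdd(1) C])
  then show ?thesis
    unfolding cond_def using inf INF_rayleigh_pos[OF False] by (intro tendsto_divide) auto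
qed

end

end

section \<open>Completeness of the space of square-integrable functions\<close>

lemma square_integrable_rep_L2 [simp]: "square_integrable (rep_L2 u)"
  using Quotient_rep_reflp[OF Quotient_L2, of u] by (simp add: L2_eq_def)

lemma square_integrable_measurable [measurable_dest]:
  "square_integrable f \<Longrightarrow> f \<in> borel_measurable lebesgue"
  by (simp add: square_integrable_def)

lemma rep_L2_measurable [measurable]: "rep_L2 u \<in> borel_measurable lebesgue"
  using square_integrable_rep_L2 by (rule square_integrable_measurable)

lemma AE_rep_abs_L2:
  assumes "square_integrable f"
  shows "AE x in lebesgue. rep_L2 (abs_L2 f) x = f x"
  using Quotient_rep_abs[OF Quotient_L2, of f] assms by (simp add: L2_eq_def)

lemma abs_L2_eqI:
  assumes "square_integrable f" "square_integrable g" "AE x in lebesgue. f x = g x"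
  shows "abs_L2 f = abs_L2 g"
  using assms by (intro Quotient_rel_abs[OF Quotient_L2]) (simp add: L2_eq_def)

lemma abs_L2_rep_L2: "abs_L2 (rep_L2 u) = u"
  by (rule Quotient_abs_rep[OF Quotient_L2])

lemma L2_eqI: "AE x in lebesgue. rep_L2 u x = rep_L2 v x \<Longrightarrow> u = v"
  using abs_L2_eqI[of "rep_L2 u" "rep_L2 v"] by (simp add: abs_L2_rep_L2)

lemma abs_L2_add:
  "square_integrable f \<Longrightarrow> square_integrable g \<Longrightarrow> abs_L2 f + abs_L2 g = abs_L2 (\<lambda>x. f x + g x)"
  by (intro plus_L2.abs_eq) (auto simp: L2_eq_def)

lemma abs_L2_diff:
  "square_integrable f \<Longrightarrow> square_integrable g \<Longrightarrow> abs_L2 f - abs_L2 g = abs_L2 (\<lambda>x. f x - g x)"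
  by (intro minus_L2.abs_eq) (auto simp: L2_eq_def)

lemma abs_L2_scale: "square_integrable f \<Longrightarrow> c *\<^sub>R abs_L2 f = abs_L2 (\<lambda>x. c * f x)"
  by (intro scaleR_L2.abs_eq) (auto simp: L2_eq_def)

lemma AE_rep_L2_add: "AE x in lebesgue. rep_L2 (u + v) x = rep_L2 u x + rep_L2 v x"
  using AE_rep_abs_L2[OF square_integrable_add, of "rep_L2 u" "rep_L2 v"]
  by (simp add: abs_L2_add[symmetric] abs_L2_rep_L2)

lemma AE_rep_L2_diff: "AE x in lebesgue. rep_L2 (u - v) x = rep_L2 u x - rep_L2 v x"
  using AE_rep_abs_L2[OF square_integrable_diff, of "rep_L2 u" "rep_L2 v"]
  by (simp add: abs_L2_diff[symmetric] abs_L2_rep_L2)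

lemma AE_rep_L2_scale: "AE x in lebesgue. rep_L2 (c *\<^sub>R u) x = c * rep_L2 u x"
  using AE_rep_abs_L2[OF square_integrable_cmult, of "rep_L2 u" c]
  by (simp add: abs_L2_scale[symmetric] abs_L2_rep_L2)

lemma AE_rep_L2_zero: "AE x in lebesgue. rep_L2 0 x = 0"
  using AE_rep_abs_L2[OF square_integrable_zero] by (simp add: zero_L2.abs_eq)

lemma AE_rep_L2_sum: "AE x in lebesgue. rep_L2 (\<Sum>i\<in>I. g i) x = (\<Sum>i\<in>I. rep_L2 (g i) x)"
proof (induction I rule: infinite_finite_induct)
  case (insert i I)
  then show ?case using AE_rep_L2_add[of "g i" "sum g I"] by (auto elim: AE_mp)
qed (use AE_rep_L2_zero in auto)

lemma inner_abs_L2: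
  "square_integrable f \<Longrightarrow> square_integrable g \<Longrightarrow> inner (abs_L2 f) (abs_L2 g) = (LINT x|lebesgue. f x * g x)"
  by (intro inner_L2.abs_eq) (auto simp: L2_eq_def)

lemma inner_L2_eq: "inner u v = (LINT x|lebesgue. rep_L2 u x * rep_L2 v x)"
  using inner_abs_L2[of "rep_L2 u" "rep_L2 v"] by (simp add: abs_L2_rep_L2)

lemma inner_L2_abs_right:
  "square_integrable g \<Longrightarrow> inner u (abs_L2 g) = (LINT x|lebesgue. rep_L2 u x * g x)"
  using inner_abs_L2[of "rep_L2 u" g] by (simp add: abs_L2_rep_L2)

lemma norm_L2_square: "(norm u)\<^sup>2 = (LINT x|lebesgue. (rep_L2 u x)\<^sup>2)"
  unfolding power2_norm_eq_inner inner_L2_eq by (simp add: power2_eq_square)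

lemma norm_abs_L2_square: "square_integrable f \<Longrightarrow> (norm (abs_L2 f))\<^sup>2 = (LINT x|lebesgue. (f x)\<^sup>2)"
  unfolding power2_norm_eq_inner by (simp add: inner_abs_L2 power2_eq_square)

lemma nn_integral_square_L2: "(\<integral>\<^sup>+x. ennreal ((rep_L2 u x)\<^sup>2) \<partial>lebesgue) = ennreal ((norm u)\<^sup>2)"
  unfolding norm_L2_square
  by (intro nn_integral_eq_integral) (use square_integrable_rep_L2[of u] in \<open>auto simp: square_integrable_def\<close>)

lemma square_integrable_nnI:
  assumes "f \<in> borel_measurable lebesgue" "(\<integral>\<^sup>+x. ennreal ((f x)\<^sup>2) \<partial>lebesgue) < \<infinity>"
  shows "square_integrable f"
  using assms unfolding square_integrable_def
  by (auto intro!: integrableI_nonneg)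

lemma norm_abs_L2_le:
  assumes f: "f \<in> borel_measurable lebesgue" and c: "0 \<le> c"
    and le: "(\<integral>\<^sup>+x. ennreal ((f x)\<^sup>2) \<partial>lebesgue) \<le> ennreal (c\<^sup>2)"
  shows "square_integrable f" "norm (abs_L2 f) \<le> c"
proof -
  show si: "square_integrable f"
    using le by (intro square_integrable_nnI f) (auto intro: le_less_trans)
  have "ennreal ((norm (abs_L2 f))\<^sup>2) = (\<integral>\<^sup>+x. ennreal ((f x)\<^sup>2) \<partial>lebesgue)"
    unfolding norm_abs_L2_square[OF si]
    using si by (intro nn_integral_eq_integral[symmetric]) (auto simp: square_integrable_def)
  with le have "ennreal ((norm (abs_L2 f))\<^sup>2) \<le> ennreal (c\<^sup>2)" by simp
  then have "(norm (abs_L2 f))\<^sup>2 \<le> c\<^sup>2" by (subst (asm) ennreal_le_iff) auto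
  then show "norm (abs_L2 f) \<le> c" using c by (rule power2_le_imp_le)
qed

subsection \<open>The Riesz--Fischer theorem\<close>

text \<open>
  The increments of a fast Cauchy sequence are summable almost everywhere by monotone convergence;
  Fatou's lemma bounds the distance to the pointwise limit.
\<close>

lemma fast_Cauchy_AE_convergent:
  fixes X :: "nat \<Rightarrow> 'a::euclidean_space L2"
  assumes fast: "\<And>n. norm (X (Suc n) - X n) \<le> (1/2) ^ n"
  shows "AE x in lebesgue. convergent (\<lambda>n. rep_L2 (X n) x)"
proof -
  define d where "d n x = \<bar>rep_L2 (X (Suc n) - X n) x\<bar>" for n x
  have si_d: "square_integrable (d n)" for n
    using square_integrable_rep_L2[of "X (Suc n) - X n"]
    by (auto simp: square_integrable_def d_def[abs_def])
  define D where "D n = abs_L2 (d n)" for n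
  have norm_D: "norm (D n) \<le> (1/2) ^ n" for n
  proof -
    have "(norm (D n))\<^sup>2 = (norm (X (Suc n) - X n))\<^sup>2"
      using norm_abs_L2_square[OF si_d, of n] norm_L2_square[of "X (Suc n) - X n"]
      by (simp add: D_def d_def)
    then show ?thesis using fast[of n] by simp
  qed
  have norm_sum: "norm (\<Sum>n<N. D n) \<le> 2" for N
  proof -
    have "norm (\<Sum>n<N. D n) \<le> (\<Sum>n<N. (1/2) ^ n)"
      by (rule order_trans[OF norm_sum sum_mono[OF norm_D]])
    also have "\<dots> \<le> (\<Sum>n. (1/2::real) ^ n)"
      by (intro sum_le_suminf) (auto intro: summable_geometric)
    also have "\<dots> = 2" by (subst suminf_geometric) auto
    finally show ?thesis .
  qed
  have AE_D: "AE x in lebesgue. rep_L2 (\<Sum>n<N. D n) x = (\<Sum>n<N. d n x)" for N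
  proof -
    have "AE x in lebesgue. \<forall>n\<in>{..<N}. rep_L2 (D n) x = d n x"
      unfolding D_def by (intro AE_finite_allI) (auto intro: AE_rep_abs_L2 si_d)
    then show ?thesis
      using AE_rep_L2_sum[of D "{..<N}"] by eventually_elim simp
  qed
  have [measurable]: "d n \<in> borel_measurable lebesgue" for n
    using si_d by (rule square_integrable_measurable)
  have int_le: "(\<integral>\<^sup>+x. ennreal ((\<Sum>n<N. d n x)\<^sup>2) \<partial>lebesgue) \<le> 4" for N
  proof -
    have "(\<integral>\<^sup>+x. ennreal ((\<Sum>n<N. d n x)\<^sup>2) \<partial>lebesgue)
        = (\<integral>\<^sup>+x. ennreal ((rep_L2 (\<Sum>n<N. D n) x)\<^sup>2) \<partial>lebesgue)"
      using AE_D[of N] by (intro nn_integral_cong_AE) (auto elim: eventually_mono)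
    also have "\<dots> \<le> ennreal (2\<^sup>2)"
      unfolding nn_integral_square_L2 using norm_sum by (intro ennreal_leI power_mono) auto
    finally show ?thesis by simp
  qed
  have "(\<integral>\<^sup>+x. (SUP N. ennreal ((\<Sum>n<N. d n x)\<^sup>2)) \<partial>lebesgue)
      = (SUP N. \<integral>\<^sup>+x. ennreal ((\<Sum>n<N. d n x)\<^sup>2) \<partial>lebesgue)"
  proof (rule nn_integral_monotone_convergence_SUP)
    show "incseq (\<lambda>N x. ennreal ((\<Sum>n<N. d n x)\<^sup>2))"
      unfolding incseq_def le_fun_def
      by (intro allI impI ennreal_leI power_mono sum_mono2) (auto simp: d_def intro: sum_nonneg)
  qed measurable
  also have "\<dots> \<le> 4" using int_le by (intro SUP_least) auto
  also have "(4::ennreal) < \<infinity>" by simp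
  finally have "AE x in lebesgue. (SUP N. ennreal ((\<Sum>n<N. d n x)\<^sup>2)) \<noteq> \<infinity>"
    by (intro nn_integral_noteq_infinite) auto
  moreover have "AE x in lebesgue. \<forall>n. rep_L2 (X (Suc n) - X n) x = rep_L2 (X (Suc n)) x - rep_L2 (X n) x"
    by (subst AE_all_countable) (auto intro: AE_rep_L2_diff)
  ultimately show ?thesis
  proof eventually_elim
    case (elim x)
    then obtain c where c: "(SUP N. ennreal ((\<Sum>n<N. d n x)\<^sup>2)) = ennreal c" "0 \<le> c"
      by (cases "SUP N. ennreal ((\<Sum>n<N. d n x)\<^sup>2)") auto
    have "(\<Sum>n<N. d n x) \<le> 1 + c" for N
    proof -
      have "ennreal ((\<Sum>n<N. d n x)\<^sup>2) \<le> ennreal c"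
        unfolding c(1)[symmetric] by (rule SUP_upper) simp
      then have "(\<Sum>n<N. d n x)\<^sup>2 \<le> c" using c(2) by simp
      moreover have "(\<Sum>n<N. d n x) \<le> 1 + (\<Sum>n<N. d n x)\<^sup>2"
        using sum_power2_ge_zero[of "(\<Sum>n<N. d n x) - 1" "\<Sum>n<N. d n x"]
        by (simp add: power2_diff)
      ultimately show ?thesis by linarith
    qed
    then have "summable (\<lambda>n. d n x)"
      by (rule summableI_nonneg_bounded[rotated]) (simp add: d_def)
    then have "summable (\<lambda>n. rep_L2 (X (Suc n) - X n) x)"
      unfolding d_def by (rule summable_rabs_cancel)
    moreover have "(\<lambda>n. rep_L2 (X (Suc n) - X n) x) = (\<lambda>n. rep_L2 (X (Suc n)) x - rep_L2 (X n) x)"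
      by (rule ext) (rule elim(2)[rule_format])
    ultimately have "summable (\<lambda>n. rep_L2 (X (Suc n)) x - rep_L2 (X n) x)"
      by (simp only:)
    then have "convergent (\<lambda>N. rep_L2 (X N) x - rep_L2 (X 0) x)"
      unfolding summable_iff_convergent sum_lessThan_telescope[of "\<lambda>n. rep_L2 (X n) x"] .
    then have "convergent (\<lambda>N. (rep_L2 (X N) x - rep_L2 (X 0) x) + rep_L2 (X 0) x)"
      by (rule convergent_add) (rule convergent_const)
    then show ?case by simp
  qed
qed

lemma L2_complete:
  fixes X :: "nat \<Rightarrow> 'a::euclidean_space L2"
  assumes "Cauchy X"
  shows "convergent X"
proof -
  have "\<exists>N. \<forall>m\<ge>N. \<forall>n\<ge>N. dist (X m) (X n) < (1/2) ^ k" for k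
    using assms by (intro metric_CauchyD) auto
  then obtain N where N: "\<And>k m n. m \<ge> N k \<Longrightarrow> n \<ge> N k \<Longrightarrow> dist (X m) (X n) < (1/2) ^ k"
    by metis
  \<comment> \<open>Strictly increasing, and \<open>r n\<close> dominates \<open>N k\<close> for all \<open>k \<le> n\<close>.\<close>
  define r where "r k = k + (\<Sum>i\<le>k. N i)" for k
  have r: "strict_mono r" unfolding strict_mono_Suc_iff r_def by simp
  have r_ge: "N k \<le> r n" if "k \<le> n" for k n
    using member_le_sum[of k "{..n}" N] that by (simp add: r_def)
  define Y where "Y = X \<circ> r"
  have fast: "norm (Y (Suc n) - Y n) \<le> (1/2) ^ n" for n
    using N[of n "r (Suc n)" "r n"] r_ge[of n n] r_ge[of n "Suc n"]
    by (simp add: Y_def dist_norm less_imp_le)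
  define f where "f x = lim (\<lambda>n. rep_L2 (Y n) x)" for x
  have [measurable]: "f \<in> borel_measurable lebesgue"
    unfolding f_def by (intro borel_measurable_lim_metric) auto
  have dist_le: "(\<integral>\<^sup>+x. ennreal ((f x - rep_L2 (Y k) x)\<^sup>2) \<partial>lebesgue) \<le> ennreal (((1/2) ^ k)\<^sup>2)" for k
  proof -
    have "(\<integral>\<^sup>+x. ennreal ((f x - rep_L2 (Y k) x)\<^sup>2) \<partial>lebesgue)
        = (\<integral>\<^sup>+x. liminf (\<lambda>n. ennreal ((rep_L2 (Y n) x - rep_L2 (Y k) x)\<^sup>2)) \<partial>lebesgue)"
    proof (rule nn_integral_cong_AE)
      show "AE x in lebesgue. ennreal ((f x - rep_L2 (Y k) x)\<^sup>2)
          = liminf (\<lambda>n. ennreal ((rep_L2 (Y n) x - rep_L2 (Y k) x)\<^sup>2))"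
        using fast_Cauchy_AE_convergent[OF fast]
      proof eventually_elim
        case (elim x)
        then have "(\<lambda>n. rep_L2 (Y n) x) \<longlonglongrightarrow> f x"
          by (simp add: f_def convergent_LIMSEQ_iff)
        then have "(\<lambda>n. ennreal ((rep_L2 (Y n) x - rep_L2 (Y k) x)\<^sup>2))
            \<longlonglongrightarrow> ennreal ((f x - rep_L2 (Y k) x)\<^sup>2)"
          by (intro tendsto_intros tendsto_ennrealI)
        then show ?case by (intro lim_imp_Liminf[symmetric]) auto
      qed
    qed
    also have "\<dots> \<le> liminf (\<lambda>n. \<integral>\<^sup>+x. ennreal ((rep_L2 (Y n) x - rep_L2 (Y k) x)\<^sup>2) \<partial>lebesgue)"
      by (intro nn_integral_liminf) auto
    also have "\<dots> = liminf (\<lambda>n. ennreal ((norm (Y n - Y k))\<^sup>2))"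
    proof -
      have "(\<integral>\<^sup>+x. ennreal ((rep_L2 (Y n) x - rep_L2 (Y k) x)\<^sup>2) \<partial>lebesgue) = ennreal ((norm (Y n - Y k))\<^sup>2)" for n
        unfolding nn_integral_square_L2[symmetric] using AE_rep_L2_diff[of "Y n" "Y k"]
        by (intro nn_integral_cong_AE) (auto elim: eventually_mono)
      then show ?thesis by simp
    qed
    also have "\<dots> \<le> ennreal (((1/2) ^ k)\<^sup>2)"
    proof (rule Liminf_le[OF _ eventually_sequentiallyI[of k]])
      fix n assume "k \<le> n"
      then have "norm (Y n - Y k) \<le> (1/2) ^ k"
        using N[of k "r n" "r k"] r_ge[of k n] r_ge[of k k] by (simp add: Y_def dist_norm less_imp_le)
      then show "ennreal ((norm (Y n - Y k))\<^sup>2) \<le> ennreal (((1/2) ^ k)\<^sup>2)"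
        by (intro ennreal_leI power_mono) auto
    qed simp
    finally show ?thesis .
  qed
  have diff: "square_integrable (\<lambda>x. f x - rep_L2 (Y k) x)"
    "norm (abs_L2 (\<lambda>x. f x - rep_L2 (Y k) x)) \<le> (1/2) ^ k" for k
    by (rule norm_abs_L2_le[OF _ _ dist_le]; simp)+
  have f: "square_integrable f"
    using square_integrable_add[OF diff(1)[of 0] square_integrable_rep_L2[of "Y 0"]] by simp
  have "norm (Y k - abs_L2 f) \<le> (1/2) ^ k" for k
  proof -
    have "abs_L2 f - Y k = abs_L2 (\<lambda>x. f x - rep_L2 (Y k) x)"
      using abs_L2_diff[OF f square_integrable_rep_L2[of "Y k"]] unfolding abs_L2_rep_L2 .
    then show ?thesis
      using diff(2)[of k] by (subst norm_minus_commute) (simp only:)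
  qed
  then have "\<forall>\<^sub>F k in sequentially. norm (Y k - abs_L2 f) \<le> (1/2) ^ k"
    by (intro always_eventually allI)
  moreover have "(\<lambda>k. (1/2::real) ^ k) \<longlonglongrightarrow> 0"
    by (rule LIMSEQ_power_zero) simp
  ultimately have "(\<lambda>k. Y k - abs_L2 f) \<longlonglongrightarrow> 0"
    by (rule Lim_null_comparison)
  then have Y: "Y \<longlonglongrightarrow> abs_L2 f" by (rule LIM_zero_cancel)
  have "X \<longlonglongrightarrow> abs_L2 f"
  proof (rule metric_LIMSEQ_I)
    fix e :: real assume e: "0 < e"
    obtain M where M: "\<And>m n. m \<ge> M \<Longrightarrow> n \<ge> M \<Longrightarrow> dist (X m) (X n) < e / 2"
      using metric_CauchyD[OF assms, of "e / 2"] e by auto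
    obtain L where L: "\<And>k. k \<ge> L \<Longrightarrow> dist (Y k) (abs_L2 f) < e / 2"
      using metric_LIMSEQ_D[OF Y, of "e / 2"] e by auto
    have "dist (X n) (abs_L2 f) < e" if "n \<ge> M" for n
    proof -
      have "M \<le> r (max L M)" using seq_suble[OF r, of "max L M"] by simp
      then show ?thesis
        using dist_triangle_half_r[of "Y (max L M)" "X n" e "abs_L2 f"]
          M[of "r (max L M)" n] L[of "max L M"] that by (simp add: Y_def)
    qed
    then show "\<exists>no. \<forall>n\<ge>no. dist (X n) (abs_L2 f) < e" by blast
  qed
  then show ?thesis by (rule convergentI)
qed

subsection \<open>Functions that vanish outside a set\<close>

lemma subspace_L2_on: "subspace (L2_on \<Omega>)"
proof (rule subspaceI)
  show "0 \<in> L2_on \<Omega>"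
    using AE_rep_L2_zero by (auto simp: L2_on_def elim: eventually_mono)
next
  fix u v :: "'a L2" and c
  assume "u \<in> L2_on \<Omega>"
  then have u: "AE x in lebesgue. x \<notin> \<Omega> \<longrightarrow> rep_L2 u x = 0" by (simp add: L2_on_def)
  show "c *\<^sub>R u \<in> L2_on \<Omega>"
    using u AE_rep_L2_scale[of c u] unfolding L2_on_def mem_Collect_eq by eventually_elim simp
  assume "v \<in> L2_on \<Omega>"
  then have "AE x in lebesgue. x \<notin> \<Omega> \<longrightarrow> rep_L2 v x = 0" by (simp add: L2_on_def)
  with u AE_rep_L2_add[of u v] show "u + v \<in> L2_on \<Omega>"
    unfolding L2_on_def mem_Collect_eq by eventually_elim simp
qed

lemma square_integrable_indicator:
  assumes "square_integrable f" "A \<in> sets lebesgue"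
  shows "square_integrable (\<lambda>x. indicator A x * f x)"
proof -
  have "integrable lebesgue (\<lambda>x. indicator A x *\<^sub>R (f x)\<^sup>2)"
    using assms by (intro integrable_mult_indicator) (auto simp: square_integrable_def)
  moreover have "(indicator A x * f x)\<^sup>2 = indicator A x *\<^sub>R (f x)\<^sup>2" for x
    by (simp add: indicator_def)
  ultimately show ?thesis
    using assms by (auto simp: square_integrable_def intro!: borel_measurable_times)
qed

lemma L2_on_orthogonal:
  assumes u: "u \<in> L2_on \<Omega>" and v: "v \<in> L2_on (- \<Omega>)"
  shows "inner u v = 0"
proof -
  have "AE x in lebesgue. rep_L2 u x * rep_L2 v x = 0"
    using u v unfolding L2_on_def mem_Collect_eq by eventually_elim auto
  then show ?thesis
    unfolding inner_L2_eq using integral_cong_AE[of "\<lambda>x. rep_L2 u x * rep_L2 v x" lebesgue "\<lambda>_. 0"] by simp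
qed

text \<open>
  As an orthogonal complement, the space of functions vanishing outside \<open>\<Omega>\<close> is closed.
\<close>

lemma L2_on_iff_orthogonal:
  assumes \<Omega>: "\<Omega> \<in> sets lebesgue"
  shows "u \<in> L2_on \<Omega> \<longleftrightarrow> (\<forall>v\<in>L2_on (- \<Omega>). inner u v = 0)"
proof
  assume orth: "\<forall>v\<in>L2_on (- \<Omega>). inner u v = 0"
  define f where "f x = indicator (- \<Omega>) x * rep_L2 u x" for x
  have "- \<Omega> \<in> sets lebesgue" using \<Omega> by (metis Compl_in_sets_lebesgue)
  then have f: "square_integrable f" unfolding f_def by (intro square_integrable_indicator) auto
  have "abs_L2 f \<in> L2_on (- \<Omega>)"
    using AE_rep_abs_L2[OF f] unfolding L2_on_def mem_Collect_eq
    by eventually_elim (simp add: f_def)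
  then have "inner u (abs_L2 f) = 0" using orth by blast
  moreover have "inner u (abs_L2 f) = inner (abs_L2 f) (abs_L2 f)"
    unfolding inner_abs_L2[OF f f] unfolding inner_L2_abs_right[OF f]
    by (intro Bochner_Integration.integral_cong) (auto simp: f_def indicator_def)
  ultimately have "abs_L2 f = 0" by simp
  with AE_rep_abs_L2[OF f] have "AE x in lebesgue. rep_L2 0 x = f x" by simp
  then have "AE x in lebesgue. f x = 0"
    using AE_rep_L2_zero by eventually_elim simp
  then show "u \<in> L2_on \<Omega>"
    unfolding L2_on_def mem_Collect_eq by eventually_elim (auto simp: f_def indicator_def)
qed (use L2_on_orthogonal in blast)

lemma closed_L2_on:
  assumes "\<Omega> \<in> sets lebesgue" "\<And>n. X n \<in> L2_on \<Omega>" "X \<longlonglongrightarrow> u"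
  shows "u \<in> L2_on \<Omega>"
proof -
  have "inner u v = 0" if "v \<in> L2_on (- \<Omega>)" for v
  proof -
    have "(\<lambda>n. inner (X n) v) \<longlonglongrightarrow> inner u v" by (intro tendsto_intros assms(3))
    moreover have "inner (X n) v = 0" for n using L2_on_orthogonal assms(2) that by blast
    ultimately show ?thesis using LIMSEQ_const_iff[of "0::real"] by simp
  qed
  then show ?thesis using L2_on_iff_orthogonal[OF assms(1)] by blast
qed

lemma set_integral_L2_on:
  assumes u: "u \<in> L2_on \<Omega>" and \<Omega>: "\<Omega> \<in> sets lebesgue" and [measurable]: "f \<in> borel_measurable lebesgue"
  shows "(LINT x:\<Omega>|lebesgue. rep_L2 u x * f x) = (LINT x|lebesgue. rep_L2 u x * f x)"
  unfolding set_lebesgue_integral_def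
proof (rule integral_cong_AE)
  show "AE x in lebesgue. indicat_real \<Omega> x *\<^sub>R (rep_L2 u x * f x) = rep_L2 u x * f x"
    using u unfolding L2_on_def mem_Collect_eq by eventually_elim (auto simp: indicator_def)
  show "(\<lambda>x. indicat_real \<Omega> x *\<^sub>R (rep_L2 u x * f x)) \<in> borel_measurable lebesgue"
    using \<Omega> by measurable
qed measurable

section \<open>Test functions\<close>

lemma partial_derivI: "(f has_derivative D) (at x) \<Longrightarrow> partial_deriv i f x = D i"
  unfolding partial_deriv_def by (simp add: frechet_derivative_at[symmetric])

lemma Ck_Suc_imp_Ck: "Ck (Suc k) f \<Longrightarrow> Ck k f"
proof (induction k arbitrary: f)
  case 0
  then show ?case
    by (auto intro!: continuous_at_imp_continuous_on differentiable_imp_continuous_within)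
qed (simp del: Ck.simps(2) add: Ck.simps(2)[of "Suc _"] Ck.simps(2)[of _ f for f])

lemma Ck_imp_continuous: "Ck k f \<Longrightarrow> continuous_on UNIV f"
  by (induction k) (auto dest: Ck_Suc_imp_Ck simp del: Ck.simps(2))

lemma partial_deriv_add:
  "f differentiable (at x) \<Longrightarrow> g differentiable (at x) \<Longrightarrow>
    partial_deriv i (\<lambda>x. f x + g x) x = partial_deriv i f x + partial_deriv i g x"
  unfolding frechet_derivative_works partial_deriv_def[of i f] partial_deriv_def[of i g]
  by (intro partial_derivI has_derivative_add)

lemma partial_deriv_mult:
  "f differentiable (at x) \<Longrightarrow> g differentiable (at x) \<Longrightarrow>
    partial_deriv i (\<lambda>x. f x * g x) x = f x * partial_deriv i g x + partial_deriv i f x * g x"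
  unfolding frechet_derivative_works partial_deriv_def[of i f] partial_deriv_def[of i g]
  by (rule partial_derivI has_derivative_mult)+

lemma partial_deriv_const: "partial_deriv i (\<lambda>x. c) x = 0"
  by (rule partial_derivI has_derivative_const)+

lemma Ck_const: "Ck k (\<lambda>x. c)"
proof (induction k arbitrary: c)
  case (Suc k)
  have "partial_deriv i (\<lambda>x. c) = (\<lambda>x. 0)" for i :: 'a and c
    by (rule ext) (rule partial_deriv_const)
  then show ?case using Suc by simp
qed simp

lemma Ck_add: "Ck k f \<Longrightarrow> Ck k g \<Longrightarrow> Ck k (\<lambda>x. f x + g x)"
proof (induction k arbitrary: f g)
  case (Suc k)
  have "partial_deriv i (\<lambda>x. f x + g x) = (\<lambda>x. partial_deriv i f x + partial_deriv i g x)" for i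
    using Suc.prems by (intro ext partial_deriv_add) auto
  then show ?case using Suc by simp
qed (auto intro: continuous_intros)

lemma Ck_mult: "Ck k f \<Longrightarrow> Ck k g \<Longrightarrow> Ck k (\<lambda>x. f x * g x)"
proof (induction k arbitrary: f g)
  case (Suc k)
  have "partial_deriv i (\<lambda>x. f x * g x) = (\<lambda>x. f x * partial_deriv i g x + partial_deriv i f x * g x)" for i
    using Suc.prems by (intro ext partial_deriv_mult) auto
  moreover have "Ck k f" "Ck k g" using Suc.prems Ck_Suc_imp_Ck by auto
  ultimately show ?case using Suc by (auto intro!: Ck_add)
qed (auto intro: continuous_intros)

lemma Ck_prod: "(\<And>i. i \<in> I \<Longrightarrow> Ck k (f i)) \<Longrightarrow> Ck k (\<lambda>x. \<Prod>i\<in>I. f i x)"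
  by (induction I rule: infinite_finite_induct) (auto intro: Ck_const Ck_mult)

text \<open>
  Here \<open>g (Suc n)\<close> is the derivative of \<open>g n\<close>, so that each \<open>g n\<close> is smooth; partial derivatives of a
  function of \<open>x \<bullet> v\<close> are again of this shape.
\<close>

lemma Ck_ridge:
  fixes g :: "nat \<Rightarrow> real \<Rightarrow> real" and v :: "'a::euclidean_space"
  assumes g: "\<And>n t. (g n has_real_derivative g (Suc n) t) (at t)"
  shows "Ck k (\<lambda>x. g n (c * (x \<bullet> v) + d))"
proof (induction k arbitrary: n)
  case 0
  have "continuous_on UNIV (g n)"
    using g by (auto intro!: continuous_at_imp_continuous_on DERIV_isCont)
  then have "continuous_on UNIV (\<lambda>x. g n (c * (x \<bullet> v) + d))"
    by (rule continuous_on_compose2) (auto intro!: continuous_intros)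
  then show ?case by simp
next
  case (Suc k)
  have deriv: "((\<lambda>x. g n (c * (x \<bullet> v) + d)) has_derivative
      (\<lambda>h. g (Suc n) (c * (x \<bullet> v) + d) * (c * (h \<bullet> v)))) (at x)" for x
    by (rule has_derivative_compose[of "\<lambda>x. c * (x \<bullet> v) + d", OF _ g[unfolded has_field_derivative_def]])
      (auto intro!: derivative_eq_intros)
  then have "partial_deriv i (\<lambda>x. g n (c * (x \<bullet> v) + d)) =
      (\<lambda>x. (c * (i \<bullet> v)) * g (Suc n) (c * (x \<bullet> v) + d))" for i
    by (intro ext) (simp add: partial_derivI[OF deriv] mult.commute)
  then show ?case
    using deriv Suc by (auto simp: differentiable_def intro!: Ck_mult Ck_const)
qed

subsection \<open>Compactly supported functions\<close>

lemma test_functionsD: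
  assumes "\<phi> \<in> test_functions \<Omega>"
  shows "Ck k \<phi>" "continuous_on UNIV \<phi>" "compact (closure {x. \<phi> x \<noteq> 0})"
    "x \<notin> \<Omega> \<Longrightarrow> \<phi> x = 0" "\<phi> differentiable (at x)"
proof -
  have Ck: "Ck k \<phi>" for k using assms by (simp add: test_functions_def)
  then show "Ck k \<phi>" .
  show "\<phi> differentiable (at x)" using Ck[of 1] by simp
  show "continuous_on UNIV \<phi>" using Ck by (rule Ck_imp_continuous)
  show "compact (closure {x. \<phi> x \<noteq> 0})" using assms by (simp add: test_functions_def)
  show "x \<notin> \<Omega> \<Longrightarrow> \<phi> x = 0"
    using assms closure_subset[of "{x. \<phi> x \<noteq> 0}"] by (auto simp: test_functions_def)
qed

lemma test_functionsI:
  assumes "\<And>k. Ck k \<phi>" "{x. \<phi> x \<noteq> 0} \<subseteq> C" "compact C" "C \<subseteq> \<Omega>"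
  shows "\<phi> \<in> test_functions \<Omega>"
proof -
  have "closure {x. \<phi> x \<noteq> 0} \<subseteq> C"
    using assms(2,3) by (intro closure_minimal compact_imp_closed)
  moreover from this have "compact (closure {x. \<phi> x \<noteq> 0})"
    using assms(3) by (metis closed_closure compact_Int_closed inf.absorb_iff2)
  ultimately show ?thesis using assms by (auto simp: test_functions_def)
qed

lemma test_functions_add:
  assumes "\<phi> \<in> test_functions \<Omega>" "\<psi> \<in> test_functions \<Omega>"
  shows "(\<lambda>x. \<phi> x + \<psi> x) \<in> test_functions \<Omega>"
proof (rule test_functionsI)
  have "{x. \<phi> x + \<psi> x \<noteq> 0} \<subseteq> {x. \<phi> x \<noteq> 0} \<union> {x. \<psi> x \<noteq> 0}" by auto
  then show "{x. \<phi> x + \<psi> x \<noteq> 0} \<subseteq> closure {x. \<phi> x \<noteq> 0} \<union> closure {x. \<psi> x \<noteq> 0}"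
    by (rule order_trans) (intro Un_mono closure_subset)
qed (use assms in \<open>auto simp: test_functions_def intro: Ck_add\<close>)

lemma test_functions_cmult:
  assumes "\<phi> \<in> test_functions \<Omega>"
  shows "(\<lambda>x. c * \<phi> x) \<in> test_functions \<Omega>"
  using assms closure_subset[of "{x. \<phi> x \<noteq> 0}"]
  by (intro test_functionsI[where C = "closure {x. \<phi> x \<noteq> 0}"] Ck_mult Ck_const)
    (auto simp: test_functions_def)

lemma test_functions_zero: "(\<lambda>x. 0) \<in> test_functions \<Omega>"
  by (intro test_functionsI[where C = "{}"]) (auto intro: Ck_const)

lemma test_functions_mult:
  assumes "\<phi> \<in> test_functions \<Omega>" "\<psi> \<in> test_functions \<Omega>"
  shows "(\<lambda>x. \<phi> x * \<psi> x) \<in> test_functions \<Omega>"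
  using assms closure_subset[of "{x. \<phi> x \<noteq> 0}"]
  by (intro test_functionsI[where C = "closure {x. \<phi> x \<noteq> 0}"] Ck_mult)
    (auto simp: test_functions_def)

lemma test_functions_partial_deriv:
  assumes \<phi>: "\<phi> \<in> test_functions \<Omega>" and i: "i \<in> Basis"
  shows "partial_deriv i \<phi> \<in> test_functions \<Omega>"
proof (rule test_functionsI)
  show "Ck k (partial_deriv i \<phi>)" for k
    using test_functionsD(1)[OF \<phi>, of "Suc k"] i by simp
  let ?C = "closure {x. \<phi> x \<noteq> 0}"
  show "compact ?C" by (rule test_functionsD(3)[OF \<phi>])
  show "?C \<subseteq> \<Omega>" using \<phi> by (simp add: test_functions_def)
  show "{x. partial_deriv i \<phi> x \<noteq> 0} \<subseteq> ?C"
  proof (rule subsetI, rule ccontr)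
    fix x assume x: "x \<in> {x. partial_deriv i \<phi> x \<noteq> 0}" "x \<notin> ?C"
    have "(\<phi> has_derivative (\<lambda>_. 0)) (at x)"
    proof (rule has_derivative_transform_within_open)
      show "((\<lambda>_. 0) has_derivative (\<lambda>_. 0)) (at x)" by (rule has_derivative_const)
      show "open (- ?C)" "x \<in> - ?C" using x by auto
      show "0 = \<phi> y" if "y \<in> - ?C" for y
        using that closure_subset[of "{x. \<phi> x \<noteq> 0}"] by auto
    qed
    then show False using x(1) partial_derivI by fastforce
  qed
qed

lemma compactly_supported_integrable:
  fixes f :: "'a::euclidean_space \<Rightarrow> real"
  assumes "continuous_on UNIV f" "compact (closure {x. f x \<noteq> 0})"
  shows "integrable lborel f" "integrable lebesgue f"
proof -
  let ?C = "closure {x. f x \<noteq> 0}"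
  have "integrable lborel (\<lambda>x. indicator ?C x *\<^sub>R f x)"
    using assms by (intro borel_integrable_compact) (auto intro: continuous_on_subset)
  moreover have "(\<lambda>x. indicator ?C x *\<^sub>R f x) = f"
    using closure_subset[of "{x. f x \<noteq> 0}"] by (intro ext) (auto simp: indicator_def)
  ultimately show "integrable lborel f" by (simp only:)
  then show "integrable lebesgue f"
    by (subst integrable_completion) auto
qed

lemma test_function_integrable:
  assumes "\<phi> \<in> test_functions \<Omega>"
  shows "integrable lborel \<phi>" "integrable lebesgue \<phi>"
  using compactly_supported_integrable[OF test_functionsD(2,3)[OF assms]] by auto

lemma test_function_measurable:
  assumes "\<phi> \<in> test_functions \<Omega>"
  shows "\<phi> \<in> borel_measurable borel" "\<phi> \<in> borel_measurable lebesgue"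
  using test_functionsD(2)[OF assms] test_function_integrable(2)[OF assms]
  by (auto intro: borel_measurable_continuous_onI)

lemma test_function_square_integrable:
  assumes "\<phi> \<in> test_functions \<Omega>"
  shows "square_integrable \<phi>"
  using test_function_integrable(2)[OF test_functions_mult[OF assms assms]]
    test_function_measurable(2)[OF assms]
  by (simp add: square_integrable_def power2_eq_square)

lemma test_function_bounded:
  assumes "\<phi> \<in> test_functions \<Omega>"
  obtains C where "0 < C" "\<And>x. \<bar>\<phi> x\<bar> \<le> C"
proof -
  let ?C = "closure {x. \<phi> x \<noteq> 0}"
  have "compact (\<phi> ` ?C)"
    using test_functionsD[OF assms] by (intro compact_continuous_image) (auto intro: continuous_on_subset)
  then obtain C where C: "0 < C" "\<forall>y\<in>\<phi> ` ?C. norm y \<le> C"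
    using compact_imp_bounded bounded_pos by metis
  have "\<bar>\<phi> x\<bar> \<le> C" for x
    using C closure_subset[of "{x. \<phi> x \<noteq> 0}"] by (cases "\<phi> x = 0") auto
  then show ?thesis using that C(1) by blast
qed

lemma abs_L2_test_in_L2_on:
  assumes "\<phi> \<in> test_functions \<Omega>"
  shows "abs_L2 \<phi> \<in> L2_on \<Omega>"
  using AE_rep_abs_L2[OF test_function_square_integrable[OF assms]] unfolding L2_on_def mem_Collect_eq
  by eventually_elim (use test_functionsD(4)[OF assms] in auto)

lemma frechet_derivative_partial:
  assumes "f differentiable (at x)"
  shows "frechet_derivative f (at x) z = (\<Sum>i\<in>Basis. (z \<bullet> i) * partial_deriv i f x)"
proof -
  have "linear (frechet_derivative f (at x))"
    using assms by (rule linear_frechet_derivative)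
  then show ?thesis
    using Linear_Algebra.linear_componentwise[of "frechet_derivative f (at x)" z 1]
    by (simp add: partial_deriv_def)
qed

lemma has_derivative_line:
  fixes f :: "'a::euclidean_space \<Rightarrow> real"
  assumes "\<And>x. f differentiable (at x)"
  shows "((\<lambda>t. f (x + t *\<^sub>R z)) has_real_derivative (\<Sum>i\<in>Basis. (z \<bullet> i) * partial_deriv i f (x + t *\<^sub>R z)))
    (at t within S)"
proof -
  have "((\<lambda>t. f (x + t *\<^sub>R z)) has_derivative
      (\<lambda>h. frechet_derivative f (at (x + t *\<^sub>R z)) (h *\<^sub>R z))) (at t within S)"
    by (rule has_derivative_compose[of "\<lambda>t. x + t *\<^sub>R z" "\<lambda>h. h *\<^sub>R z" t S f])
      (use assms in \<open>auto intro!: derivative_eq_intros simp: frechet_derivative_works[symmetric]\<close>)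
  moreover have "(\<lambda>h. frechet_derivative f (at (x + t *\<^sub>R z)) (h *\<^sub>R z)) =
      (*) (\<Sum>i\<in>Basis. (z \<bullet> i) * partial_deriv i f (x + t *\<^sub>R z))"
    by (rule ext) (simp add: frechet_derivative_partial[OF assms] sum_distrib_left sum_distrib_right mult_ac)
  ultimately show ?thesis by (simp add: has_field_derivative_def)
qed

lemma lborel_integral_translation:
  fixes f :: "'a::euclidean_space \<Rightarrow> real"
  assumes "f \<in> borel_measurable borel"
  shows "(LINT x|lborel. f (c + x)) = (LINT x|lborel. f x)"
  using integral_distr[of "(+) c" lborel borel f] assms lborel_distr_plus[of c] by simp

lemma lborel_nn_integral_translation:
  fixes f :: "'a::euclidean_space \<Rightarrow> ennreal"
  assumes "f \<in> borel_measurable borel"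
  shows "(\<integral>\<^sup>+x. f (c + x) \<partial>lborel) = (\<integral>\<^sup>+x. f x \<partial>lborel)"
  using nn_integral_distr[of "(+) c" lborel borel f] assms lborel_distr_plus[of c] by simp

text \<open>
  The difference quotients of \<open>\<phi>\<close> all have integral zero by translation invariance, and they
  converge to the partial derivative boundedly and within a fixed bounded set.
\<close>

lemma integral_partial_deriv_test:
  assumes \<phi>: "\<phi> \<in> test_functions \<Omega>" and i: "i \<in> Basis"
  shows "(LINT x|lebesgue. partial_deriv i \<phi> x) = 0"
proof -
  have d\<phi>: "partial_deriv i \<phi> \<in> test_functions \<Omega>" by (rule test_functions_partial_deriv[OF \<phi> i])
  obtain C where C: "0 < C" "\<And>x. \<bar>partial_deriv i \<phi> x\<bar> \<le> C"
    by (rule test_function_bounded[OF d\<phi>]) (rule that)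
  obtain R where R: "closure {x. \<phi> x \<noteq> 0} \<subseteq> cball 0 R"
    using bounded_subset_ballD[OF compact_imp_bounded[OF test_functionsD(3)[OF \<phi>]], of 0]
      ball_subset_cball by (metis order_trans)
  define t where "t n = 1 / real (Suc n)" for n
  have t: "0 < t n" "t n \<le> 1" for n by (auto simp: t_def)
  have t0: "t \<longlonglongrightarrow> 0" unfolding t_def by (rule LIMSEQ_Suc[OF lim_1_over_n])
  define q where "q n x = (\<phi> (t n *\<^sub>R i + x) - \<phi> x) / t n" for n x
  have [measurable]: "\<phi> \<in> borel_measurable borel" "partial_deriv i \<phi> \<in> borel_measurable borel"
    using test_function_measurable \<phi> d\<phi> by auto
  have line: "((\<lambda>s. \<phi> (x + s *\<^sub>R i)) has_real_derivative partial_deriv i \<phi> (x + s *\<^sub>R i)) (at s)" for x s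
  proof -
    have "(\<Sum>j\<in>Basis. (i \<bullet> j) * partial_deriv j \<phi> (x + s *\<^sub>R i)) = partial_deriv i \<phi> (x + s *\<^sub>R i)"
      using i by (simp add: inner_Basis if_distrib[of "\<lambda>a. a * _"] cong: if_cong)
    then show ?thesis using has_derivative_line[OF test_functionsD(5)[OF \<phi>], of x i s UNIV] by simp
  qed
  have q_bound: "norm (q n x) \<le> C * indicator (cball 0 (R + 1)) x" for n x
  proof (cases "x \<in> cball 0 (R + 1)")
    case True
    obtain s where "\<phi> (x + t n *\<^sub>R i) - \<phi> (x + 0 *\<^sub>R i) = (t n - 0) * partial_deriv i \<phi> (x + s *\<^sub>R i)"
      using MVT2[OF t(1)[of n], of "\<lambda>s. \<phi> (x + s *\<^sub>R i)" "\<lambda>s. partial_deriv i \<phi> (x + s *\<^sub>R i)"] line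
      by blast
    then have "q n x = partial_deriv i \<phi> (x + s *\<^sub>R i)"
      using t(1)[of n] by (simp add: q_def add.commute)
    then show ?thesis using C(2) True by simp
  next
    case False
    have "\<phi> y = 0" if "y \<notin> cball 0 R" for y
      using that R closure_subset[of "{x. \<phi> x \<noteq> 0}"] by auto
    moreover have "x \<notin> cball 0 R" using False by auto
    moreover have "t n *\<^sub>R i + x \<notin> cball 0 R"
    proof -
      have "norm x \<le> norm (t n *\<^sub>R i + x) + norm (t n *\<^sub>R i)"
        using norm_triangle_ineq4[of "t n *\<^sub>R i + x" "t n *\<^sub>R i"] by simp
      also have "norm (t n *\<^sub>R i) \<le> 1" using t[of n] i by simp
      finally show ?thesis using False by simp
    qed
    ultimately show ?thesis using C(1) by (simp add: q_def)
  qed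
  have "(\<lambda>n. LINT x|lborel. q n x) \<longlonglongrightarrow> (LINT x|lborel. partial_deriv i \<phi> x)"
  proof (rule integral_dominated_convergence[where w = "\<lambda>x. C * indicator (cball 0 (R + 1)) x"])
    show "integrable lborel (\<lambda>x::'a. C * indicator (cball 0 (R + 1)) x)"
      by (intro integrable_mult_right integrable_real_indicator) (auto intro: emeasure_bounded_finite[simplified])
    show "AE x in lborel. (\<lambda>n. q n x) \<longlonglongrightarrow> partial_deriv i \<phi> x"
    proof (rule AE_I2)
      fix x
      have "((\<lambda>h. (\<phi> (x + h *\<^sub>R i) - \<phi> x) / h) \<longlongrightarrow> partial_deriv i \<phi> x) (at 0)"
        using line[of x 0] by (simp add: DERIV_def)
      moreover have "filterlim t (at 0) sequentially"
        using t0 t(1) by (auto simp: filterlim_at intro!: always_eventually less_imp_neq[symmetric])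
      ultimately have "(\<lambda>n. (\<phi> (x + t n *\<^sub>R i) - \<phi> x) / t n) \<longlonglongrightarrow> partial_deriv i \<phi> x"
        by (rule filterlim_compose)
      then show "(\<lambda>n. q n x) \<longlonglongrightarrow> partial_deriv i \<phi> x" by (simp add: q_def add.commute)
    qed
    show "AE x in lborel. norm (q n x) \<le> C * indicator (cball 0 (R + 1)) x" for n
      using q_bound by (intro AE_I2)
    show "q n \<in> borel_measurable lborel" for n unfolding q_def by measurable
  qed measurable
  moreover have "(LINT x|lborel. q n x) = 0" for n
  proof -
    have int: "integrable lborel \<phi>" using test_function_integrable[OF \<phi>] by simp
    have int': "integrable lborel (\<lambda>x. \<phi> (t n *\<^sub>R i + x))"
      using int integrable_distr_eq[of "(+) (t n *\<^sub>R i)" lborel borel \<phi>] lborel_distr_plus[of "t n *\<^sub>R i"] by simp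
    have "(LINT x|lborel. q n x) = ((LINT x|lborel. \<phi> (t n *\<^sub>R i + x)) - (LINT x|lborel. \<phi> x)) / t n"
      unfolding q_def using int int' by simp
    then show ?thesis by (simp add: lborel_integral_translation)
  qed
  ultimately have "(LINT x|lborel. partial_deriv i \<phi> x) = 0"
    using LIMSEQ_const_iff[of "0::real"] by simp
  then show ?thesis by (subst integral_completion) auto
qed

lemma integration_by_parts_test:
  assumes \<phi>: "\<phi> \<in> test_functions \<Omega>" and \<psi>: "\<psi> \<in> test_functions \<Omega>" and i: "i \<in> Basis"
  shows "inner (abs_L2 \<phi>) (abs_L2 (partial_deriv i \<psi>)) = - inner (abs_L2 (partial_deriv i \<phi>)) (abs_L2 \<psi>)"
proof -
  note d = test_functions_partial_deriv[OF _ i]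
  note si = test_function_square_integrable
  have "partial_deriv i (\<lambda>x. \<phi> x * \<psi> x) = (\<lambda>x. \<phi> x * partial_deriv i \<psi> x + partial_deriv i \<phi> x * \<psi> x)"
    using test_functionsD(5)[OF \<phi>] test_functionsD(5)[OF \<psi>] by (intro ext partial_deriv_mult)
  then have "0 = (LINT x|lebesgue. \<phi> x * partial_deriv i \<psi> x + partial_deriv i \<phi> x * \<psi> x)"
    using integral_partial_deriv_test[OF test_functions_mult[OF \<phi> \<psi>] i] by simp
  also have "\<dots> = (LINT x|lebesgue. \<phi> x * partial_deriv i \<psi> x) + (LINT x|lebesgue. partial_deriv i \<phi> x * \<psi> x)"
    using square_integrable_mult[OF si[OF \<phi>] si[OF d[OF \<psi>]]] square_integrable_mult[OF si[OF d[OF \<phi>]] si[OF \<psi>]]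
    by (rule Bochner_Integration.integral_add)
  finally show ?thesis
    using inner_abs_L2[OF si[OF \<phi>] si[OF d[OF \<psi>]]] inner_abs_L2[OF si[OF d[OF \<phi>]] si[OF \<psi>]] by simp
qed

subsection \<open>Bump functions\<close>

text \<open>
  For \<open>p = 1\<close> this is the classical smooth function that is flat at \<open>0\<close>; polynomials \<open>p\<close> make the family
  closed under differentiation.
\<close>

definition flat :: "real poly \<Rightarrow> real \<Rightarrow> real" where
  "flat p t = (if t \<le> 0 then 0 else poly p (1 / t) * exp (- (1 / t)))"

definition flat_deriv :: "real poly \<Rightarrow> real poly" where
  "flat_deriv p = [:0, 0, 1:] * (p - pderiv p)"

lemma tendsto_poly_div_exp: "((\<lambda>y. y ^ k * poly p y / exp y) \<longlongrightarrow> (0::real)) at_top"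
proof (induction p arbitrary: k)
  case (pCons c p)
  have "((\<lambda>y::real. c * (y ^ k / exp y) + y ^ Suc k * poly p y / exp y) \<longlongrightarrow> c * 0 + 0) at_top"
    using tendsto_power_div_exp_0[of k] pCons.IH[of "Suc k"] by (intro tendsto_intros)
  then show ?case by (simp add: field_simps)
qed simp

lemma flat_has_derivative: "(flat p has_real_derivative flat (flat_deriv p) t) (at t)"
proof -
  consider "t < 0" | "t = 0" | "0 < t" by linarith
  then show ?thesis
  proof cases
    case 1
    have "((\<lambda>_. 0) has_real_derivative 0) (at t)" by simp
    then have "(flat p has_real_derivative 0) (at t)"
      by (rule has_field_derivative_transform_within_open[of _ _ _ "{..<0}"])
        (use 1 in \<open>auto simp: flat_def\<close>)
    then show ?thesis using 1 by (simp add: flat_def)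
  next
    case 3
    have "((\<lambda>t. poly p (1 / t) * exp (- (1 / t))) has_real_derivative flat (flat_deriv p) t) (at t)"
      using 3 by (auto intro!: derivative_eq_intros
          simp: flat_def flat_deriv_def power2_eq_square field_simps)
    then show ?thesis
      by (rule has_field_derivative_transform_within_open[of _ _ _ "{0<..}"])
        (use 3 in \<open>auto simp: flat_def\<close>)
  next
    case 2
    have "((\<lambda>h. (flat p (0 + h) - flat p 0) / h) \<longlongrightarrow> 0) (at 0)"
    proof (rule filterlim_split_at_real)
      show "((\<lambda>h. (flat p (0 + h) - flat p 0) / h) \<longlongrightarrow> 0) (at_left 0)"
        by (rule tendsto_eventually) (auto simp: eventually_at_filter flat_def)
      have "((\<lambda>h. inverse h ^ 1 * poly p (inverse h) / exp (inverse h)) \<longlongrightarrow> 0) (at_right 0)"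
        by (rule filterlim_compose[OF tendsto_poly_div_exp filterlim_inverse_at_top_right])
      then show "((\<lambda>h. (flat p (0 + h) - flat p 0) / h) \<longlongrightarrow> 0) (at_right 0)"
        by (rule Lim_transform_eventually)
          (auto simp: eventually_at_filter flat_def exp_minus field_simps)
    qed
    then show ?thesis using 2 by (simp add: DERIV_def flat_def)
  qed
qed

lemma flat_1: "flat 1 t = (if t \<le> 0 then 0 else exp (- (1 / t)))"
  by (simp add: flat_def)

lemma Ck_flat: "Ck k (\<lambda>x. flat 1 (c * (x \<bullet> v) + d))"
proof -
  have "\<And>n t. (flat ((flat_deriv ^^ n) 1) has_real_derivative flat ((flat_deriv ^^ Suc n) 1) t) (at t)"
    by (simp add: flat_has_derivative)
  from Ck_ridge[of "\<lambda>n. flat ((flat_deriv ^^ n) 1)", OF this, of k 0] show ?thesis by simp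
qed

text \<open>
  As \<open>n\<close> grows these functions approximate the indicator of the box: \<open>flat 1 (n * s)\<close> tends to \<open>1\<close>
  for \<open>s > 0\<close> and vanishes otherwise.
\<close>

definition bump :: "'a::euclidean_space \<Rightarrow> 'a \<Rightarrow> nat \<Rightarrow> 'a \<Rightarrow> real" where
  "bump l u n x = (\<Prod>i\<in>Basis. flat 1 (real (Suc n) * (x \<bullet> i - l \<bullet> i)) * flat 1 (real (Suc n) * (u \<bullet> i - x \<bullet> i)))"

lemma bump_test:
  assumes "cbox l u \<subseteq> \<Omega>"
  shows "bump l u n \<in> test_functions \<Omega>"
proof (rule test_functionsI[where C = "cbox l u"])
  show "Ck k (bump l u n)" for k
  proof -
    have "Ck k (\<lambda>x. flat 1 (real (Suc n) * (x \<bullet> i) + (- (real (Suc n) * (l \<bullet> i)))) *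
        flat 1 ((- real (Suc n)) * (x \<bullet> i) + real (Suc n) * (u \<bullet> i)))" for i :: 'a
      by (intro Ck_mult Ck_flat)
    then have "Ck k (\<lambda>x. flat 1 (real (Suc n) * (x \<bullet> i - l \<bullet> i)) * flat 1 (real (Suc n) * (u \<bullet> i - x \<bullet> i)))" for i :: 'a
      by (simp add: algebra_simps)
    then show ?thesis unfolding bump_def[abs_def] by (intro Ck_prod)
  qed
  show "{x. bump l u n x \<noteq> 0} \<subseteq> cbox l u"
    by (auto simp: bump_def flat_1 mem_box zero_less_mult_iff mult_le_0_iff not_le less_imp_le split: if_splits)
qed (use assms in auto)

lemma bump_nonneg: "0 \<le> bump l u n x" and bump_le_1: "bump l u n x \<le> 1"
proof -
  have "0 \<le> flat 1 t" "flat 1 t \<le> 1" for t by (auto simp: flat_1)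
  then show "0 \<le> bump l u n x" "bump l u n x \<le> 1"
    unfolding bump_def by (auto intro!: prod_nonneg prod_le_1 mult_le_one)
qed

lemma bump_tendsto: "(\<lambda>n. bump l u n x) \<longlonglongrightarrow> indicator (box l u) x"
proof -
  have flat: "(\<lambda>n. flat 1 (real (Suc n) * s)) \<longlonglongrightarrow> (if s \<le> 0 then 0 else 1)" for s
  proof (cases "s \<le> 0")
    case True
    then show ?thesis by (auto simp: flat_1 mult_le_0_iff zero_less_mult_iff)
  next
    case False
    have "(\<lambda>n. exp (- (1 / real (Suc n) * (1 / s)))) \<longlonglongrightarrow> exp (- (0 * (1 / s)))"
      by (intro tendsto_intros LIMSEQ_Suc[OF lim_1_over_n])
    then show ?thesis using False by (simp add: flat_1 mult_le_0_iff not_le)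
  qed
  have "(\<lambda>n. bump l u n x) \<longlonglongrightarrow>
      (\<Prod>i\<in>Basis. (if x \<bullet> i - l \<bullet> i \<le> 0 then 0 else 1) * (if u \<bullet> i - x \<bullet> i \<le> 0 then 0 else 1))"
    unfolding bump_def by (intro tendsto_prod tendsto_mult flat)
  also have "(\<Prod>i\<in>Basis. (if x \<bullet> i - l \<bullet> i \<le> 0 then 0 else 1) * (if u \<bullet> i - x \<bullet> i \<le> 0 then 0 else (1::real)))
      = indicator (box l u) x"
  proof (cases "x \<in> box l u")
    case True
    then show ?thesis by (intro trans[OF prod.neutral]) (auto simp: mem_box not_le)
  next
    case False
    then obtain i where "i \<in> Basis" "\<not> (l \<bullet> i < x \<bullet> i \<and> x \<bullet> i < u \<bullet> i)" by (auto simp: mem_box)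
    then show ?thesis using False by (intro trans[OF prod_zero]) (auto intro!: bexI[of _ i])
  qed
  finally show ?thesis .
qed

subsection \<open>The fundamental lemma of the calculus of variations\<close>

text \<open>
  An integrable function whose integral over every box vanishes is zero almost everywhere: boxes
  generate the Borel sets and are closed under intersection.
\<close>

lemma integral_boxes_zero_imp_AE_zero:
  fixes g :: "'a::euclidean_space \<Rightarrow> real"
  assumes g: "integrable lebesgue g" and whole: "(LINT x|lebesgue. g x) = 0"
    and boxes: "\<And>c d. (LINT x:box c d|lebesgue. g x) = 0"
  shows "AE x in lebesgue. g x = 0"
proof -
  obtain g' where [measurable]: "g' \<in> borel_measurable lborel" and gg': "AE x in lborel. g x = g' x"
    using completion_ex_borel_measurable_real[of g lborel] g by (auto dest: borel_measurable_integrable)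
  have gg'': "AE x in lebesgue. g x = g' x" using gg' by (rule AE_completion)
  have [measurable]: "g \<in> borel_measurable lebesgue" using g by auto
  have [measurable]: "g' \<in> borel_measurable lebesgue" by (rule measurable_completion) simp
  have int_leb: "integrable lebesgue g'" using g gg'' integrable_cong_AE[of g lebesgue g'] by simp
  then have int: "integrable lborel g'" by (subst (asm) integrable_completion) auto
  have set_eq: "(LINT x:A|lborel. g' x) = (LINT x:A|lebesgue. g x)" if "A \<in> sets borel" for A
  proof -
    have [measurable]: "A \<in> sets lebesgue" "A \<in> sets borel" using that by auto
    have "(LINT x:A|lebesgue. g x) = (LINT x:A|lebesgue. g' x)"
      unfolding set_lebesgue_integral_def using gg''
      by (intro integral_cong_AE) (auto elim: eventually_mono)
    also have "\<dots> = (LINT x:A|lborel. g' x)"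
      unfolding set_lebesgue_integral_def by (subst integral_completion) auto
    finally show ?thesis by simp
  qed
  have set_int: "set_integrable lborel A g'" if "A \<in> sets borel" for A
    using int that unfolding set_integrable_def by (intro integrable_mult_indicator) auto
  have zero: "(LINT x:A|lborel. g' x) = 0" if "A \<in> sets borel" for A
  proof -
    let ?G = "range (\<lambda>(a, b). box a b :: 'a set)"
    have borel: "sets borel = sigma_sets UNIV ?G"
      unfolding borel_eq_box by simp
    have "Int_stable ?G"
    proof (rule Int_stableI)
      fix S T :: "'a set" assume "S \<in> ?G" "T \<in> ?G"
      then obtain a b c d where "S = box a b" "T = box c d" by auto
      moreover obtain e f where "box a b \<inter> box c d = box e f"
        using box_Int_box[of a b c d] by blast
      ultimately show "S \<inter> T \<in> ?G" by (intro range_eqI[of _ _ "(e, f)"]) simp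
    qed
    moreover have "?G \<subseteq> Pow UNIV" by simp
    moreover have "A \<in> sigma_sets UNIV ?G" using that borel by simp
    ultimately show ?thesis
    proof (induction rule: sigma_sets_induct_disjoint)
      case (basic A)
      then obtain a b where "A = box a b" by auto
      then show ?case using set_eq[of A] boxes by simp
    next
      case empty
      show ?case by (simp add: set_lebesgue_integral_def)
    next
      case (compl A)
      then have A: "A \<in> sets borel" using borel by simp
      have "(LINT x:A \<union> (UNIV - A)|lborel. g' x) = (LINT x:A|lborel. g' x) + (LINT x:UNIV - A|lborel. g' x)"
        using A by (intro set_integral_Un set_int) auto
      moreover have "(LINT x:A \<union> (UNIV - A)|lborel. g' x) = 0"
        using set_eq[of UNIV] whole by (simp add: set_lebesgue_integral_def)
      ultimately show ?case using compl by simp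
    next
      case (union A)
      have A: "A i \<in> sets borel" for i using union(2) unfolding borel by blast
      then have "(\<Union>i. A i) \<in> sets borel" by (intro sets.countable_UN) auto
      with A union(1) have "(LINT x:(\<Union>i. A i)|lborel. g' x) = (\<Sum>i. (LINT x:(A i)|lborel. g' x))"
        by (intro lebesgue_integral_countable_add set_int) (auto simp: disjoint_family_on_def)
      then show ?case using union by simp
    qed
  qed
  have "AE x in lborel. g' x = 0"
    using zero by (intro density_unique_real[OF int]) (auto simp: set_lebesgue_integral_def)
  then have "AE x in lborel. g x = 0" using gg' by eventually_elim simp
  then show ?thesis by (rule AE_completion)
qed

text \<open>
  Bumps converge boundedly to indicators of boxes, so all integrals of \<open>u\<close> over boxes inside \<open>\<Omega>\<close> vanish, and
  countably many such boxes cover \<open>\<Omega>\<close>.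
\<close>

lemma test_functions_separate:
  fixes \<Omega> :: "'a::euclidean_space set"
  assumes \<Omega>: "open \<Omega>" and u: "u \<in> L2_on \<Omega>"
    and orth: "\<And>\<phi>. \<phi> \<in> test_functions \<Omega> \<Longrightarrow> inner u (abs_L2 \<phi>) = 0"
  shows "u = 0"
proof -
  have si_box: "square_integrable (indicator (cbox c d) :: 'a \<Rightarrow> real)" for c d
  proof -
    have "integrable lebesgue (\<lambda>x. indicator (cbox c d) x :: real)"
      by (intro integrable_real_indicator) (auto simp: emeasure_lborel_cbox_finite[simplified])
    moreover have "(\<lambda>x. (indicator (cbox c d) x :: real)\<^sup>2) = indicator (cbox c d)"
      by (auto simp: indicator_def)
    ultimately show ?thesis by (simp add: square_integrable_def)
  qed
  have int_cbox: "integrable lebesgue (\<lambda>x. rep_L2 u x * indicator (cbox c d) x)" for c d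
    by (rule square_integrable_mult[OF square_integrable_rep_L2 si_box])
  have box_zero: "(LINT x|lebesgue. rep_L2 u x * indicator (box c d) x) = 0" if "cbox c d \<subseteq> \<Omega>" for c d
  proof -
    have "(\<lambda>n. LINT x|lebesgue. rep_L2 u x * bump c d n x) \<longlonglongrightarrow>
        (LINT x|lebesgue. rep_L2 u x * indicator (box c d) x)"
    proof (rule integral_dominated_convergence[where w = "\<lambda>x. norm (rep_L2 u x * indicator (cbox c d) x)"])
      show "integrable lebesgue (\<lambda>x. norm (rep_L2 u x * indicator (cbox c d) x))"
        by (intro integrable_norm int_cbox)
      show "AE x in lebesgue. (\<lambda>n. rep_L2 u x * bump c d n x) \<longlonglongrightarrow> rep_L2 u x * indicator (box c d) x"
        by (intro AE_I2 tendsto_mult tendsto_const bump_tendsto)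
      show "AE x in lebesgue. norm (rep_L2 u x * bump c d n x) \<le> norm (rep_L2 u x * indicator (cbox c d) x)" for n
      proof (rule AE_I2)
        fix x
        have "\<bar>bump c d n x\<bar> \<le> indicator (cbox c d) x"
          using bump_nonneg[of c d n x] bump_le_1[of c d n x]
            test_functionsD(4)[OF bump_test[of c d "cbox c d" n], of x] by (cases "x \<in> cbox c d") auto
        then show "norm (rep_L2 u x * bump c d n x) \<le> norm (rep_L2 u x * indicator (cbox c d) x)"
          by (simp add: abs_mult mult_left_mono)
      qed
      show "(\<lambda>x. rep_L2 u x * bump c d n x) \<in> borel_measurable lebesgue" for n
        using test_function_measurable(2)[OF bump_test[OF that, of n]] by measurable
      show "(\<lambda>x. rep_L2 u x * indicator (box c d) x) \<in> borel_measurable lebesgue"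
        by (intro borel_measurable_times rep_L2_measurable borel_measurable_indicator) simp
    qed
    moreover have "(LINT x|lebesgue. rep_L2 u x * bump c d n x) = 0" for n
      using orth[OF bump_test[OF that, of n]]
      by (simp add: inner_L2_abs_right test_function_square_integrable[OF bump_test[OF that]])
    ultimately show ?thesis using LIMSEQ_const_iff[of "0::real"] by simp
  qed
  have AE_cbox: "AE x in lebesgue. x \<in> cbox l0 u0 \<longrightarrow> rep_L2 u x = 0" if sub: "cbox l0 u0 \<subseteq> \<Omega>" for l0 u0
  proof -
    define g where "g x = rep_L2 u x * indicator (box l0 u0) x" for x
    have "integrable lebesgue g"
    proof (rule Bochner_Integration.integrable_bound[OF int_cbox[of l0 u0]])
      show "AE x in lebesgue. norm (g x) \<le> norm (rep_L2 u x * indicator (cbox l0 u0) x)"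
        using box_subset_cbox[of l0 u0] by (intro AE_I2) (auto simp: g_def indicator_def)
      show "g \<in> borel_measurable lebesgue"
        unfolding g_def by (intro borel_measurable_times rep_L2_measurable borel_measurable_indicator) simp
    qed
    moreover have "(LINT x|lebesgue. g x) = 0" unfolding g_def by (rule box_zero[OF sub])
    moreover have "(LINT x:box c d|lebesgue. g x) = 0" for c d
    proof (cases "box c d \<inter> box l0 u0 = {}")
      case True
      then have "(\<lambda>x. indicat_real (box c d) x *\<^sub>R g x) = (\<lambda>x. 0)"
        by (intro ext) (auto simp: g_def indicator_def)
      then show ?thesis unfolding set_lebesgue_integral_def by (simp only: Bochner_Integration.integral_zero)
    next
      case False
      obtain c' d' where eq: "box c d \<inter> box l0 u0 = box c' d'"
        using box_Int_box[of c d l0 u0] by blast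
      have "cbox c' d' = closure (box c' d')" using False eq by (simp add: closure_box)
      also have "\<dots> \<subseteq> cbox l0 u0"
        using eq box_subset_cbox[of l0 u0] by (intro closure_minimal) auto
      finally have "(LINT x|lebesgue. rep_L2 u x * indicator (box c' d') x) = 0"
        using sub by (intro box_zero) auto
      moreover have "(\<lambda>x. indicat_real (box c d) x *\<^sub>R g x) = (\<lambda>x. rep_L2 u x * indicator (box c' d') x)"
        unfolding eq[symmetric] by (auto simp: g_def indicator_def)
      ultimately show ?thesis by (simp add: set_lebesgue_integral_def)
    qed
    ultimately have "AE x in lebesgue. g x = 0" by (rule integral_boxes_zero_imp_AE_zero)
    moreover have "AE x in lebesgue. x \<notin> cbox l0 u0 - box l0 u0"
      using null_sets_cbox_Diff_box[of l0 u0] by (intro AE_not_in null_sets_completionI)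
    ultimately show ?thesis by eventually_elim (auto simp: g_def indicator_def)
  qed
  obtain \<D> where D: "countable \<D>" "\<D> \<subseteq> Pow \<Omega>" "\<And>C. C \<in> \<D> \<Longrightarrow> \<exists>a b. C = cbox a b" "\<Union>\<D> = \<Omega>"
    using open_countable_Union_open_cbox[OF \<Omega>] by metis
  have "AE x in lebesgue. \<forall>C\<in>\<D>. x \<in> C \<longrightarrow> rep_L2 u x = 0"
    unfolding AE_ball_countable[OF D(1)]
  proof
    fix C assume C: "C \<in> \<D>"
    then obtain a b where "C = cbox a b" using D(3) by blast
    then show "AE x in lebesgue. x \<in> C \<longrightarrow> rep_L2 u x = 0" using AE_cbox[of a b] C D(2) by blast
  qed
  moreover have "AE x in lebesgue. x \<notin> \<Omega> \<longrightarrow> rep_L2 u x = 0" using u by (simp add: L2_on_def)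
  ultimately have "AE x in lebesgue. rep_L2 u x = rep_L2 0 x"
    using AE_rep_L2_zero by eventually_elim (use D(4) in auto)
  then show ?thesis by (rule L2_eqI)
qed

subsection \<open>Translations and the gradient\<close>

definition grad_energy :: "('a::euclidean_space \<Rightarrow> real) \<Rightarrow> real" where
  "grad_energy \<phi> = (\<Sum>i\<in>Basis. (norm (abs_L2 (partial_deriv i \<phi>)))\<^sup>2)"

text \<open>
  This is the Cauchy--Schwarz inequality against the indicator of \<open>S\<close>. It bounds squares of averages, both
  along segments and over cells, by averages of squares.
\<close>

lemma square_integral_le:
  fixes f :: "'a \<Rightarrow> real"
  assumes f: "integrable M f" and [measurable]: "S \<in> sets M" and "\<And>x. x \<notin> S \<Longrightarrow> f x = 0"
  shows "ennreal ((LINT x|M. f x)\<^sup>2) \<le> emeasure M S * (\<integral>\<^sup>+x. ennreal ((f x)\<^sup>2) \<partial>M)"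
proof -
  have [measurable]: "f \<in> borel_measurable M" using f by auto
  have "ennreal \<bar>LINT x|M. f x\<bar> \<le> (\<integral>\<^sup>+x. ennreal \<bar>f x\<bar> \<partial>M)"
    using integral_norm_bound_ennreal[OF f] by simp
  also have "\<dots> = (\<integral>\<^sup>+x. ennreal \<bar>f x\<bar> * indicator S x \<partial>M)"
    using assms(3) by (intro nn_integral_cong) (auto simp: indicator_def)
  finally have "(ennreal \<bar>LINT x|M. f x\<bar>)\<^sup>2 \<le> (\<integral>\<^sup>+x. ennreal \<bar>f x\<bar> * indicator S x \<partial>M)\<^sup>2"
    by (intro power_mono) auto
  also have "\<dots> \<le> (\<integral>\<^sup>+x. (ennreal \<bar>f x\<bar>)\<^sup>2 \<partial>M) * (\<integral>\<^sup>+x. (indicator S x)\<^sup>2 \<partial>M)"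
    by (intro Cauchy_Schwarz_nn_integral) measurable
  also have "(\<integral>\<^sup>+x. (indicator S x)\<^sup>2 \<partial>M) = (\<integral>\<^sup>+x. indicator S x \<partial>M)"
    by (intro nn_integral_cong) (auto simp: indicator_def)
  also have "\<dots> = emeasure M S" by simp
  finally show ?thesis by (simp add: ennreal_power mult.commute)
qed

lemma nn_integral_grad_square:
  assumes \<phi>: "\<phi> \<in> test_functions \<Omega>"
  shows "(\<integral>\<^sup>+x. ennreal (\<Sum>i\<in>Basis. (partial_deriv i \<phi> x)\<^sup>2) \<partial>lborel) = ennreal (grad_energy \<phi>)"
proof -
  note d = test_functions_partial_deriv[OF \<phi>]
  have [measurable]: "partial_deriv i \<phi> \<in> borel_measurable borel" if "i \<in> Basis" for i
    using test_function_measurable(1)[OF d[OF that]] .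
  have "(\<integral>\<^sup>+x. ennreal ((partial_deriv i \<phi> x)\<^sup>2) \<partial>lborel) = ennreal ((norm (abs_L2 (partial_deriv i \<phi>)))\<^sup>2)"
    if i: "i \<in> Basis" for i
  proof -
    have si: "square_integrable (partial_deriv i \<phi>)" by (rule test_function_square_integrable[OF d[OF i]])
    have "(\<integral>\<^sup>+x. ennreal ((partial_deriv i \<phi> x)\<^sup>2) \<partial>lborel) = (\<integral>\<^sup>+x. ennreal ((partial_deriv i \<phi> x)\<^sup>2) \<partial>lebesgue)"
      by (simp add: nn_integral_completion)
    also have "\<dots> = ennreal ((norm (abs_L2 (partial_deriv i \<phi>)))\<^sup>2)"
      unfolding norm_abs_L2_square[OF si]
      using si by (intro nn_integral_eq_integral) (auto simp: square_integrable_def)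
    finally show ?thesis .
  qed
  then show ?thesis
    unfolding grad_energy_def
    by (subst sum_ennreal[symmetric], simp, subst nn_integral_sum) (auto simp: sum_ennreal)
qed

lemma grad_energy_nonneg: "0 \<le> grad_energy \<phi>"
  by (auto simp: grad_energy_def intro: sum_nonneg)

text \<open>
  Both the Poincare inequality and compactness come from this bound for translations: along the
  segment from \<open>x\<close> to \<open>z + x\<close> the increment of \<open>\<phi>\<close> is the integral of the derivative.
\<close>

lemma translation_estimate:
  fixes \<Omega> :: "'a::euclidean_space set"
  assumes \<phi>: "\<phi> \<in> test_functions \<Omega>"
  shows "(\<integral>\<^sup>+x. ennreal ((\<phi> (z + x) - \<phi> x)\<^sup>2) \<partial>lborel) \<le> ennreal ((norm z)\<^sup>2 * grad_energy \<phi>)"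
proof -
  define G where "G x = (\<Sum>i\<in>Basis. (partial_deriv i \<phi> x)\<^sup>2)" for x
  have cont: "continuous_on UNIV (partial_deriv i \<phi>)" if "i \<in> Basis" for i
    by (rule test_functionsD(2)[OF test_functions_partial_deriv[OF \<phi> that]])
  have G_cont: "continuous_on UNIV G"
    unfolding G_def by (intro continuous_intros cont)
  then have [measurable]: "G \<in> borel_measurable borel" by (rule borel_measurable_continuous_onI)
  have [measurable]: "\<phi> \<in> borel_measurable borel" by (rule test_function_measurable(1)[OF \<phi>])
  define D where "D x t = (\<Sum>i\<in>Basis. (z \<bullet> i) * partial_deriv i \<phi> (x + t *\<^sub>R z))" for x t
  have D_cont: "continuous_on UNIV (D x)" for x
    unfolding D_def
    by (intro continuous_intros continuous_on_compose2[OF cont]) auto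
  have D_square: "(D x t)\<^sup>2 \<le> (norm z)\<^sup>2 * G (x + t *\<^sub>R z)" for x t
  proof -
    have "(D x t)\<^sup>2 \<le> (\<Sum>i\<in>Basis. (z \<bullet> i)\<^sup>2) * G (x + t *\<^sub>R z)"
      unfolding D_def G_def by (rule Cauchy_Schwarz_ineq_sum)
    also have "(\<Sum>i\<in>Basis. (z \<bullet> i)\<^sup>2) = (norm z)\<^sup>2"
      unfolding power2_norm_eq_inner euclidean_inner[of z z] by (simp add: power2_eq_square)
    finally show ?thesis .
  qed
  have pointwise: "ennreal ((\<phi> (z + x) - \<phi> x)\<^sup>2)
      \<le> (\<integral>\<^sup>+t. ennreal ((norm z)\<^sup>2 * G (x + t *\<^sub>R z)) * indicator {0..1} t \<partial>lborel)" for x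
  proof -
    have vd: "((\<lambda>t. \<phi> (x + t *\<^sub>R z)) has_vector_derivative D x t) (at t within {0..1})" for t
      unfolding D_def has_real_derivative_iff_has_vector_derivative[symmetric]
      by (rule has_derivative_line[OF test_functionsD(5)[OF \<phi>]])
    have bi: "has_bochner_integral lborel (\<lambda>t. indicator {0..1} t *\<^sub>R D x t)
        (\<phi> (x + 1 *\<^sub>R z) - \<phi> (x + 0 *\<^sub>R z))"
      by (rule has_bochner_integral_FTC_Icc[OF zero_le_one vd]) (auto intro: continuous_on_subset[OF D_cont])
    have "ennreal ((LINT t|lborel. indicator {0..1} t *\<^sub>R D x t)\<^sup>2)
        \<le> emeasure lborel {0..1::real} * (\<integral>\<^sup>+t. ennreal ((indicator {0..1} t *\<^sub>R D x t)\<^sup>2) \<partial>lborel)"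
      using bi by (intro square_integral_le) (auto simp: has_bochner_integral_iff)
    also have "\<dots> = (\<integral>\<^sup>+t. ennreal ((indicator {0..1} t *\<^sub>R D x t)\<^sup>2) \<partial>lborel)" by simp
    also have "\<dots> \<le> (\<integral>\<^sup>+t. ennreal ((norm z)\<^sup>2 * G (x + t *\<^sub>R z)) * indicator {0..1} t \<partial>lborel)"
      using D_square by (intro nn_integral_mono) (auto simp: indicator_def intro: ennreal_leI)
    finally show ?thesis using bi by (simp add: has_bochner_integral_iff add.commute)
  qed
  have "(\<integral>\<^sup>+x. ennreal ((\<phi> (z + x) - \<phi> x)\<^sup>2) \<partial>lborel)
      \<le> (\<integral>\<^sup>+x. (\<integral>\<^sup>+t. ennreal ((norm z)\<^sup>2 * G (x + t *\<^sub>R z)) * indicator {0..1} t \<partial>lborel) \<partial>lborel)"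
    by (intro nn_integral_mono pointwise)
  also have "\<dots> = (\<integral>\<^sup>+t. (\<integral>\<^sup>+x. ennreal ((norm z)\<^sup>2 * G (x + t *\<^sub>R z)) * indicator {0..1} t \<partial>lborel) \<partial>lborel)"
    by (rule lborel_pair.Fubini'[symmetric]) measurable
  also have "\<dots> = (\<integral>\<^sup>+t. ennreal ((norm z)\<^sup>2 * grad_energy \<phi>) * indicator {0..1::real} t \<partial>lborel)"
  proof (rule nn_integral_cong)
    fix t :: real
    have "(\<integral>\<^sup>+x. ennreal ((norm z)\<^sup>2 * G (x + t *\<^sub>R z)) * indicator {0..1} t \<partial>lborel)
        = (\<integral>\<^sup>+x. ennreal ((norm z)\<^sup>2 * G (t *\<^sub>R z + x)) \<partial>lborel) * indicator {0..1} t"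
      by (subst nn_integral_multc) (auto simp: add.commute)
    also have "(\<integral>\<^sup>+x. ennreal ((norm z)\<^sup>2 * G (t *\<^sub>R z + x)) \<partial>lborel)
        = (\<integral>\<^sup>+x. ennreal ((norm z)\<^sup>2 * G x) \<partial>lborel)"
      by (rule lborel_nn_integral_translation) measurable
    also have "\<dots> = ennreal ((norm z)\<^sup>2) * (\<integral>\<^sup>+x. ennreal (G x) \<partial>lborel)"
    proof (subst nn_integral_cmult[symmetric])
      have "0 \<le> G x" for x by (auto simp: G_def intro: sum_nonneg)
      then show "(\<integral>\<^sup>+x. ennreal ((norm z)\<^sup>2 * G x) \<partial>lborel) = (\<integral>\<^sup>+x. ennreal ((norm z)\<^sup>2) * ennreal (G x) \<partial>lborel)"
        by (simp add: ennreal_mult)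
    qed measurable
    also have "\<dots> = ennreal ((norm z)\<^sup>2 * grad_energy \<phi>)"
      using nn_integral_grad_square[OF \<phi>] grad_energy_nonneg[of \<phi>] by (simp add: G_def ennreal_mult)
    finally show "(\<integral>\<^sup>+x. ennreal ((norm z)\<^sup>2 * G (x + t *\<^sub>R z)) * indicator {0..1} t \<partial>lborel)
        = ennreal ((norm z)\<^sup>2 * grad_energy \<phi>) * indicator {0..1} t" .
  qed
  also have "\<dots> = ennreal ((norm z)\<^sup>2 * grad_energy \<phi>)"
    by (subst nn_integral_cmult) auto
  finally show ?thesis .
qed

text \<open>A translation by more than the diameter makes the supports disjoint.\<close>

lemma Poincare_test:
  fixes \<Omega> :: "'a::euclidean_space set"
  assumes "bounded \<Omega>"
  obtains C where "0 < C" "\<And>\<phi>. \<phi> \<in> test_functions \<Omega> \<Longrightarrow> norm (abs_L2 \<phi>) \<le> C * sqrt (grad_energy \<phi>)"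
proof -
  obtain R where R: "0 < R" "\<And>x. x \<in> \<Omega> \<Longrightarrow> norm x \<le> R" using assms bounded_pos by metis
  obtain e :: 'a where e: "e \<in> Basis" using nonempty_Basis by blast
  \<comment> \<open>The domain has diameter at most \<open>2 * R\<close>.\<close>
  define z where "z = (3 * R) *\<^sub>R e"
  have nz: "norm z = 3 * R" using e R(1) by (simp add: z_def)
  have "norm (abs_L2 \<phi>) \<le> 3 * R * sqrt (grad_energy \<phi>)" if \<phi>: "\<phi> \<in> test_functions \<Omega>" for \<phi>
  proof (rule norm_abs_L2_le(2))
    show "\<phi> \<in> borel_measurable lebesgue" by (rule test_function_measurable(2)[OF \<phi>])
    show "0 \<le> 3 * R * sqrt (grad_energy \<phi>)" using R(1) grad_energy_nonneg[of \<phi>] by simp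
    have "(\<integral>\<^sup>+x. ennreal ((\<phi> x)\<^sup>2) \<partial>lebesgue) = (\<integral>\<^sup>+x. ennreal ((\<phi> x)\<^sup>2) \<partial>lborel)"
      by (simp add: nn_integral_completion)
    also have "\<dots> \<le> (\<integral>\<^sup>+x. ennreal ((\<phi> (z + x) - \<phi> x)\<^sup>2) \<partial>lborel)"
    proof (intro nn_integral_mono ennreal_leI)
      fix x
      show "(\<phi> x)\<^sup>2 \<le> (\<phi> (z + x) - \<phi> x)\<^sup>2"
      proof (cases "x \<in> \<Omega>")
        case True
        have "norm z \<le> norm (z + x) + norm x" using norm_triangle_ineq4[of "z + x" x] by simp
        then have "z + x \<notin> \<Omega>" using R(2)[OF True] R(2)[of "z + x"] nz R(1) by auto
        then show ?thesis using test_functionsD(4)[OF \<phi>] by simp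
      qed (use test_functionsD(4)[OF \<phi>] in simp)
    qed
    also have "\<dots> \<le> ennreal ((norm z)\<^sup>2 * grad_energy \<phi>)" by (rule translation_estimate[OF \<phi>])
    also have "(norm z)\<^sup>2 * grad_energy \<phi> = (3 * R * sqrt (grad_energy \<phi>))\<^sup>2"
      using grad_energy_nonneg[of \<phi>] by (simp add: nz power_mult_distrib)
    finally show "(\<integral>\<^sup>+x. ennreal ((\<phi> x)\<^sup>2) \<partial>lebesgue) \<le> ennreal ((3 * R * sqrt (grad_energy \<phi>))\<^sup>2)" .
  qed
  then show ?thesis using that[of "3 * R"] R(1) by auto
qed

subsection \<open>Averages over cells\<close>

text \<open>The corner of the cube with side \<open>s\<close> that contains \<open>x\<close>, in units of \<open>s\<close>.\<close>

definition grid :: "real \<Rightarrow> 'a::euclidean_space \<Rightarrow> 'a" where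
  "grid s x = (\<Sum>i\<in>Basis. of_int \<lfloor>x \<bullet> i / s\<rfloor> *\<^sub>R i)"

lemma grid_inner: "i \<in> Basis \<Longrightarrow> grid s x \<bullet> i = of_int \<lfloor>x \<bullet> i / s\<rfloor>"
  by (simp add: grid_def)

lemma grid_measurable [measurable]: "grid s \<in> borel_measurable borel"
  unfolding grid_def by measurable

lemma grid_eq_bounds:
  fixes s :: real
  assumes s: "0 < s" and eq: "grid s y = grid s x" and i: "i \<in> Basis"
  shows "s * (grid s x \<bullet> i) \<le> y \<bullet> i" "y \<bullet> i \<le> s * (grid s x \<bullet> i) + s"
proof -
  have k: "grid s x \<bullet> i = of_int \<lfloor>y \<bullet> i / s\<rfloor>" using eq grid_inner[OF i, of s y] by simp
  have "s * of_int \<lfloor>y \<bullet> i / s\<rfloor> \<le> s * (y \<bullet> i / s)" "s * (y \<bullet> i / s) \<le> s * (of_int \<lfloor>y \<bullet> i / s\<rfloor> + 1)"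
    using s floor_correct[of "y \<bullet> i / s"] by (intro mult_left_mono; linarith)+
  then show "s * (grid s x \<bullet> i) \<le> y \<bullet> i" "y \<bullet> i \<le> s * (grid s x \<bullet> i) + s"
    using s unfolding k by (simp_all add: distrib_left)
qed

lemma emeasure_cell:
  fixes x :: "'a::euclidean_space" and s :: real
  assumes s: "0 < s"
  shows "emeasure lborel {y. grid s y = grid s x} = ennreal (s ^ DIM('a))"
proof (rule antisym)
  let ?l = "s *\<^sub>R grid s x" and ?u = "s *\<^sub>R grid s x + s *\<^sub>R One"
  have prod: "(\<Prod>i\<in>Basis. (?u - ?l) \<bullet> i) = s ^ DIM('a)"
    by simp
  have le: "?l \<bullet> i \<le> ?u \<bullet> i" if "i \<in> Basis" for i using s that by (simp add: inner_add_left)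
  have "{y. grid s y = grid s x} \<subseteq> cbox ?l ?u"
    using grid_eq_bounds[OF s] by (auto simp: mem_box inner_add_left)
  then have "emeasure lborel {y. grid s y = grid s x} \<le> emeasure lborel (cbox ?l ?u)"
    by (intro emeasure_mono) auto
  also have "\<dots> = ennreal (s ^ DIM('a))" using le prod by (subst emeasure_lborel_cbox) auto
  finally show "emeasure lborel {y. grid s y = grid s x} \<le> ennreal (s ^ DIM('a))" .
  have "grid s y = grid s x" if y: "y \<in> box ?l ?u" for y
  proof (rule euclidean_eqI)
    fix i :: 'a assume i: "i \<in> Basis"
    have "s * (grid s x \<bullet> i) < y \<bullet> i" "y \<bullet> i < s * (grid s x \<bullet> i) + s"
      using y i by (auto simp: mem_box inner_add_left)
    then have "\<lfloor>y \<bullet> i / s\<rfloor> = \<lfloor>x \<bullet> i / s\<rfloor>"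
      using s grid_inner[OF i, of s x] by (intro floor_unique) (auto simp: field_simps)
    then show "grid s y \<bullet> i = grid s x \<bullet> i" using grid_inner[OF i] by metis
  qed
  then have "box ?l ?u \<subseteq> {y. grid s y = grid s x}" by blast
  then have "emeasure lborel (box ?l ?u) \<le> emeasure lborel {y. grid s y = grid s x}"
    by (intro emeasure_mono) auto
  moreover have "emeasure lborel (box ?l ?u) = ennreal (s ^ DIM('a))"
    using le prod by (subst emeasure_lborel_box) auto
  ultimately show "ennreal (s ^ DIM('a)) \<le> emeasure lborel {y. grid s y = grid s x}" by simp
qed

lemma finite_grid_image:
  fixes \<Omega> :: "'a::euclidean_space set" and s :: real
  assumes s: "0 < s" and "bounded \<Omega>"
  shows "finite (grid s ` \<Omega>)"
proof -
  obtain R where R: "0 < R" "\<And>x. x \<in> \<Omega> \<Longrightarrow> norm x \<le> R" using assms(2) bounded_pos by metis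
  define J where "J = {\<lfloor>- (R / s)\<rfloor>..\<lfloor>R / s\<rfloor>}"
  have "grid s ` \<Omega> \<subseteq> (\<lambda>k. \<Sum>i\<in>Basis. of_int (k i) *\<^sub>R i) ` (Basis \<rightarrow>\<^sub>E J)"
  proof
    fix c assume "c \<in> grid s ` \<Omega>"
    then obtain x where x: "x \<in> \<Omega>" "c = grid s x" by blast
    have "\<lfloor>x \<bullet> i / s\<rfloor> \<in> J" if i: "i \<in> Basis" for i
    proof -
      have "\<bar>x \<bullet> i\<bar> \<le> R" using Basis_le_norm[OF i, of x] R(2)[OF x(1)] by linarith
      then have "- (R / s) \<le> x \<bullet> i / s" "x \<bullet> i / s \<le> R / s"
        using s by (auto simp: field_simps abs_le_iff)
      then show ?thesis unfolding J_def by (auto intro: floor_mono)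
    qed
    then show "c \<in> (\<lambda>k. \<Sum>i\<in>Basis. of_int (k i) *\<^sub>R i) ` (Basis \<rightarrow>\<^sub>E J)"
      using x(2) by (intro image_eqI[of _ _ "\<lambda>i\<in>Basis. \<lfloor>x \<bullet> i / s\<rfloor>"]) (auto simp: grid_def)
  qed
  moreover have "finite (Basis \<rightarrow>\<^sub>E J :: ('a \<Rightarrow> int) set)" by (intro finite_PiE) (auto simp: J_def)
  ultimately show ?thesis by (auto intro: finite_surj)
qed

definition cell_average :: "real \<Rightarrow> ('a::euclidean_space \<Rightarrow> real) \<Rightarrow> 'a \<Rightarrow> real" where
  "cell_average s \<phi> c = (LINT y|lborel. indicator {y. grid s y = c} y * \<phi> y) / s ^ DIM('a)"

text \<open>
  The deviation from the average over a cell is an average of increments of \<open>\<phi>\<close> over translations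
  that are not longer than the diameter of a cell.
\<close>

lemma cell_average_deviation:
  fixes \<Omega> :: "'a::euclidean_space set" and s :: real
  assumes \<phi>: "\<phi> \<in> test_functions \<Omega>" and s: "0 < s"
  shows "(\<integral>\<^sup>+x. ennreal ((\<phi> x - cell_average s \<phi> (grid s x))\<^sup>2) \<partial>lborel)
    \<le> ennreal (2 ^ DIM('a) * DIM('a) * s\<^sup>2 * grad_energy \<phi>)"
proof -
  define m where "m = s ^ DIM('a)"
  have m: "0 < m" using s by (simp add: m_def)
  define Q where "Q x = {y. grid s y = grid s x}" for x :: 'a
  have [measurable]: "Q x \<in> sets borel" for x unfolding Q_def by measurable
  have [measurable]: "\<phi> \<in> borel_measurable borel" by (rule test_function_measurable(1)[OF \<phi>])
  have emQ: "emeasure lborel (Q x) = ennreal m" for x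
    unfolding Q_def m_def by (rule emeasure_cell[OF s])
  define C where "C = cbox (- s *\<^sub>R One) (s *\<^sub>R One :: 'a)"
  have [measurable]: "C \<in> sets borel" by (simp add: C_def)
  have emC: "emeasure lborel C = ennreal ((2 * s) ^ DIM('a))"
  proof -
    have "(\<Prod>i\<in>Basis. (s *\<^sub>R One - - s *\<^sub>R One :: 'a) \<bullet> i) = (\<Prod>i\<in>(Basis :: 'a set). 2 * s)"
      by (intro prod.cong) (auto simp: inner_diff_left inner_add_left)
    then show ?thesis
      unfolding C_def using s by (subst emeasure_lborel_cbox) (auto simp del: diff_minus_eq_add minus_diff_eq)
  qed
  have pointwise: "ennreal ((\<phi> x - cell_average s \<phi> (grid s x))\<^sup>2)
      \<le> ennreal (1 / m) * (\<integral>\<^sup>+z. ennreal ((\<phi> (z + x) - \<phi> x)\<^sup>2) * indicator C z \<partial>lborel)" for x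
  proof -
    have iQ: "integrable lborel (indicat_real (Q x))"
      using emQ by (intro integrable_real_indicator) auto
    have iQ\<phi>: "integrable lborel (\<lambda>y. indicat_real (Q x) y * \<phi> y)"
      using integrable_mult_indicator[of "Q x" lborel \<phi>] test_function_integrable(1)[OF \<phi>] by simp
    have i: "integrable lborel (\<lambda>y. indicat_real (Q x) y * (\<phi> x - \<phi> y))"
      using Bochner_Integration.integrable_diff[OF integrable_mult_left[OF iQ, of "\<phi> x"] iQ\<phi>]
      by (simp add: right_diff_distrib)
    have "(LINT y|lborel. indicat_real (Q x) y * (\<phi> x - \<phi> y))
        = (LINT y|lborel. indicat_real (Q x) y * \<phi> x - indicat_real (Q x) y * \<phi> y)"
      by (simp add: right_diff_distrib)
    also have "\<dots> = m * \<phi> x - (LINT y|lborel. indicat_real (Q x) y * \<phi> y)"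
      using iQ iQ\<phi> emQ[of x] m by (simp add: measure_def)
    finally have eq: "\<phi> x - cell_average s \<phi> (grid s x)
        = (LINT y|lborel. indicat_real (Q x) y * (\<phi> x - \<phi> y)) / m"
      using m unfolding cell_average_def m_def[symmetric] Q_def[symmetric] by (simp add: field_simps)
    have "ennreal ((\<phi> x - cell_average s \<phi> (grid s x))\<^sup>2)
        = ennreal (1 / m\<^sup>2) * ennreal ((LINT y|lborel. indicat_real (Q x) y * (\<phi> x - \<phi> y))\<^sup>2)"
      unfolding eq using m by (simp add: ennreal_mult[symmetric] power_divide)
    also have "\<dots> \<le> ennreal (1 / m\<^sup>2) * (emeasure lborel (Q x) *
        (\<integral>\<^sup>+y. ennreal ((indicat_real (Q x) y * (\<phi> x - \<phi> y))\<^sup>2) \<partial>lborel))"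
      by (intro mult_left_mono square_integral_le i) (auto simp: indicator_def)
    also have "\<dots> = ennreal (1 / m) * (\<integral>\<^sup>+y. ennreal ((indicat_real (Q x) y * (\<phi> x - \<phi> y))\<^sup>2) \<partial>lborel)"
      unfolding emQ mult.assoc[symmetric] using m
      by (simp add: ennreal_mult[symmetric] power2_eq_square)
    also have "(\<integral>\<^sup>+y. ennreal ((indicat_real (Q x) y * (\<phi> x - \<phi> y))\<^sup>2) \<partial>lborel)
        = (\<integral>\<^sup>+z. ennreal ((indicat_real (Q x) (x + z) * (\<phi> x - \<phi> (x + z)))\<^sup>2) \<partial>lborel)"
      by (rule lborel_nn_integral_translation[symmetric]) measurable
    also have "\<dots> \<le> (\<integral>\<^sup>+z. ennreal ((\<phi> (z + x) - \<phi> x)\<^sup>2) * indicator C z \<partial>lborel)"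
    proof (rule nn_integral_mono)
      fix z
      have "z \<in> C" if "x + z \<in> Q x"
      proof -
        have "- s \<le> z \<bullet> i \<and> z \<bullet> i \<le> s" if i: "i \<in> Basis" for i
          using grid_eq_bounds[OF s _ i, of "x + z" x] grid_eq_bounds[OF s _ i, of x x] \<open>x + z \<in> Q x\<close>
          by (auto simp: Q_def inner_add_left)
        then show ?thesis by (auto simp: C_def mem_box)
      qed
      then show "ennreal ((indicat_real (Q x) (x + z) * (\<phi> x - \<phi> (x + z)))\<^sup>2)
          \<le> ennreal ((\<phi> (z + x) - \<phi> x)\<^sup>2) * indicator C z"
        by (auto simp: indicator_def add.commute power2_commute)
    qed
    finally show ?thesis by (simp add: mult_left_mono)
  qed
  have z_bound: "(norm z)\<^sup>2 \<le> DIM('a) * s\<^sup>2" if "z \<in> C" for z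
  proof -
    have "(norm z)\<^sup>2 = (\<Sum>i\<in>Basis. (z \<bullet> i)\<^sup>2)"
      unfolding power2_norm_eq_inner euclidean_inner[of z z] by (simp add: power2_eq_square)
    also have "\<dots> \<le> (\<Sum>i\<in>(Basis :: 'a set). s\<^sup>2)"
      using that by (intro sum_mono) (auto simp: C_def mem_box abs_le_square_iff[symmetric] abs_le_iff)
    finally show ?thesis by simp
  qed
  have "(\<integral>\<^sup>+x. ennreal ((\<phi> x - cell_average s \<phi> (grid s x))\<^sup>2) \<partial>lborel)
      \<le> (\<integral>\<^sup>+x. ennreal (1 / m) * (\<integral>\<^sup>+z. ennreal ((\<phi> (z + x) - \<phi> x)\<^sup>2) * indicator C z \<partial>lborel) \<partial>lborel)"
    by (intro nn_integral_mono pointwise)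
  also have "\<dots> = ennreal (1 / m) * (\<integral>\<^sup>+x. (\<integral>\<^sup>+z. ennreal ((\<phi> (z + x) - \<phi> x)\<^sup>2) * indicator C z \<partial>lborel) \<partial>lborel)"
    by (rule nn_integral_cmult) measurable
  also have "(\<integral>\<^sup>+x. (\<integral>\<^sup>+z. ennreal ((\<phi> (z + x) - \<phi> x)\<^sup>2) * indicator C z \<partial>lborel) \<partial>lborel)
      = (\<integral>\<^sup>+z. (\<integral>\<^sup>+x. ennreal ((\<phi> (z + x) - \<phi> x)\<^sup>2) * indicator C z \<partial>lborel) \<partial>lborel)"
    by (rule lborel_pair.Fubini'[symmetric]) measurable
  also have "\<dots> \<le> (\<integral>\<^sup>+z. ennreal (DIM('a) * s\<^sup>2 * grad_energy \<phi>) * indicator C z \<partial>lborel)"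
  proof (rule nn_integral_mono)
    fix z
    have "(\<integral>\<^sup>+x. ennreal ((\<phi> (z + x) - \<phi> x)\<^sup>2) * indicator C z \<partial>lborel)
        = (\<integral>\<^sup>+x. ennreal ((\<phi> (z + x) - \<phi> x)\<^sup>2) \<partial>lborel) * indicator C z"
      by (rule nn_integral_multc) measurable
    also have "\<dots> \<le> ennreal ((norm z)\<^sup>2 * grad_energy \<phi>) * indicator C z"
      by (intro mult_right_mono translation_estimate[OF \<phi>]) auto
    also have "\<dots> \<le> ennreal (DIM('a) * s\<^sup>2 * grad_energy \<phi>) * indicator C z"
      using z_bound[of z] grad_energy_nonneg[of \<phi>]
      by (auto simp: indicator_def intro!: ennreal_leI mult_right_mono)
    finally show "(\<integral>\<^sup>+x. ennreal ((\<phi> (z + x) - \<phi> x)\<^sup>2) * indicator C z \<partial>lborel)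
        \<le> ennreal (DIM('a) * s\<^sup>2 * grad_energy \<phi>) * indicator C z" .
  qed
  also have "\<dots> = ennreal (DIM('a) * s\<^sup>2 * grad_energy \<phi>) * ennreal ((2 * s) ^ DIM('a))"
    by (subst nn_integral_cmult) (auto simp: emC)
  also have "ennreal (1 / m) * \<dots> = ennreal (2 ^ DIM('a) * DIM('a) * s\<^sup>2 * grad_energy \<phi>)"
    using s grad_energy_nonneg[of \<phi>]
    by (simp add: ennreal_mult[symmetric] m_def power_mult_distrib)
  finally show ?thesis by (simp add: mult_left_mono)
qed

text \<open>
  Rellich's theorem in quantitative form: up to a small multiple of the gradient, a test function
  is controlled by its averages over the finitely many cells that meet \<open>\<Omega>\<close>.
\<close>

lemma Rellich_test:
  fixes \<Omega> :: "'a::euclidean_space set"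
  assumes \<Omega>: "bounded \<Omega>" and \<epsilon>: "0 < \<epsilon>"
  shows "\<exists>(I :: 'a set) (g :: 'a \<Rightarrow> 'a L2). finite I \<and> (\<forall>\<phi>\<in>test_functions \<Omega>.
    norm (abs_L2 \<phi>) \<le> \<epsilon> * sqrt (grad_energy \<phi>) + (\<Sum>c\<in>I. \<bar>inner (g c) (abs_L2 \<phi>)\<bar>))"
proof -
  define k where "k = sqrt (2 ^ DIM('a) * DIM('a))"
  have k: "0 < k" by (simp add: k_def)
  \<comment> \<open>With this side length the deviation from the cell averages is \<open>k * s = \<epsilon>\<close> times the gradient.\<close>
  define s where "s = \<epsilon> / k"
  have s: "0 < s" using k \<epsilon> by (simp add: s_def)
  define m where "m = s ^ DIM('a)"
  have m: "0 < m" using s by (simp add: m_def)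
  define I where "I = grid s ` \<Omega>"
  have I: "finite I" unfolding I_def by (rule finite_grid_image[OF s \<Omega>])
  define Q where "Q c = {y. grid s y = c}" for c :: 'a
  have [measurable]: "Q c \<in> sets borel" for c unfolding Q_def by measurable
  have si_Q: "square_integrable (indicat_real (Q c))" if "c \<in> I" for c
  proof -
    obtain x where "c = grid s x" using \<open>c \<in> I\<close> by (auto simp: I_def)
    then have "emeasure lborel (Q c) < \<infinity>" using emeasure_cell[OF s, of x] by (simp add: Q_def)
    then have "integrable lebesgue (indicat_real (Q c))"
      by (intro integrable_real_indicator) auto
    moreover have "(\<lambda>x. (indicat_real (Q c) x)\<^sup>2) = indicat_real (Q c)"
      by (auto simp: indicator_def)
    ultimately show ?thesis by (simp add: square_integrable_def)
  qed
  define e where "e c = abs_L2 (indicat_real (Q c))" for c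
  have "norm (abs_L2 \<phi>) \<le> \<epsilon> * sqrt (grad_energy \<phi>) + (\<Sum>c\<in>I. \<bar>inner ((norm (e c) / m) *\<^sub>R e c) (abs_L2 \<phi>)\<bar>)"
    if \<phi>: "\<phi> \<in> test_functions \<Omega>" for \<phi>
  proof -
    define \<alpha> where "\<alpha> c = cell_average s \<phi> c" for c
    have si: "square_integrable \<phi>" by (rule test_function_square_integrable[OF \<phi>])
    have [measurable]: "\<phi> \<in> borel_measurable borel" by (rule test_function_measurable(1)[OF \<phi>])
    have \<alpha>: "\<alpha> c = inner (e c) (abs_L2 \<phi>) / m" if "c \<in> I" for c
    proof -
      have "inner (e c) (abs_L2 \<phi>) = (LINT y|lebesgue. indicat_real (Q c) y * \<phi> y)"
        unfolding e_def by (rule inner_abs_L2[OF si_Q[OF that] si])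
      also have "\<dots> = (LINT y|lborel. indicat_real (Q c) y * \<phi> y)"
        by (rule integral_completion) measurable
      finally show ?thesis by (simp add: \<alpha>_def cell_average_def Q_def m_def)
    qed
    have \<alpha>0: "\<alpha> c = 0" if "c \<notin> I" for c
    proof -
      have "indicat_real {y. grid s y = c} y * \<phi> y = 0" for y
        using that test_functionsD(4)[OF \<phi>, of y] by (auto simp: I_def indicator_def)
      then have "(\<lambda>y. indicat_real {y. grid s y = c} y * \<phi> y) = (\<lambda>y. 0)" by (rule ext)
      then show ?thesis unfolding \<alpha>_def cell_average_def by simp
    qed
    have expand: "\<alpha> (grid s x) = (\<Sum>c\<in>I. \<alpha> c * indicat_real (Q c) x)" for x
    proof -
      have "(\<Sum>c\<in>I. \<alpha> c * indicat_real (Q c) x) = (\<Sum>c\<in>I. if c = grid s x then \<alpha> c else 0)"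
        by (intro sum.cong) (auto simp: Q_def indicator_def)
      then show ?thesis using I \<alpha>0 by simp
    qed
    have si_sum: "square_integrable (\<lambda>x. \<Sum>c\<in>J. \<alpha> c * indicat_real (Q c) x)" 
      and abs_sum: "abs_L2 (\<lambda>x. \<Sum>c\<in>J. \<alpha> c * indicat_real (Q c) x) = (\<Sum>c\<in>J. \<alpha> c *\<^sub>R e c)"
      if "J \<subseteq> I" for J
    proof -
      have "finite J" using I that finite_subset by blast
      then have "square_integrable (\<lambda>x. \<Sum>c\<in>J. \<alpha> c * indicat_real (Q c) x) \<and>
          abs_L2 (\<lambda>x. \<Sum>c\<in>J. \<alpha> c * indicat_real (Q c) x) = (\<Sum>c\<in>J. \<alpha> c *\<^sub>R e c)"
        using that
      proof (induction J rule: finite_induct)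
        case empty
        then show ?case by (simp add: square_integrable_zero zero_L2.abs_eq)
      next
        case (insert c J)
        have 1: "square_integrable (\<lambda>x. \<alpha> c * indicat_real (Q c) x)"
          using insert.prems by (intro square_integrable_cmult si_Q) auto
        have 2: "square_integrable (\<lambda>x. \<Sum>c\<in>J. \<alpha> c * indicat_real (Q c) x)"
          "abs_L2 (\<lambda>x. \<Sum>c\<in>J. \<alpha> c * indicat_real (Q c) x) = (\<Sum>c\<in>J. \<alpha> c *\<^sub>R e c)"
          using insert by auto
        have "\<alpha> c *\<^sub>R e c = abs_L2 (\<lambda>x. \<alpha> c * indicat_real (Q c) x)"
          unfolding e_def using insert.prems by (intro abs_L2_scale si_Q) auto
        moreover have "(\<Sum>c\<in>insert c J. \<alpha> c * indicat_real (Q c) x)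
            = \<alpha> c * indicat_real (Q c) x + (\<Sum>c\<in>J. \<alpha> c * indicat_real (Q c) x)" for x
          by (rule sum.insert[OF insert.hyps])
        ultimately show ?case
          using square_integrable_add[OF 1 2(1)] abs_L2_add[OF 1 2(1)] 2(2)
          by (simp only: sum.insert[OF insert.hyps] simp_thms)
      qed
      then show "square_integrable (\<lambda>x. \<Sum>c\<in>J. \<alpha> c * indicat_real (Q c) x)"
        "abs_L2 (\<lambda>x. \<Sum>c\<in>J. \<alpha> c * indicat_real (Q c) x) = (\<Sum>c\<in>J. \<alpha> c *\<^sub>R e c)" by auto
    qed
    have "norm (abs_L2 (\<lambda>x. \<phi> x - (\<Sum>c\<in>I. \<alpha> c * indicat_real (Q c) x))) \<le> \<epsilon> * sqrt (grad_energy \<phi>)"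
    proof (rule norm_abs_L2_le(2))
      show "(\<lambda>x. \<phi> x - (\<Sum>c\<in>I. \<alpha> c * indicat_real (Q c) x)) \<in> borel_measurable lebesgue"
        using square_integrable_diff[OF si si_sum[OF order_refl]] by (rule square_integrable_measurable)
      show "0 \<le> \<epsilon> * sqrt (grad_energy \<phi>)" using \<epsilon> grad_energy_nonneg[of \<phi>] by simp
      have "(\<integral>\<^sup>+x. ennreal ((\<phi> x - (\<Sum>c\<in>I. \<alpha> c * indicat_real (Q c) x))\<^sup>2) \<partial>lebesgue)
          = (\<integral>\<^sup>+x. ennreal ((\<phi> x - cell_average s \<phi> (grid s x))\<^sup>2) \<partial>lborel)"
        unfolding nn_integral_completion expand[symmetric] unfolding \<alpha>_def ..
      also have "\<dots> \<le> ennreal (2 ^ DIM('a) * DIM('a) * s\<^sup>2 * grad_energy \<phi>)"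
        by (rule cell_average_deviation[OF \<phi> s])
      also have "2 ^ DIM('a) * DIM('a) * s\<^sup>2 * grad_energy \<phi> = (\<epsilon> * sqrt (grad_energy \<phi>))\<^sup>2"
      proof -
        have "2 ^ DIM('a) * DIM('a) = k\<^sup>2" by (simp add: k_def)
        moreover have "k\<^sup>2 * s\<^sup>2 = \<epsilon>\<^sup>2" using k by (simp add: s_def power_divide)
        ultimately show ?thesis using grad_energy_nonneg[of \<phi>] by (simp add: power_mult_distrib)
      qed
      finally show "(\<integral>\<^sup>+x. ennreal ((\<phi> x - (\<Sum>c\<in>I. \<alpha> c * indicat_real (Q c) x))\<^sup>2) \<partial>lebesgue)
          \<le> ennreal ((\<epsilon> * sqrt (grad_energy \<phi>))\<^sup>2)" .
    qed
    then have "norm (abs_L2 \<phi> - (\<Sum>c\<in>I. \<alpha> c *\<^sub>R e c)) \<le> \<epsilon> * sqrt (grad_energy \<phi>)"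
      by (simp add: abs_L2_diff[OF si si_sum[OF order_refl], symmetric] abs_sum)
    moreover have "norm (\<Sum>c\<in>I. \<alpha> c *\<^sub>R e c) \<le> (\<Sum>c\<in>I. \<bar>inner ((norm (e c) / m) *\<^sub>R e c) (abs_L2 \<phi>)\<bar>)"
      using m by (intro order_trans[OF norm_sum] sum_mono) (simp add: \<alpha> abs_mult mult.commute)
    ultimately show ?thesis
      using norm_triangle_ineq[of "abs_L2 \<phi> - (\<Sum>c\<in>I. \<alpha> c *\<^sub>R e c)" "\<Sum>c\<in>I. \<alpha> c *\<^sub>R e c"] by simp
  qed
  then show ?thesis using I by (intro exI[of _ I] exI[of _ "\<lambda>c. (norm (e c) / m) *\<^sub>R e c"]) blast
qed

section \<open>Sobolev spaces as Hilbert spaces\<close>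

locale bounded_domain =
  fixes \<Omega> :: "'a::euclidean_space set"
  assumes open_domain: "open \<Omega>" and bounded_domain: "bounded \<Omega>"
begin

lemma \<Omega>_lebesgue [measurable]: "\<Omega> \<in> sets lebesgue"
  using open_domain by (simp add: borel_open)

text \<open>
  Test functions vanish outside \<open>\<Omega>\<close>, so the integrals over \<open>\<Omega>\<close> are inner products, and statements about
  weak derivatives become statements about orthogonality.
\<close>

lemma is_weak_deriv_iff:
  assumes i: "i \<in> Basis"
  shows "is_weak_deriv \<Omega> i u g \<longleftrightarrow> g \<in> L2_on \<Omega> \<and>
    (\<forall>\<phi>\<in>test_functions \<Omega>. inner u (abs_L2 (partial_deriv i \<phi>)) = - inner g (abs_L2 \<phi>))"
proof -
  have drop: "(LINT x:\<Omega>|lebesgue. rep_L2 v x * \<psi> x) = inner v (abs_L2 \<psi>)"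
    if \<psi>: "\<psi> \<in> test_functions \<Omega>" for v \<psi>
  proof -
    have "(\<lambda>x. indicat_real \<Omega> x *\<^sub>R (rep_L2 v x * \<psi> x)) = (\<lambda>x. rep_L2 v x * \<psi> x)"
    proof
      show "indicat_real \<Omega> x *\<^sub>R (rep_L2 v x * \<psi> x) = rep_L2 v x * \<psi> x" for x
        using test_functionsD(4)[OF \<psi>, of x] by (cases "x \<in> \<Omega>") auto
    qed
    then show ?thesis
      by (simp add: set_lebesgue_integral_def inner_L2_abs_right[OF test_function_square_integrable[OF \<psi>]])
  qed
  show ?thesis
    unfolding is_weak_deriv_def using drop test_functions_partial_deriv[OF _ i] by simp
qed

lemma is_weak_deriv_unique:
  assumes i: "i \<in> Basis" and "is_weak_deriv \<Omega> i u g" "is_weak_deriv \<Omega> i u g'"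
  shows "g = g'"
proof -
  have "g - g' = 0"
  proof (rule test_functions_separate[OF open_domain])
    show "g - g' \<in> L2_on \<Omega>"
      using assms is_weak_deriv_iff[OF i] subspace_L2_on by (blast intro: subspace_diff)
    show "inner (g - g') (abs_L2 \<phi>) = 0" if "\<phi> \<in> test_functions \<Omega>" for \<phi>
      using assms is_weak_deriv_iff[OF i] that by (auto simp: inner_diff_left)
  qed
  then show ?thesis by simp
qed

lemma weak_deriv_eqI:
  assumes "i \<in> Basis" "is_weak_deriv \<Omega> i u g"
  shows "weak_deriv \<Omega> i u = g"
  unfolding weak_deriv_def using assms is_weak_deriv_unique by blast

lemma weak_deriv:
  assumes "u \<in> H1 \<Omega>" "i \<in> Basis"
  shows "is_weak_deriv \<Omega> i u (weak_deriv \<Omega> i u)"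
  using assms weak_deriv_eqI unfolding H1_def by fastforce

lemma weak_deriv_in_L2_on: "u \<in> H1 \<Omega> \<Longrightarrow> i \<in> Basis \<Longrightarrow> weak_deriv \<Omega> i u \<in> L2_on \<Omega>"
  using weak_deriv is_weak_deriv_iff by blast

lemma is_weak_deriv_add:
  assumes i: "i \<in> Basis" and "is_weak_deriv \<Omega> i u g" "is_weak_deriv \<Omega> i v k"
  shows "is_weak_deriv \<Omega> i (u + v) (g + k)"
  using assms subspace_L2_on[of \<Omega>] unfolding is_weak_deriv_iff[OF i]
  by (auto simp: inner_add_left subspace_add)

lemma is_weak_deriv_scale:
  assumes i: "i \<in> Basis" and "is_weak_deriv \<Omega> i u g"
  shows "is_weak_deriv \<Omega> i (c *\<^sub>R u) (c *\<^sub>R g)"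
  using assms subspace_L2_on[of \<Omega>] unfolding is_weak_deriv_iff[OF i]
  by (auto simp: subspace_scale)

lemma is_weak_deriv_zero: "i \<in> Basis \<Longrightarrow> is_weak_deriv \<Omega> i 0 0"
  using subspace_L2_on[of \<Omega>] by (auto simp: is_weak_deriv_iff subspace_0)

lemma subspace_H1: "subspace (H1 \<Omega>)"
proof (rule subspaceI)
  show "0 \<in> H1 \<Omega>"
    using is_weak_deriv_zero subspace_0[OF subspace_L2_on] by (auto simp: H1_def)
  show "u + v \<in> H1 \<Omega>" if "u \<in> H1 \<Omega>" "v \<in> H1 \<Omega>" for u v
    using that is_weak_deriv_add[of _ u _ v] subspace_add[OF subspace_L2_on, of u \<Omega> v]
    unfolding H1_def mem_Collect_eq by blast
  show "c *\<^sub>R u \<in> H1 \<Omega>" if "u \<in> H1 \<Omega>" for c u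
    using that is_weak_deriv_scale[of _ u] subspace_scale[OF subspace_L2_on, of u \<Omega>]
    unfolding H1_def mem_Collect_eq by blast
qed

lemma weak_deriv_add:
  assumes "u \<in> H1 \<Omega>" "v \<in> H1 \<Omega>" "i \<in> Basis"
  shows "weak_deriv \<Omega> i (u + v) = weak_deriv \<Omega> i u + weak_deriv \<Omega> i v"
  using assms by (intro weak_deriv_eqI is_weak_deriv_add weak_deriv)

lemma weak_deriv_scale:
  assumes "u \<in> H1 \<Omega>" "i \<in> Basis"
  shows "weak_deriv \<Omega> i (c *\<^sub>R u) = c *\<^sub>R weak_deriv \<Omega> i u"
  using assms by (intro weak_deriv_eqI is_weak_deriv_scale weak_deriv)

lemma weak_deriv_diff:
  assumes "u \<in> H1 \<Omega>" "v \<in> H1 \<Omega>" "i \<in> Basis"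
  shows "weak_deriv \<Omega> i (u - v) = weak_deriv \<Omega> i u - weak_deriv \<Omega> i v"
  using weak_deriv_add[of u "(-1) *\<^sub>R v" i] weak_deriv_scale[of v i "-1"] assms
    subspace_scale[OF subspace_H1, of v "-1"] by simp

lemma is_weak_deriv_test:
  assumes \<phi>: "\<phi> \<in> test_functions \<Omega>" and i: "i \<in> Basis"
  shows "is_weak_deriv \<Omega> i (abs_L2 \<phi>) (abs_L2 (partial_deriv i \<phi>))"
  unfolding is_weak_deriv_iff[OF i]
  using integration_by_parts_test[OF \<phi> _ i] abs_L2_test_in_L2_on[OF test_functions_partial_deriv[OF \<phi> i]]
  by simp

lemma test_in_H1: "\<phi> \<in> test_functions \<Omega> \<Longrightarrow> abs_L2 \<phi> \<in> H1 \<Omega>"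
  unfolding H1_def using abs_L2_test_in_L2_on is_weak_deriv_test by blast

lemma weak_deriv_test:
  "\<phi> \<in> test_functions \<Omega> \<Longrightarrow> i \<in> Basis \<Longrightarrow> weak_deriv \<Omega> i (abs_L2 \<phi>) = abs_L2 (partial_deriv i \<phi>)"
  by (intro weak_deriv_eqI is_weak_deriv_test)

definition grad_form :: "'a L2 \<Rightarrow> 'a L2 \<Rightarrow> real" where
  "grad_form u v = (\<Sum>i\<in>Basis. inner (weak_deriv \<Omega> i u) (weak_deriv \<Omega> i v))"

definition H1_form :: "'a L2 \<Rightarrow> 'a L2 \<Rightarrow> real" where
  "H1_form u v = inner u v + grad_form u v"

lemma grad_form_add: "\<lbrakk>u \<in> H1 \<Omega>; v \<in> H1 \<Omega>; w \<in> H1 \<Omega>\<rbrakk> \<Longrightarrow> grad_form (u + v) w = grad_form u w + grad_form v w"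
  by (simp add: grad_form_def weak_deriv_add inner_add_left sum.distrib)

lemma grad_form_scale: "\<lbrakk>u \<in> H1 \<Omega>; w \<in> H1 \<Omega>\<rbrakk> \<Longrightarrow> grad_form (c *\<^sub>R u) w = c * grad_form u w"
  by (simp add: grad_form_def weak_deriv_scale sum_distrib_left)

lemma grad_form_sym: "grad_form u v = grad_form v u"
  by (simp add: grad_form_def inner_commute)

lemma grad_form_nonneg: "0 \<le> grad_form u u"
  by (auto simp: grad_form_def intro: sum_nonneg)

lemma grad_form_square: "grad_form u u = (\<Sum>i\<in>Basis. (norm (weak_deriv \<Omega> i u))\<^sup>2)"
  by (simp add: grad_form_def power2_norm_eq_inner)

lemma grad_form_test: "\<phi> \<in> test_functions \<Omega> \<Longrightarrow> grad_form (abs_L2 \<phi>) (abs_L2 \<phi>) = grad_energy \<phi>"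
  by (simp add: grad_form_square grad_energy_def weak_deriv_test)

lemma inner_form_H1: "inner_form (H1 \<Omega>) H1_form"
proof unfold_locales
  show "subspace (H1 \<Omega>)" by (rule subspace_H1)
  show "0 < H1_form u u" if "u \<noteq> 0" for u
    using that grad_form_nonneg[of u] by (auto simp: H1_form_def add_pos_nonneg)
  show "H1_form u v = H1_form v u" for u v
    unfolding H1_form_def using grad_form_sym[of u v] inner_commute[of u v] by simp
qed (auto simp: H1_form_def grad_form_add grad_form_scale inner_add_left algebra_simps)

sublocale H1: inner_form "H1 \<Omega>" H1_form by (rule inner_form_H1)

lemma weak_grad_inner:
  "weak_grad \<Omega> u x \<bullet> weak_grad \<Omega> v x = (\<Sum>i\<in>Basis. rep_L2 (weak_deriv \<Omega> i u) x * rep_L2 (weak_deriv \<Omega> i v) x)"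
  unfolding weak_grad_def by (subst euclidean_inner) simp

lemma set_integral_weak_grad:
  assumes "u \<in> H1 \<Omega>"
  shows "set_integrable lebesgue \<Omega> (\<lambda>x. weak_grad \<Omega> u x \<bullet> weak_grad \<Omega> v x)"
    "(LINT x:\<Omega>|lebesgue. weak_grad \<Omega> u x \<bullet> weak_grad \<Omega> v x) = grad_form u v"
proof -
  have int: "integrable lebesgue (\<lambda>x. rep_L2 (weak_deriv \<Omega> i u) x * rep_L2 (weak_deriv \<Omega> i v) x)" for i
    by (intro square_integrable_mult) auto
  then have int_sum: "integrable lebesgue (\<lambda>x. weak_grad \<Omega> u x \<bullet> weak_grad \<Omega> v x)"
    unfolding weak_grad_inner by (intro Bochner_Integration.integrable_sum)
  then show "set_integrable lebesgue \<Omega> (\<lambda>x. weak_grad \<Omega> u x \<bullet> weak_grad \<Omega> v x)"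
    unfolding set_integrable_def by (intro integrable_mult_indicator) auto
  have vanish: "AE x in lebesgue. \<forall>i\<in>Basis. x \<notin> \<Omega> \<longrightarrow> rep_L2 (weak_deriv \<Omega> i u) x = 0"
    using weak_deriv_in_L2_on[OF assms] by (intro AE_finite_allI) (auto simp: L2_on_def)
  have "(LINT x:\<Omega>|lebesgue. weak_grad \<Omega> u x \<bullet> weak_grad \<Omega> v x)
      = (LINT x|lebesgue. weak_grad \<Omega> u x \<bullet> weak_grad \<Omega> v x)"
    unfolding set_lebesgue_integral_def
  proof (rule integral_cong_AE)
    show "AE x in lebesgue. indicat_real \<Omega> x *\<^sub>R (weak_grad \<Omega> u x \<bullet> weak_grad \<Omega> v x) = weak_grad \<Omega> u x \<bullet> weak_grad \<Omega> v x"
      using vanish by eventually_elim (auto simp: weak_grad_inner indicator_def)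
    show m: "(\<lambda>x. weak_grad \<Omega> u x \<bullet> weak_grad \<Omega> v x) \<in> borel_measurable lebesgue"
      using int_sum by auto
    show "(\<lambda>x. indicat_real \<Omega> x *\<^sub>R (weak_grad \<Omega> u x \<bullet> weak_grad \<Omega> v x)) \<in> borel_measurable lebesgue"
      by (intro borel_measurable_scaleR borel_measurable_indicator m) simp
  qed
  also have "\<dots> = grad_form u v"
    unfolding weak_grad_inner grad_form_def inner_L2_eq by (rule Bochner_Integration.integral_sum[OF int])
  finally show "(LINT x:\<Omega>|lebesgue. weak_grad \<Omega> u x \<bullet> weak_grad \<Omega> v x) = grad_form u v" .
qed

lemma H1_norm_eq:
  assumes u: "u \<in> H1 \<Omega>"
  shows "H1_norm \<Omega> u = H1.nrm u"
proof -
  have uO: "u \<in> L2_on \<Omega>" using u by (simp add: H1_def)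
  have si: "set_integrable lebesgue \<Omega> (\<lambda>x. rep_L2 u x * rep_L2 u x)"
    unfolding set_integrable_def
    by (intro integrable_mult_indicator square_integrable_mult) auto
  have "(LINT x:\<Omega>|lebesgue. (rep_L2 u x)\<^sup>2 + (norm (weak_grad \<Omega> u x))\<^sup>2)
      = (LINT x:\<Omega>|lebesgue. rep_L2 u x * rep_L2 u x + weak_grad \<Omega> u x \<bullet> weak_grad \<Omega> u x)"
    unfolding power2_norm_eq_inner by (simp add: power2_eq_square)
  also have "\<dots> = (LINT x:\<Omega>|lebesgue. rep_L2 u x * rep_L2 u x) + grad_form u u"
    using set_integral_add(2)[OF si set_integral_weak_grad(1)[OF u, of u]] set_integral_weak_grad(2)[OF u, of u]
    by simp
  also have "(LINT x:\<Omega>|lebesgue. rep_L2 u x * rep_L2 u x) = inner u u"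
    using set_integral_L2_on[OF uO, of "rep_L2 u"] by (simp add: inner_L2_eq)
  finally show ?thesis by (simp add: H1_norm_def H1.nrm_def H1_form_def)
qed

lemma norm_le_H1: "u \<in> H1 \<Omega> \<Longrightarrow> norm u \<le> H1.nrm u"
  using grad_form_nonneg[of u]
  by (simp add: H1.nrm_def H1_form_def norm_eq_sqrt_inner)

lemma norm_weak_deriv_le_H1:
  assumes "u \<in> H1 \<Omega>" "i \<in> Basis"
  shows "norm (weak_deriv \<Omega> i u) \<le> H1.nrm u"
proof -
  have "inner (weak_deriv \<Omega> i u) (weak_deriv \<Omega> i u) \<le> grad_form u u"
    unfolding grad_form_def using assms(2) by (intro member_le_sum) auto
  then show ?thesis by (simp add: H1.nrm_def H1_form_def norm_eq_sqrt_inner add_increasing)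
qed

lemma H1_nrm_tendsto_iff:
  assumes s: "\<And>n. s n \<in> H1 \<Omega>" and u: "u \<in> H1 \<Omega>"
  shows "(\<lambda>n. H1.nrm (s n - u)) \<longlonglongrightarrow> 0 \<longleftrightarrow>
    s \<longlonglongrightarrow> u \<and> (\<forall>i\<in>Basis. (\<lambda>n. weak_deriv \<Omega> i (s n)) \<longlonglongrightarrow> weak_deriv \<Omega> i u)"
proof safe
  assume 0: "(\<lambda>n. H1.nrm (s n - u)) \<longlonglongrightarrow> 0"
  have mem: "s n - u \<in> H1 \<Omega>" for n using s u by auto
  have "(\<lambda>n. s n - u) \<longlonglongrightarrow> 0"
    using norm_le_H1[OF mem] by (intro Lim_null_comparison[OF _ 0] always_eventually) auto
  then show "s \<longlonglongrightarrow> u" by (rule LIM_zero_cancel)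
  fix i :: 'a assume i: "i \<in> Basis"
  have "(\<lambda>n. weak_deriv \<Omega> i (s n) - weak_deriv \<Omega> i u) \<longlonglongrightarrow> 0"
    using norm_weak_deriv_le_H1[OF mem i] weak_deriv_diff[OF s u i]
    by (intro Lim_null_comparison[OF _ 0] always_eventually) auto
  then show "(\<lambda>n. weak_deriv \<Omega> i (s n)) \<longlonglongrightarrow> weak_deriv \<Omega> i u" by (rule LIM_zero_cancel)
next
  assume L2: "s \<longlonglongrightarrow> u" and D: "\<forall>i\<in>Basis. (\<lambda>n. weak_deriv \<Omega> i (s n)) \<longlonglongrightarrow> weak_deriv \<Omega> i u"
  have "(\<lambda>n. sqrt (inner (s n - u) (s n - u) + (\<Sum>i\<in>Basis. inner (weak_deriv \<Omega> i (s n) - weak_deriv \<Omega> i u)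
      (weak_deriv \<Omega> i (s n) - weak_deriv \<Omega> i u)))) \<longlonglongrightarrow>
      sqrt (inner (u - u) (u - u) + (\<Sum>i\<in>Basis. inner (weak_deriv \<Omega> i u - weak_deriv \<Omega> i u)
      (weak_deriv \<Omega> i u - weak_deriv \<Omega> i u)))"
    using D by (intro tendsto_intros L2) auto
  then show "(\<lambda>n. H1.nrm (s n - u)) \<longlonglongrightarrow> 0"
    using s u by (simp add: H1.nrm_def H1_form_def grad_form_def weak_deriv_diff)
qed

text \<open>
  Weak derivatives are defined by inner products with fixed functions, hence pass to \<open>L\<^sup>2\<close> limits.
\<close>

lemma hilbert_form_H1: "hilbert_form (H1 \<Omega>) H1_form"
proof unfold_locales
  fix s :: "nat \<Rightarrow> 'a L2"
  assume s: "\<And>n. s n \<in> H1 \<Omega>" and cauchy: "\<And>e. 0 < e \<Longrightarrow> \<exists>N. \<forall>m\<ge>N. \<forall>n\<ge>N. H1.nrm (s m - s n) < e"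
  have conv: "convergent t" if le: "\<And>m n. norm (t m - t n) \<le> H1.nrm (s m - s n)" for t :: "nat \<Rightarrow> 'a L2"
  proof (rule L2_complete, rule metric_CauchyI)
    fix e :: real assume "0 < e"
    then obtain N where "\<forall>m\<ge>N. \<forall>n\<ge>N. H1.nrm (s m - s n) < e" using cauchy by blast
    then show "\<exists>N. \<forall>m\<ge>N. \<forall>n\<ge>N. dist (t m) (t n) < e"
      using le unfolding dist_norm by (meson order_le_less_trans)
  qed
  have mem: "s m - s n \<in> H1 \<Omega>" for m n using s by auto
  obtain u where u: "s \<longlonglongrightarrow> u" using conv[of s] norm_le_H1[OF mem] by (auto simp: convergent_def)
  have "\<forall>i\<in>Basis. \<exists>g. (\<lambda>n. weak_deriv \<Omega> i (s n)) \<longlonglongrightarrow> g"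
  proof
    fix i :: 'a assume i: "i \<in> Basis"
    show "\<exists>g. (\<lambda>n. weak_deriv \<Omega> i (s n)) \<longlonglongrightarrow> g"
      using conv[of "\<lambda>n. weak_deriv \<Omega> i (s n)"] norm_weak_deriv_le_H1[OF mem i] weak_deriv_diff[OF s s i]
      by (auto simp: convergent_def)
  qed
  then obtain g where g: "\<And>i. i \<in> Basis \<Longrightarrow> (\<lambda>n. weak_deriv \<Omega> i (s n)) \<longlonglongrightarrow> g i" by metis
  have uO: "u \<in> L2_on \<Omega>"
    using s by (intro closed_L2_on[OF \<Omega>_lebesgue _ u]) (simp add: H1_def)
  have wd: "is_weak_deriv \<Omega> i u (g i)" if i: "i \<in> Basis" for i
    unfolding is_weak_deriv_iff[OF i]
  proof (intro conjI ballI)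
    show "g i \<in> L2_on \<Omega>"
      using weak_deriv_in_L2_on[OF s i] by (intro closed_L2_on[OF \<Omega>_lebesgue _ g[OF i]])
    fix \<phi> assume \<phi>: "\<phi> \<in> test_functions \<Omega>"
    have "(\<lambda>n. inner (s n) (abs_L2 (partial_deriv i \<phi>))) \<longlonglongrightarrow> inner u (abs_L2 (partial_deriv i \<phi>))"
      by (intro tendsto_intros u)
    moreover have "(\<lambda>n. - inner (weak_deriv \<Omega> i (s n)) (abs_L2 \<phi>)) \<longlonglongrightarrow> - inner (g i) (abs_L2 \<phi>)"
      by (intro tendsto_intros g[OF i])
    moreover have "inner (s n) (abs_L2 (partial_deriv i \<phi>)) = - inner (weak_deriv \<Omega> i (s n)) (abs_L2 \<phi>)" for n
      using weak_deriv[OF s i] \<phi> unfolding is_weak_deriv_iff[OF i] by blast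
    ultimately show "inner u (abs_L2 (partial_deriv i \<phi>)) = - inner (g i) (abs_L2 \<phi>)"
      using LIMSEQ_unique by simp
  qed
  then have uH: "u \<in> H1 \<Omega>" using uO by (auto simp: H1_def)
  have "(\<lambda>n. weak_deriv \<Omega> i (s n)) \<longlonglongrightarrow> weak_deriv \<Omega> i u" if "i \<in> Basis" for i
    using g[OF that] weak_deriv_eqI[OF that wd[OF that]] by simp
  then have "(\<lambda>n. H1.nrm (s n - u)) \<longlonglongrightarrow> 0" using H1_nrm_tendsto_iff[of s u, OF s uH] u by blast
  then show "\<exists>l\<in>H1 \<Omega>. (\<lambda>n. H1.nrm (s n - l)) \<longlonglongrightarrow> 0" using uH by blast
qed

subsection \<open>The closure of the test functions\<close>

lemma H10_iff: "u \<in> H10 \<Omega> \<longleftrightarrow> u \<in> H1 \<Omega> \<and> (\<forall>e>0. \<exists>\<phi>\<in>test_functions \<Omega>. H1.nrm (u - abs_L2 \<phi>) < e)"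
  unfolding H10_def using H1_norm_eq test_in_H1 by (auto simp: H1.H_diff)

lemma H10_subset_H1: "H10 \<Omega> \<subseteq> H1 \<Omega>"
  by (auto simp: H10_def)

lemma subspace_H10: "subspace (H10 \<Omega>)"
proof (rule subspaceI)
  note si = test_function_square_integrable
  show "0 \<in> H10 \<Omega>"
    unfolding H10_iff
    using test_functions_zero[of \<Omega>] zero_L2.abs_eq[where ?'a = 'a] by (auto intro!: bexI[of _ "\<lambda>x. 0"])
  show "u + v \<in> H10 \<Omega>" if u: "u \<in> H10 \<Omega>" and v: "v \<in> H10 \<Omega>" for u v
    unfolding H10_iff
  proof (intro conjI allI impI)
    have uv: "u \<in> H1 \<Omega>" "v \<in> H1 \<Omega>" using u v H10_subset_H1 by auto
    then show "u + v \<in> H1 \<Omega>" by auto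
    fix e :: real assume "0 < e"
    then obtain \<phi> \<psi> where \<phi>: "\<phi> \<in> test_functions \<Omega>" "H1.nrm (u - abs_L2 \<phi>) < e / 2"
      and \<psi>: "\<psi> \<in> test_functions \<Omega>" "H1.nrm (v - abs_L2 \<psi>) < e / 2"
      using u v unfolding H10_iff by (meson half_gt_zero)
    have eq: "u + v - abs_L2 (\<lambda>x. \<phi> x + \<psi> x) = (u - abs_L2 \<phi>) + (v - abs_L2 \<psi>)"
      by (simp add: abs_L2_add[OF si[OF \<phi>(1)] si[OF \<psi>(1)], symmetric])
    have "H1.nrm (u + v - abs_L2 (\<lambda>x. \<phi> x + \<psi> x)) \<le> H1.nrm (u - abs_L2 \<phi>) + H1.nrm (v - abs_L2 \<psi>)"
      unfolding eq using uv \<phi>(1) \<psi>(1) test_in_H1 by (intro H1.nrm_triangle H1.H_diff)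
    then show "\<exists>\<phi>\<in>test_functions \<Omega>. H1.nrm (u + v - abs_L2 \<phi>) < e"
      using \<phi> \<psi> by (intro bexI[of _ "\<lambda>x. \<phi> x + \<psi> x"] test_functions_add) auto
  qed
  show "c *\<^sub>R u \<in> H10 \<Omega>" if u: "u \<in> H10 \<Omega>" for c u
    unfolding H10_iff
  proof (intro conjI allI impI)
    have uH: "u \<in> H1 \<Omega>" using u H10_subset_H1 by auto
    then show "c *\<^sub>R u \<in> H1 \<Omega>" by auto
    fix e :: real assume e: "0 < e"
    then have "0 < e / (\<bar>c\<bar> + 1)" by (intro divide_pos_pos) auto
    then obtain \<phi> where \<phi>: "\<phi> \<in> test_functions \<Omega>" "H1.nrm (u - abs_L2 \<phi>) < e / (\<bar>c\<bar> + 1)"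
      using u unfolding H10_iff by blast
    have mem: "u - abs_L2 \<phi> \<in> H1 \<Omega>" using uH test_in_H1[OF \<phi>(1)] by auto
    have "c *\<^sub>R u - abs_L2 (\<lambda>x. c * \<phi> x) = c *\<^sub>R (u - abs_L2 \<phi>)"
      by (simp add: abs_L2_scale[OF si[OF \<phi>(1)], symmetric] scaleR_diff_right)
    then have "H1.nrm (c *\<^sub>R u - abs_L2 (\<lambda>x. c * \<phi> x)) = \<bar>c\<bar> * H1.nrm (u - abs_L2 \<phi>)"
      using H1.nrm_scale[OF mem] by simp
    also have "\<dots> \<le> (\<bar>c\<bar> + 1) * H1.nrm (u - abs_L2 \<phi>)"
      using H1.nrm_nonneg[OF mem] by (intro mult_right_mono) auto
    also have "\<dots> < e" using \<phi>(2) by (simp add: field_simps)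
    finally show "\<exists>\<phi>\<in>test_functions \<Omega>. H1.nrm (c *\<^sub>R u - abs_L2 \<phi>) < e"
      using test_functions_cmult[OF \<phi>(1)] by blast
  qed
qed

lemma H10_closed:
  assumes s: "\<And>n. s n \<in> H10 \<Omega>" and u: "u \<in> H1 \<Omega>" and lim: "(\<lambda>n. H1.nrm (s n - u)) \<longlonglongrightarrow> 0"
  shows "u \<in> H10 \<Omega>"
  unfolding H10_iff
proof (intro conjI allI impI u)
  fix e :: real assume "0 < e"
  then obtain n where n: "H1.nrm (s n - u) < e / 2"
    using order_tendstoD(2)[OF lim, of "e / 2"] by (auto simp: eventually_sequentially)
  obtain \<phi> where \<phi>: "\<phi> \<in> test_functions \<Omega>" "H1.nrm (s n - abs_L2 \<phi>) < e / 2"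
    using s[of n] \<open>0 < e\<close> unfolding H10_iff by (meson half_gt_zero)
  have mem: "s n \<in> H1 \<Omega>" "abs_L2 \<phi> \<in> H1 \<Omega>" using s H10_subset_H1 test_in_H1[OF \<phi>(1)] by auto
  have "H1.nrm ((s n - abs_L2 \<phi>) - (s n - u)) \<le> H1.nrm (s n - abs_L2 \<phi>) + H1.nrm (s n - u)"
    using mem u by (intro H1.nrm_triangle_diff H1.H_diff)
  then show "\<exists>\<phi>\<in>test_functions \<Omega>. H1.nrm (u - abs_L2 \<phi>) < e"
    using \<phi> n by (intro bexI[of _ \<phi>]) auto
qed

lemma H10_approximation:
  assumes u: "u \<in> H10 \<Omega>"
  obtains \<phi> where "\<And>n. \<phi> n \<in> test_functions \<Omega>" "(\<lambda>n. abs_L2 (\<phi> n)) \<longlonglongrightarrow> u"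
    "(\<lambda>n. grad_energy (\<phi> n)) \<longlonglongrightarrow> grad_form u u"
proof -
  have "\<exists>\<phi>\<in>test_functions \<Omega>. H1.nrm (u - abs_L2 \<phi>) < 1 / real (Suc n)" for n
    using u unfolding H10_iff by simp
  then obtain \<phi> where \<phi>: "\<And>n. \<phi> n \<in> test_functions \<Omega>" "\<And>n. H1.nrm (u - abs_L2 (\<phi> n)) < 1 / real (Suc n)"
    by metis
  have uH: "u \<in> H1 \<Omega>" using u H10_subset_H1 by blast
  have mem: "abs_L2 (\<phi> n) \<in> H1 \<Omega>" for n using test_in_H1[OF \<phi>(1)] .
  have "(\<lambda>n. H1.nrm (abs_L2 (\<phi> n) - u)) \<longlonglongrightarrow> 0"
  proof (rule tendsto_sandwich[of "\<lambda>_. 0" _ _ "\<lambda>n. 1 / real (Suc n)"])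
    show "(\<lambda>n. 1 / real (Suc n)) \<longlonglongrightarrow> 0" by (rule LIMSEQ_Suc[OF lim_1_over_n])
    show "\<forall>\<^sub>F n in sequentially. H1.nrm (abs_L2 (\<phi> n) - u) \<le> 1 / real (Suc n)"
      using \<phi>(2) H1.nrm_minus_commute[OF uH mem] by (auto intro!: always_eventually less_imp_le)
    show "\<forall>\<^sub>F n in sequentially. 0 \<le> H1.nrm (abs_L2 (\<phi> n) - u)"
      using mem uH by (auto intro!: always_eventually H1.nrm_nonneg)
  qed simp
  then have lim: "(\<lambda>n. abs_L2 (\<phi> n)) \<longlonglongrightarrow> u"
    "\<And>i. i \<in> Basis \<Longrightarrow> (\<lambda>n. weak_deriv \<Omega> i (abs_L2 (\<phi> n))) \<longlonglongrightarrow> weak_deriv \<Omega> i u"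
    using H1_nrm_tendsto_iff[of "\<lambda>n. abs_L2 (\<phi> n)" u, OF mem uH] by auto
  have "(\<lambda>n. grad_form (abs_L2 (\<phi> n)) (abs_L2 (\<phi> n))) \<longlonglongrightarrow> grad_form u u"
    unfolding grad_form_def by (intro tendsto_intros lim(2))
  then show ?thesis using that[of \<phi>] \<phi>(1) lim(1) by (simp add: grad_form_test)
qed

lemma Poincare:
  obtains C where "0 < C" "\<And>u. u \<in> H10 \<Omega> \<Longrightarrow> norm u \<le> C * sqrt (grad_form u u)"
proof -
  obtain C where C: "0 < C" "\<And>\<phi>. \<phi> \<in> test_functions \<Omega> \<Longrightarrow> norm (abs_L2 \<phi>) \<le> C * sqrt (grad_energy \<phi>)"
    by (rule Poincare_test[OF bounded_domain]) (rule that)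
  have "norm u \<le> C * sqrt (grad_form u u)" if u: "u \<in> H10 \<Omega>" for u
  proof -
    obtain \<phi> where \<phi>: "\<And>n. \<phi> n \<in> test_functions \<Omega>" "(\<lambda>n. abs_L2 (\<phi> n)) \<longlonglongrightarrow> u"
      "(\<lambda>n. grad_energy (\<phi> n)) \<longlonglongrightarrow> grad_form u u"
      by (rule H10_approximation[OF u]) (rule that)
    show ?thesis
    proof (rule LIMSEQ_le)
      show "(\<lambda>n. norm (abs_L2 (\<phi> n))) \<longlonglongrightarrow> norm u" by (intro tendsto_intros \<phi>)
      show "(\<lambda>n. C * sqrt (grad_energy (\<phi> n))) \<longlonglongrightarrow> C * sqrt (grad_form u u)" by (intro tendsto_intros \<phi>)
    qed (use C(2) \<phi>(1) in blast)
  qed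
  then show ?thesis using that C(1) by blast
qed

lemma Rellich:
  assumes "0 < \<epsilon>"
  obtains I :: "'a set" and g where "finite I"
    "\<And>u. u \<in> H10 \<Omega> \<Longrightarrow> norm u \<le> \<epsilon> * sqrt (grad_form u u) + (\<Sum>c\<in>I. \<bar>inner (g c) u\<bar>)"
proof -
  obtain I :: "'a set" and g where I: "finite I"
    and g: "\<And>\<phi>. \<phi> \<in> test_functions \<Omega> \<Longrightarrow>
      norm (abs_L2 \<phi>) \<le> \<epsilon> * sqrt (grad_energy \<phi>) + (\<Sum>c\<in>I. \<bar>inner (g c) (abs_L2 \<phi>)\<bar>)"
    using Rellich_test[OF bounded_domain assms] by blast
  have "norm u \<le> \<epsilon> * sqrt (grad_form u u) + (\<Sum>c\<in>I. \<bar>inner (g c) u\<bar>)" if u: "u \<in> H10 \<Omega>" for u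
  proof -
    obtain \<phi> where \<phi>: "\<And>n. \<phi> n \<in> test_functions \<Omega>" "(\<lambda>n. abs_L2 (\<phi> n)) \<longlonglongrightarrow> u"
      "(\<lambda>n. grad_energy (\<phi> n)) \<longlonglongrightarrow> grad_form u u"
      by (rule H10_approximation[OF u]) (rule that)
    show ?thesis
    proof (rule LIMSEQ_le)
      show "(\<lambda>n. norm (abs_L2 (\<phi> n))) \<longlonglongrightarrow> norm u" by (intro tendsto_intros \<phi>)
      show "(\<lambda>n. \<epsilon> * sqrt (grad_energy (\<phi> n)) + (\<Sum>c\<in>I. \<bar>inner (g c) (abs_L2 (\<phi> n))\<bar>)) \<longlonglongrightarrow>
          \<epsilon> * sqrt (grad_form u u) + (\<Sum>c\<in>I. \<bar>inner (g c) u\<bar>)"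
        by (intro tendsto_intros \<phi>)
    qed (use g \<phi>(1) in blast)
  qed
  then show ?thesis using that I by blast
qed

end

section \<open>The energy form and the potential\<close>

subsection \<open>Bounded potentials\<close>

text \<open>
  The bounded operator on \<open>L\<^sup>2\<close> that represents the potential form.
\<close>

definition multiply :: "'a::euclidean_space set \<Rightarrow> ('a \<Rightarrow> real) \<Rightarrow> 'a L2 \<Rightarrow> 'a L2" where
  "multiply \<Omega> V u = abs_L2 (\<lambda>x. indicat_real \<Omega> x * V x * rep_L2 u x)"

lemma square_integrable_multiply:
  assumes V: "V \<in> Linfty_on \<Omega>"
  shows "square_integrable (\<lambda>x. indicat_real \<Omega> x * V x * rep_L2 u x)"
    and "\<exists>C\<ge>0. \<forall>u. norm (multiply \<Omega> V u) \<le> C * norm u"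
proof -
  have [measurable]: "(\<lambda>x. indicat_real \<Omega> x * V x) \<in> borel_measurable lebesgue"
    using V by (simp add: Linfty_on_def set_borel_measurable_def)
  obtain C0 where C0: "AE x\<in>\<Omega> in lebesgue. \<bar>V x\<bar> \<le> C0" using V by (auto simp: Linfty_on_def)
  define C where "C = \<bar>C0\<bar>"
  have C: "0 \<le> C" "AE x in lebesgue. \<bar>indicat_real \<Omega> x * V x\<bar> \<le> C"
    using C0 by (auto simp: C_def indicator_def elim!: eventually_mono)
  have le: "(\<integral>\<^sup>+x. ennreal ((indicat_real \<Omega> x * V x * rep_L2 u x)\<^sup>2) \<partial>lebesgue) \<le> ennreal ((C * norm u)\<^sup>2)" for u :: "'a L2"
  proof -
    have "(\<integral>\<^sup>+x. ennreal ((indicat_real \<Omega> x * V x * rep_L2 u x)\<^sup>2) \<partial>lebesgue)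
        \<le> (\<integral>\<^sup>+x. ennreal (C\<^sup>2) * ennreal ((rep_L2 u x)\<^sup>2) \<partial>lebesgue)"
    proof (rule nn_integral_mono_AE)
      show "AE x in lebesgue. ennreal ((indicat_real \<Omega> x * V x * rep_L2 u x)\<^sup>2) \<le> ennreal (C\<^sup>2) * ennreal ((rep_L2 u x)\<^sup>2)"
        using C(2)
      proof eventually_elim
        case (elim x)
        then have "(indicat_real \<Omega> x * V x)\<^sup>2 \<le> C\<^sup>2"
          using C(1) by (simp only: abs_le_square_iff[symmetric] abs_of_nonneg)
        then have "(indicat_real \<Omega> x * V x * rep_L2 u x)\<^sup>2 \<le> C\<^sup>2 * (rep_L2 u x)\<^sup>2"
          by (subst power_mult_distrib) (intro mult_right_mono, auto)
        then show ?case by (simp add: ennreal_mult[symmetric] ennreal_leI)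
      qed
    qed
    also have "\<dots> = ennreal (C\<^sup>2) * ennreal ((norm u)\<^sup>2)"
      by (subst nn_integral_cmult) (auto simp: nn_integral_square_L2)
    also have "\<dots> = ennreal ((C * norm u)\<^sup>2)" by (simp add: ennreal_mult[symmetric] power_mult_distrib)
    finally show ?thesis .
  qed
  show "square_integrable (\<lambda>x. indicat_real \<Omega> x * V x * rep_L2 u x)"
    by (rule norm_abs_L2_le(1)[OF _ _ le]) (use C(1) in auto)
  have "norm (multiply \<Omega> V u) \<le> C * norm u" for u
    unfolding multiply_def by (rule norm_abs_L2_le(2)[OF _ _ le]) (use C(1) in auto)
  then show "\<exists>C\<ge>0. \<forall>u. norm (multiply \<Omega> V u) \<le> C * norm u" using C(1) by blast
qed

lemma set_integrable_potential:
  assumes V: "V \<in> Linfty_on \<Omega>"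
  shows "set_integrable lebesgue \<Omega> (\<lambda>x. V x * rep_L2 u x * rep_L2 v x)"
  using square_integrable_mult[OF square_integrable_multiply(1)[OF V] square_integrable_rep_L2, of u v]
  by (simp add: set_integrable_def mult.assoc)

lemma potential_form_eq_inner:
  assumes V: "V \<in> Linfty_on \<Omega>"
  shows "potential_form \<Omega> V u v = inner (multiply \<Omega> V u) v"
  using inner_L2_abs_right[OF square_integrable_multiply(1)[OF V], of v u]
  unfolding potential_form_def multiply_def set_lebesgue_integral_def
  by (simp add: inner_commute mult_ac)

lemma multiply_add:
  assumes V: "V \<in> Linfty_on \<Omega>"
  shows "multiply \<Omega> V (u + v) = multiply \<Omega> V u + multiply \<Omega> V v"
  unfolding multiply_def abs_L2_add[OF square_integrable_multiply(1)[OF V] square_integrable_multiply(1)[OF V]]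
proof (rule abs_L2_eqI)
  show "AE x in lebesgue. indicat_real \<Omega> x * V x * rep_L2 (u + v) x =
      indicat_real \<Omega> x * V x * rep_L2 u x + indicat_real \<Omega> x * V x * rep_L2 v x"
    using AE_rep_L2_add[of u v] by eventually_elim (simp add: distrib_left)
qed (rule square_integrable_multiply(1)[OF V]
    square_integrable_add[OF square_integrable_multiply(1)[OF V] square_integrable_multiply(1)[OF V]])+

lemma multiply_scale:
  assumes V: "V \<in> Linfty_on \<Omega>"
  shows "multiply \<Omega> V (c *\<^sub>R u) = c *\<^sub>R multiply \<Omega> V u"
  unfolding multiply_def abs_L2_scale[OF square_integrable_multiply(1)[OF V]]
proof (rule abs_L2_eqI)
  show "AE x in lebesgue. indicat_real \<Omega> x * V x * rep_L2 (c *\<^sub>R u) x = c * (indicat_real \<Omega> x * V x * rep_L2 u x)"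
    using AE_rep_L2_scale[of c u] by eventually_elim simp
qed (rule square_integrable_multiply(1)[OF V]
    square_integrable_cmult[OF square_integrable_multiply(1)[OF V]])+

lemma potential_form_add_left:
  "V \<in> Linfty_on \<Omega> \<Longrightarrow> potential_form \<Omega> V (u + v) w = potential_form \<Omega> V u w + potential_form \<Omega> V v w"
  by (simp add: potential_form_eq_inner multiply_add inner_add_left)

lemma potential_form_scale_left:
  "V \<in> Linfty_on \<Omega> \<Longrightarrow> potential_form \<Omega> V (c *\<^sub>R u) w = c * potential_form \<Omega> V u w"
  by (simp add: potential_form_eq_inner multiply_scale)

lemma potential_form_sym: "potential_form \<Omega> V u v = potential_form \<Omega> V v u"
  by (simp add: potential_form_def mult_ac)

lemma potential_form_bounded:
  assumes V: "V \<in> Linfty_on \<Omega>"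
  obtains C where "0 \<le> C" "\<And>u v. \<bar>potential_form \<Omega> V u v\<bar> \<le> C * norm u * norm v"
proof -
  obtain C where C: "0 \<le> C" "\<And>u. norm (multiply \<Omega> V u) \<le> C * norm u"
    using square_integrable_multiply(2)[OF V] by blast
  have "\<bar>potential_form \<Omega> V u v\<bar> \<le> C * norm u * norm v" for u v
    unfolding potential_form_eq_inner[OF V]
    using Cauchy_Schwarz_ineq2[of "multiply \<Omega> V u" v] mult_right_mono[OF C(2)[of u] norm_ge_zero[of v]]
    by linarith
  then show ?thesis using that C(1) by blast
qed

lemma Linfty_on_add:
  assumes "V \<in> Linfty_on \<Omega>" "W \<in> Linfty_on \<Omega>"
  shows "(\<lambda>x. V x + W x) \<in> Linfty_on \<Omega>"
proof -
  obtain C D where CD: "AE x\<in>\<Omega> in lebesgue. \<bar>V x\<bar> \<le> C" "AE x\<in>\<Omega> in lebesgue. \<bar>W x\<bar> \<le> D"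
    using assms by (auto simp: Linfty_on_def)
  then have "AE x\<in>\<Omega> in lebesgue. \<bar>V x + W x\<bar> \<le> C + D"
    by eventually_elim (auto intro: order_trans[OF abs_triangle_ineq] add_mono)
  moreover have "set_borel_measurable lebesgue \<Omega> (\<lambda>x. V x + W x)"
    using assms unfolding Linfty_on_def set_borel_measurable_def
    by (simp add: distrib_left borel_measurable_add)
  ultimately show ?thesis by (auto simp: Linfty_on_def)
qed

lemma potential_form_add_potential:
  assumes "V \<in> Linfty_on \<Omega>" "W \<in> Linfty_on \<Omega>"
  shows "potential_form \<Omega> (\<lambda>x. V x + W x) u v = potential_form \<Omega> V u v + potential_form \<Omega> W u v"
  using set_integral_add(2)[OF set_integrable_potential[OF assms(1)] set_integrable_potential[OF assms(2)], of u v u v]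
  by (simp add: potential_form_def distrib_right)

subsection \<open>The energy inner product\<close>

locale schroedinger = bounded_domain \<Omega> for \<Omega> :: "'a::euclidean_space set" +
  fixes V1 V2 :: "'a \<Rightarrow> real"
  assumes V1: "V1 \<in> Linfty_on \<Omega>" and V2: "V2 \<in> Linfty_on \<Omega>"
    and V1_nonneg: "AE x\<in>\<Omega> in lebesgue. 0 \<le> V1 x"
begin

abbreviation "A \<equiv> energy_form \<Omega> V1"

lemma energy_form_eq:
  assumes "u \<in> H1 \<Omega>" "V \<in> Linfty_on \<Omega>"
  shows "energy_form \<Omega> V u v = grad_form u v + potential_form \<Omega> V u v"
  unfolding energy_form_def potential_form_def
  using set_integral_add(2)[OF set_integral_weak_grad(1)[OF assms(1)] set_integrable_potential[OF assms(2)]]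
    set_integral_weak_grad(2)[OF assms(1)] by simp

lemma potential_V1_nonneg: "0 \<le> potential_form \<Omega> V1 u u"
  unfolding potential_form_def set_lebesgue_integral_def
proof (rule integral_nonneg_AE)
  show "AE x in lebesgue. 0 \<le> indicat_real \<Omega> x *\<^sub>R (V1 x * rep_L2 u x * rep_L2 u x)"
    using V1_nonneg by eventually_elim (auto simp: indicator_def mult.assoc)
qed

lemma grad_form_le_A: "u \<in> H10 \<Omega> \<Longrightarrow> grad_form u u \<le> A u u"
  using energy_form_eq[OF _ V1, of u u] potential_V1_nonneg[of u] H10_subset_H1 by auto

lemma inner_form_A: "inner_form (H10 \<Omega>) A"
proof unfold_locales
  show "subspace (H10 \<Omega>)" by (rule subspace_H10)
  note sub = subspace_H10 and E = energy_form_eq[OF _ V1] and mem = subsetD[OF H10_subset_H1]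
  fix u v w :: "'a L2" and c assume u: "u \<in> H10 \<Omega>"
  show "0 < A u u" if "u \<noteq> 0"
  proof -
    obtain C where C: "0 < C" "\<And>u. u \<in> H10 \<Omega> \<Longrightarrow> norm u \<le> C * sqrt (grad_form u u)"
      by (rule Poincare) (rule that)
    have "grad_form u u \<noteq> 0" using C(2)[OF u] \<open>u \<noteq> 0\<close> by auto
    then show ?thesis using grad_form_nonneg[of u] grad_form_le_A[OF u] by linarith
  qed
  assume w: "w \<in> H10 \<Omega>"
  show "A (c *\<^sub>R u) w = c * A u w"
    using mem[OF u] mem[OF w] mem[OF subspace_scale[OF sub u]]
    by (simp add: E grad_form_scale potential_form_scale_left[OF V1] distrib_left)
  assume v: "v \<in> H10 \<Omega>"
  show "A (u + v) w = A u w + A v w"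
    using mem[OF u] mem[OF v] mem[OF w] mem[OF subspace_add[OF sub u v]]
    by (simp add: E grad_form_add potential_form_add_left[OF V1])
next
  fix u v :: "'a L2" assume "u \<in> H10 \<Omega>" "v \<in> H10 \<Omega>"
  then have "u \<in> H1 \<Omega>" "v \<in> H1 \<Omega>" using H10_subset_H1 by auto
  then show "A u v = A v u"
    using energy_form_eq[OF _ V1] grad_form_sym[of u v] potential_form_sym[of \<Omega> V1 u v] by simp
qed

sublocale A: inner_form "H10 \<Omega>" A by (rule inner_form_A)

lemma norm_A_eq: "norm_A \<Omega> V1 = A.nrm"
  by (rule ext) (simp add: norm_A_def A.nrm_def)

lemma sqrt_grad_le: "u \<in> H10 \<Omega> \<Longrightarrow> sqrt (grad_form u u) \<le> A.nrm u"
  using grad_form_le_A by (simp add: A.nrm_def)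

lemma norm_le_A:
  obtains C where "0 < C" "\<And>u. u \<in> H10 \<Omega> \<Longrightarrow> norm u \<le> C * A.nrm u"
proof -
  obtain C where C: "0 < C" "\<And>u. u \<in> H10 \<Omega> \<Longrightarrow> norm u \<le> C * sqrt (grad_form u u)"
    by (rule Poincare) (rule that)
  have "norm u \<le> C * A.nrm u" if "u \<in> H10 \<Omega>" for u
    using C(2)[OF that] mult_left_mono[OF sqrt_grad_le[OF that], of C] C(1) by linarith
  then show ?thesis using that C(1) by blast
qed

text \<open>
  The Poincare inequality gives the first bound and the boundedness of \<open>V\<^sub>1\<close> the second; completeness is
  thereby inherited from \<open>H1 \<Omega>\<close>.
\<close>

lemma A_equivalent_H1:
  obtains c C where "0 < c" "0 < C"
    "\<And>u. u \<in> H10 \<Omega> \<Longrightarrow> H1.nrm u \<le> c * A.nrm u" "\<And>u. u \<in> H10 \<Omega> \<Longrightarrow> A.nrm u \<le> C * H1.nrm u"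
proof -
  obtain C where C: "0 < C" "\<And>u. u \<in> H10 \<Omega> \<Longrightarrow> norm u \<le> C * A.nrm u"
    by (rule norm_le_A) (rule that)
  obtain D where D: "0 \<le> D" "\<And>u v. \<bar>potential_form \<Omega> V1 u v\<bar> \<le> D * norm u * norm v"
    by (rule potential_form_bounded[OF V1]) (rule that)
  have "H1.nrm u \<le> (C + 1) * A.nrm u" if u: "u \<in> H10 \<Omega>" for u
  proof (rule power2_le_imp_le)
    have "(H1.nrm u)\<^sup>2 = (norm u)\<^sup>2 + grad_form u u"
      using u H10_subset_H1 by (auto simp: H1.nrm_square H1_form_def power2_norm_eq_inner)
    also have "\<dots> \<le> (C * A.nrm u)\<^sup>2 + (A.nrm u)\<^sup>2"
      using C(2)[OF u] grad_form_le_A[OF u] A.nrm_square[OF u] by (intro add_mono power_mono) auto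
    also have "\<dots> \<le> ((C + 1) * A.nrm u)\<^sup>2"
      using C(1) A.nrm_nonneg[OF u] by (simp add: power_mult_distrib power2_sum distrib_right)
    finally show "(H1.nrm u)\<^sup>2 \<le> ((C + 1) * A.nrm u)\<^sup>2" .
  qed (use C(1) A.nrm_nonneg[OF u] in auto)
  moreover have "A.nrm u \<le> (D + 1) * H1.nrm u" if u: "u \<in> H10 \<Omega>" for u
  proof (rule power2_le_imp_le)
    have uH: "u \<in> H1 \<Omega>" using u H10_subset_H1 by auto
    have "(A.nrm u)\<^sup>2 = grad_form u u + potential_form \<Omega> V1 u u"
      using energy_form_eq[OF uH V1] A.nrm_square[OF u] by simp
    also have "\<dots> \<le> grad_form u u + D * (norm u)\<^sup>2"
      using D(2)[of u u] by (simp add: power2_eq_square mult.assoc)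
    also have "\<dots> \<le> (H1.nrm u)\<^sup>2 + D * (H1.nrm u)\<^sup>2"
    proof (intro add_mono mult_left_mono power_mono norm_le_H1[OF uH])
      show "grad_form u u \<le> (H1.nrm u)\<^sup>2"
        using uH by (simp add: H1.nrm_square H1_form_def)
    qed (use D(1) in auto)
    also have "\<dots> \<le> ((D + 1) * H1.nrm u)\<^sup>2"
    proof -
      have "1 + D \<le> (D + 1)\<^sup>2" using D(1) by (simp add: power2_eq_square distrib_left)
      from mult_right_mono[OF this, of "(H1.nrm u)\<^sup>2"] show ?thesis
        unfolding power_mult_distrib by (simp add: distrib_right)
    qed
    finally show "(A.nrm u)\<^sup>2 \<le> ((D + 1) * H1.nrm u)\<^sup>2" .
  qed (use D(1) H1.nrm_nonneg u H10_subset_H1 in auto)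
  ultimately show ?thesis using that[of "C + 1" "D + 1"] C(1) D(1) by auto
qed

lemma hilbert_form_A: "hilbert_form (H10 \<Omega>) A"
proof unfold_locales
  interpret HH: hilbert_form "H1 \<Omega>" H1_form by (rule hilbert_form_H1)
  obtain c C where c: "0 < c" "0 < C"
    "\<And>u. u \<in> H10 \<Omega> \<Longrightarrow> H1.nrm u \<le> c * A.nrm u" "\<And>u. u \<in> H10 \<Omega> \<Longrightarrow> A.nrm u \<le> C * H1.nrm u"
    by (rule A_equivalent_H1) (rule that)
  fix s :: "nat \<Rightarrow> 'a L2"
  assume s: "\<And>n. s n \<in> H10 \<Omega>" and cauchy: "\<And>e. 0 < e \<Longrightarrow> \<exists>N. \<forall>m\<ge>N. \<forall>n\<ge>N. A.nrm (s m - s n) < e"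
  have mem: "s m - s n \<in> H10 \<Omega>" for m n using s by auto
  have "\<exists>l\<in>H1 \<Omega>. (\<lambda>n. H1.nrm (s n - l)) \<longlonglongrightarrow> 0"
  proof (rule HH.complete)
    show "s n \<in> H1 \<Omega>" for n using s H10_subset_H1 by auto
    fix e :: real assume "0 < e"
    then obtain N where N: "\<forall>m\<ge>N. \<forall>n\<ge>N. A.nrm (s m - s n) < e / c"
      using cauchy[of "e / c"] c(1) by auto
    have "H1.nrm (s m - s n) < e" if "m \<ge> N" "n \<ge> N" for m n
    proof -
      have "c * A.nrm (s m - s n) < e" using N that c(1) by (simp add: field_simps)
      then show ?thesis using c(3)[OF mem[of m n]] by linarith
    qed
    then show "\<exists>N. \<forall>m\<ge>N. \<forall>n\<ge>N. H1.nrm (s m - s n) < e" by blast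
  qed
  then obtain l where l: "l \<in> H1 \<Omega>" "(\<lambda>n. H1.nrm (s n - l)) \<longlonglongrightarrow> 0" by blast
  have l10: "l \<in> H10 \<Omega>" by (rule H10_closed[OF s l])
  have "(\<lambda>n. A.nrm (s n - l)) \<longlonglongrightarrow> 0"
  proof (rule tendsto_sandwich[of "\<lambda>_. 0" _ _ "\<lambda>n. C * H1.nrm (s n - l)"])
    show "(\<lambda>n. C * H1.nrm (s n - l)) \<longlonglongrightarrow> 0" using tendsto_mult_right_zero[OF l(2)] .
    show "\<forall>\<^sub>F n in sequentially. A.nrm (s n - l) \<le> C * H1.nrm (s n - l)"
      using c(4) s l10 by (intro always_eventually) auto
    show "\<forall>\<^sub>F n in sequentially. 0 \<le> A.nrm (s n - l)"
      using s l10 by (intro always_eventually allI A.nrm_nonneg) auto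
  qed simp
  then show "\<exists>l\<in>H10 \<Omega>. (\<lambda>n. A.nrm (s n - l)) \<longlonglongrightarrow> 0" using l10 by blast
qed

text \<open>
  In the bound of \<open>b w v\<close> by the \<open>L\<^sup>2\<close> norms, the Poincare inequality is applied to \<open>v\<close> and Rellich's estimate
  to \<open>w\<close>; by Riesz the cell averages of \<open>w\<close> are functionals \<open>a f w\<close>.
\<close>

lemma compact_form_A: "compact_form (H10 \<Omega>) A (potential_form \<Omega> V2)"
proof -
  interpret AA: hilbert_form "H10 \<Omega>" A by (rule hilbert_form_A)
  show ?thesis
  proof unfold_locales
    fix \<epsilon> :: real assume \<epsilon>: "0 < \<epsilon>"
    obtain C where C: "0 < C" "\<And>u. u \<in> H10 \<Omega> \<Longrightarrow> norm u \<le> C * A.nrm u"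
      by (rule norm_le_A) (rule that)
    obtain D0 where D0: "0 \<le> D0" "\<And>u v. \<bar>potential_form \<Omega> V2 u v\<bar> \<le> D0 * norm u * norm v"
      by (rule potential_form_bounded[OF V2]) (rule that)
    define D where "D = D0 * C + 1"
    have D: "0 < D" using D0(1) C(1) by (simp add: D_def add_nonneg_pos)
    have b: "\<bar>potential_form \<Omega> V2 w v\<bar> \<le> D * norm w * A.nrm v" if v: "v \<in> H10 \<Omega>" for w v
    proof -
      have "D0 * norm w * norm v \<le> D0 * norm w * (C * A.nrm v)"
        using C(2)[OF v] D0(1) by (intro mult_left_mono) auto
      also have "\<dots> = D0 * C * (norm w * A.nrm v)" by simp
      also have "\<dots> \<le> D * (norm w * A.nrm v)"
        using A.nrm_nonneg[OF v] by (intro mult_right_mono) (auto simp: D_def)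
      finally show ?thesis using D0(2)[of w v] by (simp add: mult.assoc)
    qed
    obtain I :: "'a set" and g where I: "finite I"
      and g: "\<And>u. u \<in> H10 \<Omega> \<Longrightarrow> norm u \<le> \<epsilon> / D * sqrt (grad_form u u) + (\<Sum>c\<in>I. \<bar>inner (g c) u\<bar>)"
      by (rule Rellich[of "\<epsilon> / D"]) (use \<epsilon> D in simp, rule that)
    have bounded: "\<bar>inner (D *\<^sub>R g c) u\<bar> \<le> (norm (D *\<^sub>R g c) * C) * A.nrm u" if u: "u \<in> H10 \<Omega>" for c u
      using Cauchy_Schwarz_ineq2[of "D *\<^sub>R g c" u] mult_left_mono[OF C(2)[OF u], of "norm (D *\<^sub>R g c)"]
      by (simp add: mult.assoc)
    define f where "f c = represent (H10 \<Omega>) A (inner (D *\<^sub>R g c))" for c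
    have f: "f c \<in> H10 \<Omega>" "\<And>v. v \<in> H10 \<Omega> \<Longrightarrow> A (f c) v = inner (D *\<^sub>R g c) v" for c
      unfolding f_def
      by (rule AA.Riesz_representation[OF _ _ bounded]; simp add: inner_add_right)+
    obtain F where F: "finite F" "F \<subseteq> H10 \<Omega>"
      "\<And>w. w \<in> H10 \<Omega> \<Longrightarrow> (\<Sum>c\<in>I. \<bar>A (f c) w\<bar>) \<le> (\<Sum>v\<in>F. \<bar>A v w\<bar>)"
      by (rule A.indexed_functionals_as_set[OF I f(1)]) (rule that)
    have "\<bar>potential_form \<Omega> V2 w v\<bar> \<le> (\<epsilon> * A.nrm w + (\<Sum>f\<in>F. \<bar>A f w\<bar>)) * A.nrm v"
      if w: "w \<in> H10 \<Omega>" and v: "v \<in> H10 \<Omega>" for w v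
    proof -
      have "\<epsilon> / D * sqrt (grad_form w w) \<le> \<epsilon> / D * A.nrm w"
        using sqrt_grad_le[OF w] \<epsilon> D by (intro mult_left_mono) auto
      with g[OF w] have "norm w \<le> \<epsilon> / D * A.nrm w + (\<Sum>c\<in>I. \<bar>inner (g c) w\<bar>)" by linarith
      from mult_left_mono[OF this, of D] D
      have "D * norm w \<le> \<epsilon> * A.nrm w + (\<Sum>c\<in>I. \<bar>A (f c) w\<bar>)"
        by (simp add: distrib_left sum_distrib_left f(2)[OF w] abs_mult)
      with F(3)[OF w] have "D * norm w \<le> \<epsilon> * A.nrm w + (\<Sum>f\<in>F. \<bar>A f w\<bar>)" by linarith
      from mult_right_mono[OF this A.nrm_nonneg[OF v]] b[OF v, of w] show ?thesis by linarith
    qed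
    then show "\<exists>F. finite F \<and> F \<subseteq> H10 \<Omega> \<and> (\<forall>w\<in>H10 \<Omega>. \<forall>v\<in>H10 \<Omega>.
        \<bar>potential_form \<Omega> V2 w v\<bar> \<le> (\<epsilon> * A.nrm w + (\<Sum>f\<in>F. \<bar>A f w\<bar>)) * A.nrm v)"
      using F(1,2) by blast
  qed (auto simp: potential_form_add_left[OF V2] potential_form_scale_left[OF V2] intro: potential_form_sym)
qed

sublocale compact_form "H10 \<Omega>" A "potential_form \<Omega> V2" by (rule compact_form_A)

subsection \<open>The operators of the problem\<close>

lemma op_K_eq: "op_K \<Omega> V1 V2 = K"
  by (rule ext) (simp add: op_K_def weak_solve_def K_def)

lemma op_Kh_eq: "op_Kh \<Omega> V1 V2 W = Kh W"
  by (rule ext) (simp add: op_Kh_def Kh_def)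

lemma op_Kt_eq: "op_Kt \<Omega> V1 V2 W u = proj W (K (proj W u))"
  by (simp add: op_Kt_def proj_A_def proj_def op_K_eq)

lemma op_T_eq:
  assumes "u \<in> H10 \<Omega>"
  shows "op_T \<Omega> V1 V2 u = u + K u"
  unfolding op_T_def weak_solve_def
  using assms K_mem a_K by (intro A.represent_eqI) (auto simp: A.a_add_left)

text \<open>
  The Galerkin operator of \<open>- \<Delta> + V\<^sub>1\<close> is injective on \<open>W\<close>, and it maps \<open>u + Kh W u\<close> to the image of \<open>u\<close> under
  the Galerkin operator of \<open>- \<Delta> + V\<^sub>1 + V\<^sub>2\<close>, since both represent the same functional in \<open>L\<^sup>2\<close>.
\<close>

lemma op_Th_eq:
  assumes W: "trial_space W" and u: "u \<in> W"
  shows "op_Th \<Omega> V1 V2 W u = u + Kh W u"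
proof -
  note Ws = W_sub[OF W]
  interpret L: inner_form W "inner :: 'a L2 \<Rightarrow> 'a L2 \<Rightarrow> real"
    by unfold_locales (simp_all add: Ws(1) inner_add_left, rule inner_commute)
  have fd: "represent W inner F \<in> W" "\<And>v. v \<in> W \<Longrightarrow> inner (represent W inner F) v = F v"
    if "\<And>u v. \<lbrakk>u \<in> W; v \<in> W\<rbrakk> \<Longrightarrow> F (u + v) = F u + F v" "\<And>u c. u \<in> W \<Longrightarrow> F (c *\<^sub>R u) = c * F u" for F
    using L.represent_finite_dim[OF Ws(1,2) order_refl that] by auto
  interpret W: inner_form W A by (rule A.subspace_inner_form[OF Ws(1,3)])
  have G: "galerkin_V1 \<Omega> V1 W w \<in> W" "\<And>v. v \<in> W \<Longrightarrow> inner (galerkin_V1 \<Omega> V1 W w) v = A w v"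
    if "w \<in> W" for w
    unfolding galerkin_V1_def using that by (intro fd; simp add: W.a_simps)+
  have inj: "inj_on (galerkin_V1 \<Omega> V1 W) W"
  proof (rule inj_onI)
    fix w w' assume w: "w \<in> W" "w' \<in> W" and eq: "galerkin_V1 \<Omega> V1 W w = galerkin_V1 \<Omega> V1 W w'"
    show "w = w'"
    proof (rule W.representer_unique[OF w])
      show "A w v = A w' v" if "v \<in> W" for v
        using G(2)[OF w(1) that] G(2)[OF w(2) that] eq by simp
    qed
  qed
  have uH: "u \<in> H10 \<Omega>" using u Ws(3) by blast
  have w: "u + Kh W u \<in> W" using u Kh_mem[OF W uH] by auto
  have "galerkin_V1_V2 \<Omega> V1 V2 W u = galerkin_V1 \<Omega> V1 W (u + Kh W u)"
    unfolding galerkin_V1_V2_def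
  proof (rule L.represent_eqI[OF G(1)[OF w]])
    fix v assume v: "v \<in> W"
    show "inner (galerkin_V1 \<Omega> V1 W (u + Kh W u)) v = A u v + potential_form \<Omega> V2 u v"
      using G(2)[OF w v] a_Kh[OF W uH v] W.a_add_left[OF u Kh_mem[OF W uH] v] by simp
  qed
  then show ?thesis unfolding op_Th_def using inv_into_f_f[OF inj w] by simp
qed

lemma cond_number_eq:
  assumes "W \<subseteq> H10 \<Omega>" and S: "\<And>u. u \<in> W \<Longrightarrow> A (S u) u = A u u + potential_form \<Omega> V2 u u"
  shows "cond_number \<Omega> V1 W S = (SUP u\<in>{u \<in> W. A.nrm u = 1}. A u u + potential_form \<Omega> V2 u u) /
    (INF u\<in>{u \<in> W. A.nrm u = 1}. A u u + potential_form \<Omega> V2 u u)"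
proof -
  have "(\<lambda>u. A (S u) u) ` {u \<in> W. A.nrm u = 1} = (\<lambda>u. A u u + potential_form \<Omega> V2 u u) ` {u \<in> W. A.nrm u = 1}"
    using S by (intro image_cong) auto
  then show ?thesis unfolding cond_number_def mu_max_def mu_min_def norm_A_eq by simp
qed

end

theorem theorem3p4:
  fixes \<Omega> :: "'a::euclidean_space set"
    and V1 V2 :: "'a \<Rightarrow> real"
    and X :: "real \<Rightarrow> 'a L2 set"
  assumes domain: "open \<Omega>" "connected \<Omega>" "\<Omega> \<noteq> {}" "bounded \<Omega>"
    and potentials: "V1 \<in> Linfty_on \<Omega>" "V2 \<in> Linfty_on \<Omega>"
    and V1_nonneg: "AE x\<in>\<Omega> in lebesgue. 0 \<le> V1 x"
    and conforming: "\<forall>h>0. subspace (X h) \<and> finite_dim (X h) \<and> X h \<subseteq> H10 \<Omega>"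
    and asymptotically_dense: "\<forall>u\<in>H10 \<Omega>.
      ((\<lambda>h. INF v\<in>X h. norm_A \<Omega> V1 (u - v)) \<longlongrightarrow> 0) (at_right 0)"
  shows
    "(\<forall>u\<in>H10 \<Omega>. op_T \<Omega> V1 V2 u = u + op_K \<Omega> V1 V2 u) \<and>
     (\<forall>h>0. \<forall>u\<in>X h. op_Th \<Omega> V1 V2 (X h) u = u + op_Kh \<Omega> V1 V2 (X h) u) \<and>

     \<comment> \<open>norm convergence\<close>
     ((\<lambda>h. opnorm_A \<Omega> V1 (\<lambda>u. op_Kt \<Omega> V1 V2 (X h) u - op_K \<Omega> V1 V2 u)) \<longlongrightarrow> 0)
       (at_right 0) \<and>

     \<comment> \<open>clustering\<close>
     (\<forall>\<epsilon>>0. \<exists>M::nat. \<forall>h>0.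
        let E = eigenvalues (X h) (op_Th \<Omega> V1 V2 (X h)) - {1 - \<epsilon><..<1 + \<epsilon>}
        in finite E \<and> (\<Sum>\<nu>\<in>E. multiplicity_of (X h) (op_Th \<Omega> V1 V2 (X h)) \<nu>) \<le> M) \<and>

     \<comment> \<open>spectral convergence: near \<open>\<mu>\<close>, the eigenvalues of \<open>K\<^sub>h\<close> with multiplicity are
        exactly \<open>ev 0 h, \<dots>, ev (m - 1) h\<close>\<close>
     (\<forall>\<mu>\<in>eigenvalues (H10 \<Omega>) (op_K \<Omega> V1 V2). \<mu> \<noteq> 0 \<longrightarrow>
        finite_dim (eigenspace (H10 \<Omega>) (op_K \<Omega> V1 V2) \<mu>) \<and>
        (let m = multiplicity_of (H10 \<Omega>) (op_K \<Omega> V1 V2) \<mu>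
         in \<exists>\<delta>>0. \<exists>ev :: nat \<Rightarrow> real \<Rightarrow> real.
              (\<forall>j<m. (ev j \<longlongrightarrow> \<mu>) (at_right 0)) \<and>
              (\<forall>\<^sub>F h in at_right 0. \<forall>\<nu>. \<bar>\<nu> - \<mu>\<bar> < \<delta> \<longrightarrow>
                 multiplicity_of (X h) (op_Kh \<Omega> V1 V2 (X h)) \<nu> = card {j. j < m \<and> ev j h = \<nu>}))) \<and>

     \<comment> \<open>uniform condition number\<close>
     ((\<forall>u\<in>H10 \<Omega>. u \<noteq> 0 \<longrightarrow> 0 < energy_form \<Omega> (\<lambda>x. V1 x + V2 x) u u) \<longrightarrow>
        (\<forall>h>0. X h \<noteq> {0} \<longrightarrow>
           cond_number \<Omega> V1 (X h) (op_Th \<Omega> V1 V2 (X h))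
             \<le> cond_number \<Omega> V1 (H10 \<Omega>) (op_T \<Omega> V1 V2)) \<and>
        ((\<lambda>h. cond_number \<Omega> V1 (X h) (op_Th \<Omega> V1 V2 (X h))) \<longlongrightarrow>
           cond_number \<Omega> V1 (H10 \<Omega>) (op_T \<Omega> V1 V2)) (at_right 0))"
  proof -
  interpret schroedinger \<Omega> V1 V2
    using domain potentials V1_nonneg by unfold_locales auto
  have trial_X: "trial_space (X h)" if "0 < h" for h
    using conforming that by (simp add: trial_space_def)
  have pos_h: "\<forall>\<^sub>F h in at_right 0. 0 < (h::real)"
    by (simp add: eventually_at_filter)
  interpret galerkin "H10 \<Omega>" A "potential_form \<Omega> V2" X "at_right 0"
  proof unfold_locales
    show "\<forall>\<^sub>F h in at_right 0. trial_space (X h)"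
      using pos_h by eventually_elim (rule trial_X)
    show "((\<lambda>h. INF v\<in>X h. A.nrm (u - v)) \<longlongrightarrow> 0) (at_right 0)" if "u \<in> H10 \<Omega>" for u
      using asymptotically_dense that unfolding norm_A_eq by blast
  qed
  have continuous_operator: "\<forall>u\<in>H10 \<Omega>. op_T \<Omega> V1 V2 u = u + op_K \<Omega> V1 V2 u"
    using op_T_eq op_K_eq by simp
  have discrete_operator: "\<forall>h>0. \<forall>u\<in>X h. op_Th \<Omega> V1 V2 (X h) u = u + op_Kh \<Omega> V1 V2 (X h) u"
    using op_Th_eq op_Kh_eq trial_X by simp
  have norm_convergence:
    "((\<lambda>h. opnorm_A \<Omega> V1 (\<lambda>u. op_Kt \<Omega> V1 V2 (X h) u - op_K \<Omega> V1 V2 u)) \<longlongrightarrow> 0) (at_right 0)"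
  proof (rule order_tendstoI)
    fix y :: ennreal assume y: "0 < y"
    obtain z where z: "0 < z" "z < y" using dense[OF y] by blast
    then obtain \<eta> where \<eta>: "z = ennreal \<eta>" "0 < \<eta>" by (cases z) auto
    show "\<forall>\<^sub>F h in at_right 0. opnorm_A \<Omega> V1 (\<lambda>u. op_Kt \<Omega> V1 V2 (X h) u - op_K \<Omega> V1 V2 u) < y"
      using proj_K_proj_tendsto[OF \<eta>(2)]
    proof eventually_elim
      case (elim h)
      have "opnorm_A \<Omega> V1 (\<lambda>u. op_Kt \<Omega> V1 V2 (X h) u - op_K \<Omega> V1 V2 u) \<le> z"
        unfolding opnorm_A_def op_Kt_eq op_K_eq norm_A_eq \<eta>(1)
      proof (rule SUP_least)
        fix u assume "u \<in> {u \<in> H10 \<Omega>. A.nrm u \<le> 1}"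
        then have u: "u \<in> H10 \<Omega>" "A.nrm u \<le> 1" by auto
        have "A.nrm (proj (X h) (K (proj (X h) u)) - K u) \<le> \<eta> * A.nrm u" using elim u(1) by blast
        also have "\<dots> \<le> \<eta>" using u(2) \<eta>(2) by (simp add: mult_left_le)
        finally show "ennreal (A.nrm (proj (X h) (K (proj (X h) u)) - K u)) \<le> ennreal \<eta>"
          by (rule ennreal_leI)
      qed
      then show ?case using z(2) by simp
    qed
  qed simp
  have clusters: "\<exists>M::nat. \<forall>h>0.
      let E = eigenvalues (X h) (op_Th \<Omega> V1 V2 (X h)) - {1 - \<epsilon><..<1 + \<epsilon>}
      in finite E \<and> (\<Sum>\<nu>\<in>E. multiplicity_of (X h) (op_Th \<Omega> V1 V2 (X h)) \<nu>) \<le> M" if "0 < \<epsilon>" for \<epsilon>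
  proof -
    obtain M :: nat where M: "\<And>W S. trial_space W \<Longrightarrow> (\<forall>u\<in>W. S u = u + Kh W u) \<Longrightarrow>
      (let E = eigenvalues W S - {1 - \<epsilon><..<1 + \<epsilon>}
       in finite E \<and> (\<Sum>\<nu>\<in>E. multiplicity_of W S \<nu>) \<le> M)"
      using clustering[OF \<open>0 < \<epsilon>\<close>] by blast
    show ?thesis using M[OF trial_X] op_Th_eq[OF trial_X] by blast
  qed
  have spectrum: "finite_dim (eigenspace (H10 \<Omega>) (op_K \<Omega> V1 V2) \<mu>) \<and>
      (let m = multiplicity_of (H10 \<Omega>) (op_K \<Omega> V1 V2) \<mu>
       in \<exists>\<delta>>0. \<exists>ev :: nat \<Rightarrow> real \<Rightarrow> real.
            (\<forall>j<m. (ev j \<longlongrightarrow> \<mu>) (at_right 0)) \<and>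
            (\<forall>\<^sub>F h in at_right 0. \<forall>\<nu>. \<bar>\<nu> - \<mu>\<bar> < \<delta> \<longrightarrow>
               multiplicity_of (X h) (op_Kh \<Omega> V1 V2 (X h)) \<nu> = card {j. j < m \<and> ev j h = \<nu>}))"
    if "\<mu> \<noteq> 0" for \<mu>
    unfolding op_K_eq op_Kh_eq Let_def
    using eigenspace_K_finite_dim[OF that] spectral_convergence[OF that] by blast
  have condition: "(\<forall>h>0. X h \<noteq> {0} \<longrightarrow> cond_number \<Omega> V1 (X h) (op_Th \<Omega> V1 V2 (X h))
        \<le> cond_number \<Omega> V1 (H10 \<Omega>) (op_T \<Omega> V1 V2)) \<and>
      ((\<lambda>h. cond_number \<Omega> V1 (X h) (op_Th \<Omega> V1 V2 (X h))) \<longlongrightarrow>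
        cond_number \<Omega> V1 (H10 \<Omega>) (op_T \<Omega> V1 V2)) (at_right 0)"
    if positive: "\<forall>u\<in>H10 \<Omega>. u \<noteq> 0 \<longrightarrow> 0 < energy_form \<Omega> (\<lambda>x. V1 x + V2 x) u u"
  proof -
    have pos: "0 < A u u + potential_form \<Omega> V2 u u" if "u \<in> H10 \<Omega>" "u \<noteq> 0" for u
    proof -
      have "u \<in> H1 \<Omega>" using that H10_subset_H1 by blast
      then have "energy_form \<Omega> (\<lambda>x. V1 x + V2 x) u u = A u u + potential_form \<Omega> V2 u u"
        by (simp add: energy_form_eq Linfty_on_add V1 V2 potential_form_add_potential)
      then show ?thesis using positive[rule_format, OF that] by (simp only:)
    qed
    have cT: "cond_number \<Omega> V1 (H10 \<Omega>) (op_T \<Omega> V1 V2) = cond (H10 \<Omega>)"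
      unfolding cond_def sphere_in_def rayleigh_def
      by (rule cond_number_eq) (auto simp: op_T_eq A.a_add_left K_mem a_K)
    have cTh: "cond_number \<Omega> V1 (X h) (op_Th \<Omega> V1 V2 (X h)) = cond (X h)" if "0 < h" for h
      unfolding cond_def sphere_in_def rayleigh_def
    proof (rule cond_number_eq)
      note Ws = W_sub[OF trial_X[OF that]]
      show "X h \<subseteq> H10 \<Omega>" by (rule Ws(3))
      fix u assume u: "u \<in> X h"
      then have uH: "u \<in> H10 \<Omega>" "Kh (X h) u \<in> H10 \<Omega>"
        using Ws(3) Kh_mem[OF trial_X[OF that]] by auto
      show "A (op_Th \<Omega> V1 V2 (X h) u) u = A u u + potential_form \<Omega> V2 u u"
        using uH a_Kh[OF trial_X[OF that] uH(1) u] by (simp add: op_Th_eq[OF trial_X[OF that] u] A.a_add_left)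
    qed
    have "\<forall>h>0. X h \<noteq> {0} \<longrightarrow> cond (X h) \<le> cond (H10 \<Omega>)"
      using cond_le[OF pos] trial_X by blast
    moreover have "((\<lambda>h. cond (X h)) \<longlongrightarrow> cond (H10 \<Omega>)) (at_right 0)"
      by (rule cond_tendsto[OF pos])
    then have "((\<lambda>h. cond_number \<Omega> V1 (X h) (op_Th \<Omega> V1 V2 (X h))) \<longlongrightarrow> cond (H10 \<Omega>)) (at_right 0)"
      by (rule Lim_transform_eventually) (use pos_h in \<open>eventually_elim, simp add: cTh\<close>)
    ultimately show ?thesis unfolding cT using cTh by simp
  qed
  show ?thesis
    by (intro conjI, rule continuous_operator, rule discrete_operator, rule norm_convergence,
        rule allI, rule impI, erule clusters, rule ballI, rule impI, erule spectrum,
        rule impI, erule condition)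
qed

end
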